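(* There exists $\eta>0$ such that if $F\in\mathcal E_{2,\eta}$, then $$\overline{\operatorname{Span}}\{e_\lambda F:\ \lambda\in\mathbb C\}=\mathcal E F\cap\mathcal F.$$
   Context: $\mathcal E$ is the space of all entire functions on $\mathbb C$, and $\mathcal E F=\{hF:h\in\mathcal E\}$. For $\eta\ge0$, $\mathcal E_{2,\eta}$ is the class of entire functions $F$ with $\limsup_{|z|\to\infty}\frac{\log|F(z)|}{|z|^2}\le\eta$. $\mathcal F$ is the Fock space of entire functions $F$ with $\|F\|^2_{\mathcal F}=\frac1\pi\int_{\mathbb C}|F(z)|^2e^{-\pi|z|^2}\,dm(z)<\infty$, $m$ being area Lebesgue measure. $e_\lambda(z)=e^{\lambda z}$, and $\overline{\operatorname{Span}}$ denotes the closure in $\mathcal F$ of the linear span. *)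

theory Defs
  imports "HOL-Complex_Analysis.Complex_Analysis" "HOL-Library.Function_Algebras"
begin

definition entire_functions :: "(complex \<Rightarrow> complex) set"
  where "entire_functions = {h. h holomorphic_on UNIV}"

definition entire_multiples :: "(complex \<Rightarrow> complex) \<Rightarrow> (complex \<Rightarrow> complex) set"
  where "entire_multiples F = {\<lambda>z. h z * F z | h. h \<in> entire_functions}"

text \<open>The logarithm on $[0,\infty)$ with $\log 0 = -\infty$; the library function
  \<^const>\<open>ln\<close> has \<open>ln 0 = 0\<close>.\<close>

definition ext_log :: "real \<Rightarrow> ereal"
  where "ext_log x = (if x = 0 then - \<infinity> else ereal (ln x))"

definition entire_order_two :: "real \<Rightarrow> (complex \<Rightarrow> complex) set"
  where "entire_order_two \<eta> = {F \<in> entire_functions.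
    Limsup at_infinity (\<lambda>z. ext_log (cmod (F z)) / ereal ((cmod z)\<^sup>2)) \<le> ereal \<eta>}"

definition fock_space :: "(complex \<Rightarrow> complex) set"
  where "fock_space = {F \<in> entire_functions.
    integrable lborel (\<lambda>z. (cmod (F z))\<^sup>2 * exp (- pi * (cmod z)\<^sup>2))}"

definition fock_norm :: "(complex \<Rightarrow> complex) \<Rightarrow> real"
  where "fock_norm F =
    sqrt (1 / pi * (LINT z|lborel. (cmod (F z))\<^sup>2 * exp (- pi * (cmod z)\<^sup>2)))"

definition fock_dist :: "(complex \<Rightarrow> complex) \<Rightarrow> (complex \<Rightarrow> complex) \<Rightarrow> real"
  where "fock_dist F G = fock_norm (\<lambda>z. F z - G z)"

definition fun_scale :: "complex \<Rightarrow> (complex \<Rightarrow> complex) \<Rightarrow> complex \<Rightarrow> complex"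
  where "fun_scale c F = (\<lambda>z. c * F z)"

text \<open>Vector addition on functions is the pointwise one of
  \<^theory>\<open>HOL-Library.Function_Algebras\<close>.\<close>

global_interpretation cfun: vector_space fun_scale
  by unfold_locales (auto simp: fun_scale_def fun_eq_iff algebra_simps)

definition exp_fun :: "complex \<Rightarrow> complex \<Rightarrow> complex"
  where "exp_fun l = (\<lambda>z. exp (l * z))"

text \<open>The closure is taken in the topology of the metric induced by the Fock norm.\<close>

lemma fock_norm_nonneg: "0 \<le> fock_norm F"
  unfolding fock_norm_def by simp

lemma fock_norm_0: "fock_norm (\<lambda>z. 0) = 0"
  unfolding fock_norm_def by simp

lemma fock_norm_power2:
  "(fock_norm F)\<^sup>2 = 1 / pi * (LINT z|lborel. (cmod (F z))\<^sup>2 * exp (- pi * (cmod z)\<^sup>2))"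
  unfolding fock_norm_def by simp

lemma fock_norm_uminus: "fock_norm (\<lambda>z. - F z) = fock_norm F"
  unfolding fock_norm_def by simp

lemma cmod_add_power2_le:
  assumes "t > 0"
  shows "(cmod (a + b))\<^sup>2 \<le> (1 + t) * (cmod a)\<^sup>2 + (1 + 1 / t) * (cmod b)\<^sup>2"
proof -
  have "(cmod (a + b))\<^sup>2 \<le> (cmod a + cmod b)\<^sup>2"
    by (intro power_mono norm_triangle_ineq) auto
  also have "\<dots> = (1 + t) * (cmod a)\<^sup>2 + (1 + 1 / t) * (cmod b)\<^sup>2 - (t * cmod a - cmod b)\<^sup>2 / t"
    using assms by (simp add: field_simps power2_eq_square)
  also have "\<dots> \<le> (1 + t) * (cmod a)\<^sup>2 + (1 + 1 / t) * (cmod b)\<^sup>2"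
    using assms by simp
  finally show ?thesis .
qed

lemma fock_space_add:
  assumes F: "F \<in> fock_space" and G: "G \<in> fock_space"
  shows "(\<lambda>z. F z + G z) \<in> fock_space"
proof -
  define w where "w = (\<lambda>z::complex. exp (- pi * (cmod z)\<^sup>2))"
  have hF: "F holomorphic_on UNIV" and hG: "G holomorphic_on UNIV"
    and iF: "integrable lborel (\<lambda>z. (cmod (F z))\<^sup>2 * w z)"
    and iG: "integrable lborel (\<lambda>z. (cmod (G z))\<^sup>2 * w z)"
    using F G by (auto simp: fock_space_def entire_functions_def w_def)
  have "integrable lborel (\<lambda>z. (cmod (F z + G z))\<^sup>2 * w z)"
  proof (rule Bochner_Integration.integrable_bound)
    show "integrable lborel (\<lambda>z. 2 * ((cmod (F z))\<^sup>2 * w z) + 2 * ((cmod (G z))\<^sup>2 * w z))"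
      using iF iG by simp
    have "continuous_on UNIV F" "continuous_on UNIV G"
      by (simp_all add: hF hG holomorphic_on_imp_continuous_on)
    hence "continuous_on UNIV (\<lambda>z. (cmod (F z + G z))\<^sup>2 * w z)"
      unfolding w_def by (intro continuous_intros)
    thus "(\<lambda>z. (cmod (F z + G z))\<^sup>2 * w z) \<in> borel_measurable lborel"
      by (simp add: borel_measurable_continuous_onI)
    have "norm ((cmod (F z + G z))\<^sup>2 * w z)
        \<le> norm (2 * ((cmod (F z))\<^sup>2 * w z) + 2 * ((cmod (G z))\<^sup>2 * w z))" for z
    proof -
      have "w z > 0" by (simp add: w_def)
      hence "(cmod (F z + G z))\<^sup>2 * w z \<le> (2 * (cmod (F z))\<^sup>2 + 2 * (cmod (G z))\<^sup>2) * w z"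
        using cmod_add_power2_le[of 1 "F z" "G z"] by (intro mult_right_mono) auto
      thus ?thesis using \<open>w z > 0\<close> by (simp add: algebra_simps)
    qed
    thus "AE z in lborel. norm ((cmod (F z + G z))\<^sup>2 * w z)
        \<le> norm (2 * ((cmod (F z))\<^sup>2 * w z) + 2 * ((cmod (G z))\<^sup>2 * w z))"
      by simp
  qed
  moreover have "(\<lambda>z. F z + G z) holomorphic_on UNIV"
    by (intro holomorphic_intros hF hG)
  ultimately show ?thesis
    by (simp add: fock_space_def entire_functions_def w_def)
qed

lemma fock_space_uminus: "F \<in> fock_space \<Longrightarrow> (\<lambda>z. - F z) \<in> fock_space"
  by (simp add: fock_space_def entire_functions_def holomorphic_on_minus)

lemma fock_space_diff:
  assumes "F \<in> fock_space" "G \<in> fock_space"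
  shows "(\<lambda>z. F z - G z) \<in> fock_space"
  using fock_space_add[OF assms(1) fock_space_uminus[OF assms(2)]] by simp

lemma fock_norm_eq_0_iff:
  assumes F: "F \<in> fock_space"
  shows "fock_norm F = 0 \<longleftrightarrow> F = (\<lambda>z. 0)"
proof
  assume "fock_norm F = 0"
  hence "(LINT z|lborel. (cmod (F z))\<^sup>2 * exp (- pi * (cmod z)\<^sup>2)) = 0"
    using fock_norm_power2[of F] by simp
  hence "AE z in lborel. (cmod (F z))\<^sup>2 * exp (- pi * (cmod z)\<^sup>2) = 0"
    using F by (subst (asm) integral_nonneg_eq_0_iff_AE) (auto simp: fock_space_def)
  hence ae: "AE z in lebesgue. F z = 0"
    by (intro AE_completion) simp
  have "continuous_on UNIV F"
    using F by (simp add: fock_space_def entire_functions_def holomorphic_on_imp_continuous_on)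
  hence op: "open {z. F z \<noteq> 0}"
    by (intro open_Collect_neq continuous_on_const)
  have "{z. F z \<noteq> 0} \<in> null_sets lebesgue"
    using AE_iff_null_sets[of "{z. F z \<noteq> 0}" lebesgue] ae op by simp
  hence "{z. F z \<noteq> 0} = {}"
    using open_not_negligible[OF op] negligible_iff_null_sets by blast
  thus "F = (\<lambda>z. 0)" by auto
next
  assume "F = (\<lambda>z. 0)"
  thus "fock_norm F = 0" by (simp add: fock_norm_0)
qed

lemma fock_norm_triangle:
  assumes F: "F \<in> fock_space" and G: "G \<in> fock_space"
  shows "fock_norm (\<lambda>z. F z + G z) \<le> fock_norm F + fock_norm G"
proof (cases "fock_norm F = 0 \<or> fock_norm G = 0")
  case True
  thus ?thesis
    using F G by (auto simp: fock_norm_eq_0_iff fock_norm_0)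
next
  case False
  define w where "w = (\<lambda>z::complex. exp (- pi * (cmod z)\<^sup>2))"
  define a b where "a = fock_norm F" and "b = fock_norm G"
  have ab: "a > 0" "b > 0"
    using False fock_norm_nonneg[of F] fock_norm_nonneg[of G] by (auto simp: a_def b_def)
  define t where "t = b / a"
  have t: "t > 0" using ab by (simp add: t_def)
  have iF: "integrable lborel (\<lambda>z. (cmod (F z))\<^sup>2 * w z)"
    and iG: "integrable lborel (\<lambda>z. (cmod (G z))\<^sup>2 * w z)"
    and iFG: "integrable lborel (\<lambda>z. (cmod (F z + G z))\<^sup>2 * w z)"
    using F G fock_space_add[OF F G] by (auto simp: fock_space_def w_def)
  have "(LINT z|lborel. (cmod (F z + G z))\<^sup>2 * w z)
      \<le> (LINT z|lborel. (1 + t) * ((cmod (F z))\<^sup>2 * w z) + (1 + 1 / t) * ((cmod (G z))\<^sup>2 * w z))"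
  proof (rule integral_mono)
    fix z
    have "(cmod (F z + G z))\<^sup>2 * w z
        \<le> ((1 + t) * (cmod (F z))\<^sup>2 + (1 + 1 / t) * (cmod (G z))\<^sup>2) * w z"
      using cmod_add_power2_le[OF t, of "F z" "G z"]
      by (intro mult_right_mono) (auto simp: w_def)
    thus "(cmod (F z + G z))\<^sup>2 * w z
        \<le> (1 + t) * ((cmod (F z))\<^sup>2 * w z) + (1 + 1 / t) * ((cmod (G z))\<^sup>2 * w z)"
      by (simp add: algebra_simps)
  qed (use iF iG iFG in auto)
  also have "\<dots> = (1 + t) * (LINT z|lborel. (cmod (F z))\<^sup>2 * w z)
      + (1 + 1 / t) * (LINT z|lborel. (cmod (G z))\<^sup>2 * w z)"
    using iF iG by simp
  finally have "1 / pi * (LINT z|lborel. (cmod (F z + G z))\<^sup>2 * w z)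
      \<le> 1 / pi * ((1 + t) * (LINT z|lborel. (cmod (F z))\<^sup>2 * w z)
      + (1 + 1 / t) * (LINT z|lborel. (cmod (G z))\<^sup>2 * w z))"
    by (intro mult_left_mono) auto
  hence "(fock_norm (\<lambda>z. F z + G z))\<^sup>2 \<le> (1 + t) * a\<^sup>2 + (1 + 1 / t) * b\<^sup>2"
    unfolding a_def b_def fock_norm_power2 w_def by (simp add: algebra_simps add_divide_distrib)
  also have "\<dots> = (a + b)\<^sup>2"
    using ab by (simp add: t_def field_simps power2_eq_square)
  finally have "fock_norm (\<lambda>z. F z + G z) \<le> a + b"
    by (rule power2_le_imp_le) (use ab in linarith)
  thus ?thesis by (simp only: a_def b_def)
qed

global_interpretation Fock: Metric_space fock_space fock_dist
proof
  show "0 \<le> fock_dist F G" for F G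
    by (simp add: fock_dist_def fock_norm_nonneg)
  show "fock_dist F G = fock_dist G F" for F G
    using fock_norm_uminus[of "\<lambda>z. F z - G z"] by (simp add: fock_dist_def)
  show "fock_dist F G = 0 \<longleftrightarrow> F = G" if "F \<in> fock_space" "G \<in> fock_space" for F G
    using fock_norm_eq_0_iff[OF fock_space_diff[OF that]] by (auto simp: fock_dist_def fun_eq_iff)
  show "fock_dist F H \<le> fock_dist F G + fock_dist G H"
    if "F \<in> fock_space" "G \<in> fock_space" "H \<in> fock_space" for F G H
    using fock_norm_triangle[OF fock_space_diff[OF that(1,2)] fock_space_diff[OF that(2,3)]]
    by (simp add: fock_dist_def)
qed

end

theory Submission
  imports Defs
begin

text \<open>
  One inclusion is soft. Convergence in the Fock norm is locally uniform, and if $h_n F$ converges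
  uniformly near a circle on which $F$ has no zero, then $h_n$ converges uniformly on the disc by the
  maximum principle; so limits of multiples of $F$ are multiples of $F$
  (\<open>entire_multiples_closed\<close>).

  For the other inclusion suppose that $hF$ lies in the Fock space but not in the closed span. Hilbert
  space projection (\<open>fock_orthogonal_complement\<close>) gives $g$ in the Fock space with
  $\langle e_\lambda F, g\rangle = 0$ for all $\lambda$ and $\langle hF, g\rangle \neq 0$. Put
  \[ K(w) = \langle hF, g\rangle + w \Bigl\langle \frac{h(z)-h(w)}{z-w} F(z), g\Bigr\rangle . \]
  This is \<open>interpolant F g h\<close>, an entire function with $K(0) \neq 0$. It has finite order-two type because quotients of
  functions of finite type have it too (\<open>order_two_quotient\<close>). The plan is to show that $K$ is small in mean on most of
  every large disc, which no such $K$ can be.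

  \<^emph>\<open>Smallness.\<close> Orthogonality allows $h(w)F(z)$ to be replaced by $h(w) e^{\lambda(z-w)} F(z)$ in
  the definition of $K(w)$, with $\lambda$ depending on $w$. If $\log|F|$ is touched from above at $w$
  by a paraboloid of opening 1, that is, if $|F(z)|e^{-|z-y|^2}$ is maximal at $z = w$ for some $y$,
  then a suitable $\lambda$ makes $e^{\lambda(z-w)}F(z)$, weighted by $e^{-\pi|z|^2/2}$, at most the
  value of the weighted $|F|$ at $w$ times a Gaussian centred at $w$
  (\<open>contact_exp_bound\<close>). Since
  $hF$ and $g$ are square integrable against the weight, $K$ is then $o(1)$ in mean over the touching
  points in a disc of radius $\rho \to \infty$ (\<open>interpolation_integral_bound\<close>).

  \<^emph>\<open>Touching points are abundant.\<close> Slide a paraboloid with vertex $y$ down until it touches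
  $\log|F|$ at $w$. Then $y$ is determined by $w$ through the gradient of $\log|F|$. As $\log|F|$ is
  harmonic near $w$, the two eigenvalues of its Hessian are opposite, and touching bounds them by the
  opening; so the map from $w$ to $y$ has Jacobian in $[0,1]$, and the touching points occupy at least the area of
  the set of vertices (\<open>contact_set_area\<close>). When the type of $F$ is small, a three-circles estimate
  shows that $w$ is close to $y$ relative to the radius of the disc, so nearly the whole disc consists
  of touching points (\<open>contact_set_nearly_full\<close>).

  \<^emph>\<open>Largeness.\<close> The same area estimate applied to $K$, on a disc of radius $R$ around which the maximum
  modulus grows tamely, shows that $|K| > 1$ on a fixed proportion of the disc of radius $3R$, once $K$ is
  normalised to have $|K(0)| > 1$ (\<open>superlevel_area\<close>). This proportion exceeds what the
  complement of the touching points can cover, and the contradiction follows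
  (\<open>fock_inner_multiple_eq_0\<close>).
\<close>

section \<open>Areas of images under planar maps\<close>

lemma entire_continuous: "f holomorphic_on UNIV \<Longrightarrow> continuous_on S f"
  using holomorphic_on_imp_continuous_on holomorphic_on_subset by blast

text \<open>
  The map $h \mapsto \alpha h + \beta \bar h$ has determinant $|\alpha|^2 - |\beta|^2$ as a
  real-linear map of the plane. Transport along the isometry with $\mathbb{R}^2$ makes the change of
  variables estimate for Jacobian matrices applicable.
\<close>
lemma measure_le_of_subset_image:
  fixes f :: "complex \<Rightarrow> complex" and \<alpha> \<beta> :: "complex \<Rightarrow> complex"
  assumes V: "V \<in> sets borel" and E: "E \<in> sets borel" "bounded E"
    and der: "\<And>w. w \<in> E \<Longrightarrow> (f has_derivative (\<lambda>h. \<alpha> w * h + \<beta> w * cnj h)) (at w)"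
    and jac: "\<And>w. w \<in> E \<Longrightarrow> \<bar>(cmod (\<alpha> w))^2 - (cmod (\<beta> w))^2\<bar> \<le> 1"
    and sub: "V \<subseteq> f ` E"
  shows "emeasure lborel V \<le> emeasure lborel E"
proof -
  define \<phi> :: "complex \<Rightarrow> real^2" where "\<phi> z = vector [Re z, Im z]" for z
  define \<psi> :: "real^2 \<Rightarrow> complex" where "\<psi> x = Complex (x$1) (x$2)" for x
  have \<psi>\<phi> [simp]: "\<psi> (\<phi> z) = z" for z by (simp add: \<phi>_def \<psi>_def)
  have \<phi>\<psi> [simp]: "\<phi> (\<psi> x) = x" for x by (simp add: \<phi>_def \<psi>_def vec_eq_iff forall_2)
  have lin\<phi>: "linear \<phi>"
    by (rule linearI) (auto simp: \<phi>_def vec_eq_iff forall_2)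
  have lin\<psi>: "linear \<psi>"
    by (rule linearI) (auto simp: \<psi>_def complex_eq_iff)
  have bl\<phi>: "bounded_linear \<phi>" and bl\<psi>: "bounded_linear \<psi>"
    using lin\<phi> lin\<psi> by (simp_all add: linear_conv_bounded_linear)
  have m\<phi> [measurable]: "\<phi> \<in> borel_measurable borel"
    by (intro borel_measurable_continuous_onI linear_continuous_on bl\<phi>)
  have m\<psi> [measurable]: "\<psi> \<in> borel_measurable borel"
    by (intro borel_measurable_continuous_onI linear_continuous_on bl\<psi>)
  have img: "\<phi> ` S = \<psi> -` S" for S
    by (force simp: image_iff) 
  have eq: "lborel = distr lborel borel \<psi>"
  proof (rule lborel_eqI)
    fix l u :: complex
    assume le: "\<And>b. b \<in> Basis \<Longrightarrow> l \<bullet> b \<le> u \<bullet> b"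
    have "\<psi> -` box l u = box (\<phi> l) (\<phi> u)"
      by (auto simp: \<psi>_def \<phi>_def in_box_complex_iff mem_box_cart(1) forall_2)
    moreover have "Re l \<le> Re u" "Im l \<le> Im u"
      using le[of 1] le[of \<i>] by (auto simp: Basis_complex_def)
    ultimately show "emeasure (distr lborel borel \<psi>) (box l u) = ennreal (\<Prod>b\<in>Basis. (u - l) \<bullet> b)"
      by (simp add: emeasure_distr emeasure_lborel_box_eq Basis_complex_def Basis_vec_def axis_eq_axis
           UNIV_2 \<phi>_def inner_axis prod.insert_if)
  qed simp
  have em: "emeasure lborel (\<phi> ` S) = emeasure lborel S" if "S \<in> sets borel" for S
  proof -
    have "emeasure lborel S = emeasure (distr lborel borel \<psi>) S"
      by (simp flip: eq)
    also have "\<dots> = emeasure lborel (\<phi> ` S)"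
      using that by (simp add: emeasure_distr img)
    finally show ?thesis by simp
  qed
  have Bor: "\<phi> ` S \<in> sets borel" if "S \<in> sets borel" for S
    using measurable_sets[OF m\<psi>, of S] that by (simp add: img)
  define S where "S = \<phi> ` E"
  have bS: "bounded S" unfolding S_def using E(2) bl\<phi> by (rule bounded_linear_image)
  have Sl: "S \<in> lmeasurable"
    using Bor[OF E(1)] bS unfolding S_def[symmetric]
    by (intro bounded_set_imp_lmeasurable) auto
  define D where "D x h = \<phi> (\<alpha> (\<psi> x) * \<psi> h + \<beta> (\<psi> x) * cnj (\<psi> h))" for x h
  have dD: "((\<phi> \<circ> f \<circ> \<psi>) has_derivative D x) (at x within S)" if "x \<in> S" for x
  proof -
    have "\<psi> x \<in> E" using that by (auto simp: S_def)
    hence "(\<phi> \<circ> f \<circ> \<psi> has_derivative (\<phi> \<circ> (\<lambda>h. \<alpha> (\<psi> x) * h + \<beta> (\<psi> x) * cnj h) \<circ> \<psi>)) (at x)"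
      by (intro diff_chain_at bounded_linear_imp_has_derivative bl\<psi> bl\<phi>) (auto intro: der)
    thus ?thesis by (auto simp: D_def[abs_def] comp_def intro: has_derivative_at_withinI)
  qed
  have det: "\<bar>det (matrix (D x))\<bar> \<le> 1" if "x \<in> S" for x
  proof -
    have xE: "\<psi> x \<in> E" using that by (auto simp: S_def)
    have "det (matrix (D x)) = (cmod (\<alpha> (\<psi> x)))^2 - (cmod (\<beta> (\<psi> x)))^2"
      unfolding det_2 matrix_def D_def cmod_power2
      by (simp add: \<phi>_def \<psi>_def axis_def power2_eq_square algebra_simps)
    thus ?thesis using jac[OF xE] by simp
  qed
  have int: "(\<lambda>x. \<bar>det (matrix (D x))\<bar>) integrable_on S"
  proof (rule measurable_bounded_by_integrable_imp_integrable)
    show "(\<lambda>x. \<bar>det (matrix (D x))\<bar>) \<in> borel_measurable (lebesgue_on S)"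
      using Sl dD by (intro borel_measurable_abs borel_measurable_det_Jacobian) (auto simp: fmeasurableD)
    show "(\<lambda>x. 1 :: real) integrable_on S"
      using Sl by (simp add: lmeasurable_iff_integrable_on)
  qed (use Sl det in \<open>auto simp: fmeasurableD\<close>)
  have *: "(\<phi> \<circ> f \<circ> \<psi>) ` S \<in> lmeasurable \<and> measure lebesgue ((\<phi> \<circ> f \<circ> \<psi>) ` S) \<le> 1 * measure lebesgue S"
    using measurable_bounded_differentiable_image[OF Sl dD int det]
      measure_bounded_differentiable_image[OF Sl dD int det] by blast
  have sub': "\<phi> ` V \<subseteq> (\<phi> \<circ> f \<circ> \<psi>) ` S"
    using sub by (force simp: S_def image_iff)
  have "emeasure lborel V = emeasure lebesgue (\<phi> ` V)"
    using em[OF V] Bor[OF V] by simp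
  also have "\<dots> \<le> emeasure lebesgue ((\<phi> \<circ> f \<circ> \<psi>) ` S)"
    using * sub' by (intro emeasure_mono) (auto simp: fmeasurable_def)
  also have "\<dots> \<le> emeasure lebesgue S"
    using * Sl by (subst (1 2) emeasure_eq_measure2) auto
  also have "\<dots> = emeasure lborel E"
    using em[OF E(1)] Bor[OF E(1)] by (simp add: S_def)
  finally show ?thesis .
qed

lemma emeasure_disc: "r \<ge> 0 \<Longrightarrow> emeasure lborel (ball (c::complex) r) = ennreal (pi * r^2)"
  by (simp add: emeasure_ball unit_ball_vol_2)

section \<open>Touching the modulus of an entire function by Gaussians\<close>

lemma le_of_le_add_small_multiple:
  fixes x A C :: real
  assumes "d > 0" and "\<And>t. 0 < t \<Longrightarrow> t < d \<Longrightarrow> x \<le> A + t * C"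
  shows "x \<le> A"
proof (rule tendsto_lowerbound)
  show "((\<lambda>t. A + t * C) \<longlongrightarrow> A) (at_right 0)"
    by (auto intro!: tendsto_eq_intros)
  show "eventually (\<lambda>t. x \<le> A + t * C) (at_right 0)"
    using assms by (auto simp: eventually_at_right_field)
qed simp

lemma ex_unit_mult_eq_cmod: "\<exists>u. cmod u = 1 \<and> n * u = of_real (cmod n)"
proof (cases "n = 0")
  case False
  have "n * (cnj n / of_real (cmod n)) = of_real (cmod n)"
    using False complex_norm_square[of n] by (simp add: field_simps power2_eq_square)
  thus ?thesis using False by (intro exI[of _ "cnj n / of_real (cmod n)"]) (auto simp: norm_divide)
qed (auto intro: exI[of _ 1])

text \<open>
  Compare the second order Taylor polynomials of $N$ and of the Gaussian: choosing the argument of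
  $\zeta$ so that the linear, then the quadratic, term of $N$ is real and positive shows that the
  linear term vanishes and that the quadratic coefficient has modulus at most $a$.
\<close>
lemma touching_gaussian_derivs:
  assumes hol: "N holomorphic_on UNIV" and N0: "N 0 = 1" and a: "a > 0" and e: "e > 0"
    and le: "\<And>\<zeta>. cmod \<zeta> < e \<Longrightarrow> cmod (N \<zeta>) \<le> exp (a * (cmod \<zeta>)^2)"
  shows "deriv N 0 = 0" and "cmod (deriv (deriv N) 0) \<le> 2 * a"
proof -
  define n1 n2 where "n1 = deriv N 0" and "n2 = deriv (deriv N) 0 / 2"
  have holn: "(deriv ^^ i) N holomorphic_on UNIV" for i
    by (rule holomorphic_higher_deriv[OF hol]) simp
  have "continuous_on (cball 0 1) ((deriv ^^ 3) N)"
    using holn[of 3] holomorphic_on_imp_continuous_on holomorphic_on_subset by blast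
  hence "bounded ((deriv ^^ 3) N ` cball 0 1)"
    by (intro compact_imp_bounded compact_continuous_image) auto
  then obtain B where B: "\<And>x. x \<in> cball 0 1 \<Longrightarrow> cmod ((deriv ^^ 3) N x) \<le> B"
    unfolding bounded_iff by (metis imageI)
  have B0: "B \<ge> 0" using B[of 0] by (auto intro: order_trans[OF norm_ge_zero])
  have taylor: "cmod (N \<zeta> - (1 + n1 * \<zeta> + n2 * \<zeta>^2)) \<le> B * cmod \<zeta> ^ 3" if "cmod \<zeta> \<le> 1" for \<zeta>
  proof -
    have "cmod ((deriv ^^ 0) N \<zeta> - (\<Sum>i\<le>2. (deriv ^^ i) N 0 * (\<zeta> - 0) ^ i / fact i))
        \<le> B * cmod (\<zeta> - 0) ^ Suc 2 / fact 2"
    proof (rule complex_Taylor[of "cball 0 1"])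
      show "((deriv ^^ i) N has_field_derivative (deriv ^^ Suc i) N x) (at x within cball 0 1)" for i x
        using holn[of i] by (auto intro!: holomorphic_derivI[where S = UNIV] simp del: funpow.simps simp add: funpow.simps(2))
    qed (use B that in \<open>auto simp: numeral_3_eq_3 numeral_2_eq_2\<close>)
    moreover have "B * cmod \<zeta> ^ 3 / 2 \<le> B * cmod \<zeta> ^ 3"
      using B0 by simp
    ultimately show ?thesis
      by (simp add: N0 n1_def n2_def numeral_2_eq_2 numeral_3_eq_3)
  qed
  \<comment> \<open>the bound 1/a keeps a t^2 below 1, where the exponential is at most 1 + x + x^2\<close>
  define d where "d = min e (min 1 (1 / a))"
  have d: "d > 0" "d \<le> e" "d \<le> 1" "d \<le> 1 / a" using e a by (auto simp: d_def)
  have key: "Re (n1 * \<zeta>) + Re (n2 * \<zeta>^2) \<le> a * (cmod \<zeta>)^2 + (a^2 + B) * cmod \<zeta> ^ 3"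
    if \<zeta>: "cmod \<zeta> < d" for \<zeta>
  proof -
    let ?t = "cmod \<zeta>"
    have t: "?t \<le> 1" "?t < e" "?t \<le> 1 / a" using \<zeta> d by auto
    have "a * ?t^2 \<le> a * ?t" using t a by (simp add: power2_eq_square mult_left_le)
    also have "\<dots> \<le> 1" using t a by (simp add: field_simps)
    finally have "exp (a * ?t^2) \<le> 1 + a * ?t^2 + (a * ?t^2)^2"
      using a by (intro exp_bound) auto
    moreover have "(a * ?t^2)^2 \<le> a^2 * ?t ^ 3"
    proof -
      have "(a * ?t^2)^2 = (a^2 * ?t ^ 3) * ?t" by (simp add: power2_eq_square power3_eq_cube)
      also have "\<dots> \<le> a^2 * ?t ^ 3" using t by (intro mult_left_le) auto
      finally show ?thesis .
    qed
    moreover have "Re (1 + n1 * \<zeta> + n2 * \<zeta>^2) \<le> cmod (N \<zeta>) + cmod (N \<zeta> - (1 + n1 * \<zeta> + n2 * \<zeta>^2))"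
      using complex_Re_le_cmod[of "1 + n1 * \<zeta> + n2 * \<zeta>^2"]
        norm_triangle_sub[of "1 + n1 * \<zeta> + n2 * \<zeta>^2" "N \<zeta>"]
        norm_minus_commute[of "N \<zeta>" "1 + n1 * \<zeta> + n2 * \<zeta>^2"] by linarith
    moreover note taylor[OF t(1)] le[OF t(2)]
    moreover have "(a^2 + B) * ?t ^ 3 = a^2 * ?t ^ 3 + B * ?t ^ 3" by (rule distrib_right)
    moreover have "Re (1 + n1 * \<zeta> + n2 * \<zeta>^2) = 1 + Re (n1 * \<zeta>) + Re (n2 * \<zeta>^2)" by simp
    ultimately show ?thesis by linarith
  qed
  have "cmod n1 \<le> 0"
  proof (rule le_of_le_add_small_multiple[OF d(1)])
    fix t :: real assume t: "0 < t" "t < d"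
    obtain u where u: "cmod u = 1" "n1 * u = of_real (cmod n1)"
      using ex_unit_mult_eq_cmod by blast
    define \<zeta> where "\<zeta> = of_real t * u"
    have \<zeta>: "cmod \<zeta> = t" using t u by (simp add: \<zeta>_def norm_mult)
    have "n1 * \<zeta> = of_real (t * cmod n1)"
      using u(2) by (simp add: \<zeta>_def mult.left_commute)
    hence 1: "Re (n1 * \<zeta>) = t * cmod n1" by (metis Re_complex_of_real)
    have "- Re (n2 * \<zeta>^2) \<le> cmod (n2 * \<zeta>^2)" using abs_Re_le_cmod[of "n2 * \<zeta>^2"] by linarith
    also have "\<dots> = cmod n2 * t^2" by (simp add: norm_mult norm_power \<zeta>)
    finally have "t * cmod n1 \<le> cmod n2 * t^2 + a * t^2 + (a^2 + B) * t ^ 3"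
      using key[of \<zeta>] \<zeta> t 1 by simp
    also have "\<dots> \<le> cmod n2 * t^2 + a * t^2 + (a^2 + B) * t^2"
      using t d B0 by (intro add_left_mono mult_left_mono) (auto simp: power2_eq_square power3_eq_cube mult_left_le)
    finally have "t * cmod n1 \<le> t * (0 + t * (cmod n2 + a + (a^2 + B)))"
      by (simp add: algebra_simps power2_eq_square)
    thus "cmod n1 \<le> 0 + t * (cmod n2 + a + (a^2 + B))"
      using t by (simp only: mult_le_cancel_left_pos)
  qed
  hence n1: "n1 = 0" by simp
  thus "deriv N 0 = 0" by (simp add: n1_def)
  have "cmod n2 \<le> a"
  proof (rule le_of_le_add_small_multiple[OF d(1)])
    fix t :: real assume t: "0 < t" "t < d"
    obtain v where v: "cmod v = 1" "n2 * v = of_real (cmod n2)"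
      using ex_unit_mult_eq_cmod by blast
    define \<zeta> where "\<zeta> = of_real t * csqrt v"
    have \<zeta>: "cmod \<zeta> = t" using t v by (simp add: \<zeta>_def norm_mult norm_csqrt)
    have "n2 * \<zeta>^2 = of_real (t^2 * cmod n2)"
      using v(2) by (simp add: \<zeta>_def power_mult_distrib mult.left_commute)
    hence "Re (n2 * \<zeta>^2) = t^2 * cmod n2" by (metis Re_complex_of_real)
    hence "t^2 * cmod n2 \<le> a * t^2 + (a^2 + B) * t ^ 3"
      using key[of \<zeta>] \<zeta> t n1 by simp
    hence "t^2 * cmod n2 \<le> t^2 * (a + t * (a^2 + B))"
      by (simp add: algebra_simps power2_eq_square power3_eq_cube)
    thus "cmod n2 \<le> a + t * (a^2 + B)"
      using t by (simp only: mult_le_cancel_left_pos zero_less_power)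
  qed
  thus "cmod (deriv (deriv N) 0) \<le> 2 * a" by (simp add: n2_def norm_divide)
qed

text \<open>
  At a maximum $w$ of $\log|f(z)| - a|z-y|^2$ the gradients agree. The gradient of $\log|f|$, read
  as a complex number, is the conjugate of $f'/f$; solving for $y$ gives this formula.
\<close>
definition foot :: "(complex \<Rightarrow> complex) \<Rightarrow> real \<Rightarrow> complex \<Rightarrow> complex" where
  "foot f a w = w - cnj (deriv f w / f w) / of_real (2 * a)"

text \<open>
  Equivalently, the paraboloid $a|z-y|^2 + c$ with the right constant $c$ lies above $\log|f|$ on
  $D$ and meets it at $w$. The multiplicative form needs no convention for $\log 0$.
\<close>
definition touches :: "(complex \<Rightarrow> complex) \<Rightarrow> real \<Rightarrow> complex set \<Rightarrow> complex \<Rightarrow> complex \<Rightarrow> bool" where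
  "touches f a D y w \<longleftrightarrow> f w \<noteq> 0 \<and>
     (\<forall>z\<in>D. cmod (f z) * exp (- a * (cmod (z - y))^2) \<le> cmod (f w) * exp (- a * (cmod (w - y))^2))"

text \<open>
  Dividing $f$ by its value at $w$ and by an exponential that absorbs the linear part of $a|z-y|^2$
  leaves a function with value 1 that is dominated by $e^{a|\zeta|^2}$. Its first derivative gives
  the position of the vertex, its second derivative is $(f'/f)'(w)$.
\<close>
lemma touches_imp:
  assumes hol: "f holomorphic_on UNIV" and a: "a > 0" and tc: "touches f a D y w"
    and w: "w \<in> interior D"
  shows "y = foot f a w"
    and "cmod (deriv (deriv f) w / f w - (deriv f w / f w)^2) \<le> 2 * a"
proof -
  have fw: "f w \<noteq> 0" using tc by (simp add: touches_def)
  obtain e where e: "e > 0" "ball w e \<subseteq> D"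
    using w by (meson mem_interior)
  \<comment> \<open>the exponential with this c removes the linear part of a|z-y|^2 at w\<close>
  define c where "c = of_real (2 * a) * cnj (w - y)"
  define N where "N = (\<lambda>\<zeta>. exp (- c * \<zeta>) * f (w + \<zeta>) / f w)"
  have df: "(f has_field_derivative deriv f z) (at z)" for z
    using hol by (auto intro: holomorphic_derivI[where S = UNIV])
  have ddf: "(deriv f has_field_derivative deriv (deriv f) z) (at z)" for z
    using holomorphic_deriv[OF hol] by (auto intro: holomorphic_derivI[where S = UNIV])
  have dN: "(N has_field_derivative exp (- c * \<zeta>) * (deriv f (w + \<zeta>) - c * f (w + \<zeta>)) / f w) (at \<zeta>)" for \<zeta>
    unfolding N_def using fw
    by (auto intro!: derivative_eq_intros DERIV_chain2[OF df] simp: field_simps)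
  have ddN: "((\<lambda>\<zeta>. exp (- c * \<zeta>) * (deriv f (w + \<zeta>) - c * f (w + \<zeta>)) / f w) has_field_derivative
      exp (- c * \<zeta>) * (deriv (deriv f) (w + \<zeta>) - 2 * c * deriv f (w + \<zeta>) + c^2 * f (w + \<zeta>)) / f w) (at \<zeta>)" for \<zeta>
    using fw
    by (auto intro!: derivative_eq_intros DERIV_chain2[OF df] DERIV_chain2[OF ddf] simp: field_simps power2_eq_square)
  have deN: "deriv N = (\<lambda>\<zeta>. exp (- c * \<zeta>) * (deriv f (w + \<zeta>) - c * f (w + \<zeta>)) / f w)"
    using dN by (auto intro: DERIV_imp_deriv)
  have holN: "N holomorphic_on UNIV"
    using dN by (auto simp: holomorphic_on_open)
  have leN: "cmod (N \<zeta>) \<le> exp (a * (cmod \<zeta>)^2)" if "cmod \<zeta> < e" for \<zeta>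
  proof -
    have "w + \<zeta> \<in> D" using that e(2) by (auto simp: dist_norm)
    hence "cmod (f (w + \<zeta>)) * exp (- a * (cmod (w + \<zeta> - y))^2) \<le> cmod (f w) * exp (- a * (cmod (w - y))^2)"
      using tc by (auto simp: touches_def)
    hence "cmod (f (w + \<zeta>)) \<le> cmod (f w) * exp (a * (cmod (w + \<zeta> - y))^2 - a * (cmod (w - y))^2)"
      by (simp add: exp_diff exp_minus field_simps)
    also have "a * (cmod (w + \<zeta> - y))^2 - a * (cmod (w - y))^2 = a * (cmod \<zeta>)^2 + Re (c * \<zeta>)"
      unfolding cmod_power2 by (simp add: c_def power2_eq_square algebra_simps)
    finally have "cmod (f (w + \<zeta>)) / cmod (f w) \<le> exp (a * (cmod \<zeta>)^2 + Re (c * \<zeta>))"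
      using fw by (simp add: field_simps)
    hence "exp (- Re (c * \<zeta>)) * (cmod (f (w + \<zeta>)) / cmod (f w)) \<le> exp (- Re (c * \<zeta>)) * exp (a * (cmod \<zeta>)^2 + Re (c * \<zeta>))"
      by (intro mult_left_mono) auto
    also have "\<dots> = exp (a * (cmod \<zeta>)^2)" by (simp flip: exp_add)
    finally show ?thesis by (simp add: N_def norm_mult norm_divide)
  qed
  have N0: "N 0 = 1" using fw by (simp add: N_def)
  note T = touching_gaussian_derivs[OF holN N0 a e(1) leN]
  have c: "deriv f w = c * f w" using T(1) fw by (simp add: deN)
  hence "deriv f w / f w = c" using fw by simp
  thus "y = foot f a w" using a by (simp add: foot_def c_def)
  have "deriv (deriv N) 0 = deriv (deriv f) w / f w - (deriv f w / f w)^2"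
    using DERIV_imp_deriv[OF ddN[of 0]] fw
    by (simp add: deN c field_simps power2_eq_square)
  thus "cmod (deriv (deriv f) w / f w - (deriv f w / f w)^2) \<le> 2 * a"
    using T(2) by simp
qed

text \<open>
  The vertex is determined by the touching point, so no quantifier over vertices is needed; this
  makes measurability evident.
\<close>
definition contact_set :: "(complex \<Rightarrow> complex) \<Rightarrow> real \<Rightarrow> complex set \<Rightarrow> complex set" where
  "contact_set f a D = {w. touches f a D (foot f a w) w}"

text \<open>
  Away from the zeros of $f$ the set is cut out by closed conditions, one for each point of $D$.
\<close>
lemma borel_contact_set:
  assumes hol: "f holomorphic_on UNIV" and a: "a > 0"
  shows "contact_set f a D \<in> sets borel"
proof -
  define U where "U = {w. f w \<noteq> 0}"
  have cf: "continuous_on S f" "continuous_on S (deriv f)" for S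
    using hol holomorphic_deriv[OF hol] holomorphic_on_imp_continuous_on continuous_on_subset
    by (metis open_UNIV subset_UNIV)+
  have U: "open U" unfolding U_def by (intro open_Collect_neq cf continuous_on_const)
  define \<Psi> where "\<Psi> z w = cmod (f w) * exp (- a * (cmod (w - foot f a w))^2)
     - cmod (f z) * exp (- a * (cmod (z - foot f a w))^2)" for z w
  have c\<Psi>: "continuous_on U (\<Psi> z)" for z
    unfolding \<Psi>_def foot_def using a by (intro continuous_intros cf) (auto simp: U_def)
  show ?thesis
  proof (cases "D = {}")
    case True
    thus ?thesis using U by (simp add: contact_set_def touches_def U_def)
  next
    case False
    have eq: "contact_set f a D = (\<Inter>z\<in>D. U \<inter> \<Psi> z -` {0..})"
      using False by (auto simp: contact_set_def touches_def U_def \<Psi>_def)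
    have "closedin (top_of_set U) (contact_set f a D)"
      unfolding eq using False
      by (intro closedin_INT continuous_closedin_preimage c\<Psi>) auto
    then obtain C where "closed C" "contact_set f a D = U \<inter> C"
      by (auto simp: closedin_closed)
    thus ?thesis using U by auto
  qed
qed

text \<open>
  The vertices are the image of the touching points under \<open>foot\<close>, whose derivative is
  $\xi \mapsto \xi - \overline{q'\xi}/(2a)$ with $q = f'/f$. Its determinant $1 - |q'|^2/(4a^2)$
  lies in $[0,1]$ because $|q'| \le 2a$ at a touching point.
\<close>
lemma contact_set_area:
  assumes hol: "f holomorphic_on UNIV" and a: "a > 0"
    and V: "V \<in> sets borel" and B: "open B" "bounded B" "B \<subseteq> D"
    and tc: "\<And>y. y \<in> V \<Longrightarrow> \<exists>w\<in>B. touches f a D y w"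
  shows "emeasure lborel V \<le> emeasure lborel (B \<inter> contact_set f a D)"
proof (rule measure_le_of_subset_image)
  define q' where "q' w = deriv (deriv f) w / f w - (deriv f w / f w)^2" for w
  show "B \<inter> contact_set f a D \<in> sets borel"
    using borel_contact_set[OF hol a] B by auto
  show "bounded (B \<inter> contact_set f a D)" using B by blast
  have int: "w \<in> interior D" if "w \<in> B" for w
    using that B by (meson interior_maximal subsetD)
  show "V \<subseteq> foot f a ` (B \<inter> contact_set f a D)"
  proof
    fix y assume "y \<in> V"
    then obtain w where w: "w \<in> B" "touches f a D y w" using tc by blast
    have "y = foot f a w" using touches_imp(1)[OF hol a w(2) int[OF w(1)]] .
    thus "y \<in> foot f a ` (B \<inter> contact_set f a D)" using w by (auto simp: contact_set_def)
  qed
  fix w assume w: "w \<in> B \<inter> contact_set f a D"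
  hence fw: "f w \<noteq> 0" by (auto simp: contact_set_def touches_def)
  have q: "cmod (q' w) \<le> 2 * a"
    using w touches_imp(2)[OF hol a _ int] by (auto simp: contact_set_def q'_def)
  have df: "(f has_field_derivative deriv f z) (at z)" for z
    using hol by (auto intro: holomorphic_derivI[where S = UNIV])
  have ddf: "(deriv f has_field_derivative deriv (deriv f) z) (at z)" for z
    using holomorphic_deriv[OF hol] by (auto intro: holomorphic_derivI[where S = UNIV])
  have "((\<lambda>w. deriv f w / f w) has_field_derivative q' w) (at w)"
    using fw by (auto intro!: derivative_eq_intros df ddf simp: q'_def field_simps power2_eq_square)
  hence "((\<lambda>w. deriv f w / f w) has_derivative (*) (q' w)) (at w)"
    by (simp add: has_field_derivative_def)
  hence 1: "((\<lambda>w. cnj (deriv f w / f w)) has_derivative (\<lambda>h. cnj (q' w * h))) (at w)"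
    by (rule bounded_linear.has_derivative[OF bounded_linear_cnj])
  have "(foot f a has_derivative (\<lambda>h. h - cnj (q' w * h) / of_real (2 * a))) (at w)"
    unfolding foot_def[abs_def] divide_inverse[of _ "of_real (2 * a)"]
    by (intro has_derivative_diff has_derivative_ident has_derivative_mult_left 1)
  thus "(foot f a has_derivative (\<lambda>h. 1 * h + (- cnj (q' w) / of_real (2 * a)) * cnj h)) (at w)"
    by (simp add: field_simps)
  have "(cmod (q' w) / (2 * a))^2 \<le> 1"
    using q a by (intro power_le_one) auto
  thus "\<bar>(cmod 1)^2 - (cmod (- cnj (q' w) / of_real (2 * a)))^2\<bar> \<le> 1"
    using a by (simp add: norm_divide)
qed (use V in auto)

section \<open>Zero removal and quotients of entire functions\<close>

definition divdiff :: "(complex \<Rightarrow> complex) \<Rightarrow> complex \<Rightarrow> complex \<Rightarrow> complex" where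
  "divdiff h w z = (if z = w then deriv h w else (h z - h w) / (z - w))"

lemma divdiff_mult: "divdiff h w z * (z - w) = h z - h w"
  by (simp add: divdiff_def)

lemma holomorphic_divdiff:
  assumes "h holomorphic_on UNIV"
  shows "divdiff h w holomorphic_on UNIV"
  unfolding divdiff_def[abs_def] using pole_lemma[OF assms, of w] by simp

text \<open>
  The function $u = \log M - \log f$ has positive real part, so the Schwarz lemma, applied after a
  Cayley map, bounds that real part on half the disc by three times its value at the centre.
\<close>
lemma harnack_lower_bound:
  assumes hol: "f holomorphic_on ball 0 r" and r: "r > 0"
    and nz: "\<And>z. cmod z < r \<Longrightarrow> f z \<noteq> 0" and M: "\<And>z. cmod z < r \<Longrightarrow> cmod (f z) < M"
    and z: "cmod z \<le> r / 2"
  shows "cmod (f 0) ^ 3 \<le> cmod (f z) * M^2"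
proof -
  obtain g where g: "g holomorphic_on ball 0 r" "\<And>x. x \<in> ball 0 r \<Longrightarrow> exp (g x) = f x"
    using holomorphic_logarithm_exists[of "ball 0 r" f 0] hol nz r by auto
  have M0: "M > 0" using M[of 0] r by (metis norm_ge_zero norm_zero order.strict_trans1)
  define u where "u x = of_real (ln M) - g x + \<i> * of_real (Im (g 0))" for x
  have Reu: "Re (u x) = ln M - ln (cmod (f x))" if "cmod x < r" for x
  proof -
    have "cmod (f x) = exp (Re (g x))" using g(2)[of x] that by (metis mem_ball_0 norm_exp_eq_Re)
    thus ?thesis by (simp add: u_def)
  qed
  have pos: "Re (u x) > 0" if "cmod x < r" for x
    using Reu[OF that] M[OF that] nz[OF that] by (simp add: ln_less_cancel_iff M0)
  define s where "s = Re (u 0)"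
  have u0: "u 0 = of_real s" by (simp add: s_def u_def complex_eq_iff)
  have s: "s > 0" using pos[of 0] r by (simp add: s_def)
  \<comment> \<open>the Cayley map that takes the right half-plane to the unit disc and s to 0\<close>
  define q where "q \<zeta> = (u (of_real r * \<zeta>) - of_real s) / (u (of_real r * \<zeta>) + of_real s)" for \<zeta>
  have inb: "cmod (of_real r * \<zeta>) < r" if "cmod \<zeta> < 1" for \<zeta>
    using that r by (simp add: norm_mult)
  have nzq: "u (of_real r * \<zeta>) + of_real s \<noteq> 0" if "cmod \<zeta> < 1" for \<zeta>
    using pos[OF inb[OF that]] s by (auto simp: complex_eq_iff)
  have "u holomorphic_on ball 0 r" unfolding u_def by (intro holomorphic_intros g)
  hence "(u \<circ> (\<lambda>\<zeta>. of_real r * \<zeta>)) holomorphic_on ball 0 1"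
    by (rule holomorphic_on_compose_gen[rotated]) (auto intro!: holomorphic_intros simp: inb)
  hence holq: "q holomorphic_on ball 0 1"
    unfolding q_def comp_def by (intro holomorphic_intros) (auto simp: nzq)
  have q1: "cmod (q \<zeta>) < 1" if "cmod \<zeta> < 1" for \<zeta>
  proof -
    define v where "v = u (of_real r * \<zeta>)"
    have "Re v > 0" using pos[OF inb[OF that]] by (simp add: v_def)
    hence "0 < 4 * (Re v * s)" using s by simp
    also have "4 * (Re v * s) = (cmod (v + of_real s))^2 - (cmod (v - of_real s))^2"
      unfolding cmod_power2 by (simp add: power2_eq_square algebra_simps)
    finally have "(cmod (v - of_real s))^2 < (cmod (v + of_real s))^2" by simp
    hence "cmod (v - of_real s) < cmod (v + of_real s)"
      by (rule power2_less_imp_less) simp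
    thus ?thesis using nzq[OF that] by (simp add: q_def v_def norm_divide)
  qed
  have "q 0 = 0" by (simp add: q_def u0)
  define \<zeta> where "\<zeta> = z / of_real r"
  have \<zeta>: "cmod \<zeta> \<le> 1 / 2" "of_real r * \<zeta> = z"
    using z r by (auto simp: \<zeta>_def norm_divide field_simps)
  hence "cmod (q \<zeta>) \<le> cmod \<zeta>"
    using Schwarz_Lemma(1)[OF holq \<open>q 0 = 0\<close> q1, of \<zeta>] by simp
  hence "cmod (q \<zeta>) \<le> 1 / 2" using \<zeta> by linarith
  moreover have "u z + of_real s \<noteq> 0" using nzq[of \<zeta>] \<zeta> by simp
  ultimately have "cmod (u z - of_real s) \<le> cmod (u z + of_real s) / 2"
    unfolding q_def \<zeta>(2) by (simp add: norm_divide field_simps)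
  moreover have "cmod (u z) - s \<le> cmod (u z - of_real s)"
    using norm_triangle_ineq2[of "u z" "of_real s"] s by simp
  moreover have "cmod (u z + of_real s) \<le> cmod (u z) + s"
    using norm_triangle_ineq[of "u z" "of_real s"] s by simp
  moreover have "Re (u z) \<le> cmod (u z)" by (rule complex_Re_le_cmod)
  ultimately have "Re (u z) \<le> 3 * s" by argo
  moreover have zr: "cmod z < r" using z r by linarith
  ultimately have "3 * ln (cmod (f 0)) \<le> ln (cmod (f z)) + 2 * ln M"
    using Reu[of z] Reu[of 0] r by (simp add: s_def)
  moreover have "f 0 \<noteq> 0" "f z \<noteq> 0" using nz r zr by auto
  ultimately have "ln (cmod (f 0) ^ 3) \<le> ln (cmod (f z) * M^2)"
    using M0 by (simp add: ln_mult ln_realpow)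
  thus ?thesis using \<open>f 0 \<noteq> 0\<close> \<open>f z \<noteq> 0\<close> M0 by (simp add: ln_le_cancel_iff del: ln_mult)
qed

lemma norm_le_of_sphere:
  assumes "f holomorphic_on UNIV" "R > 0" "\<And>z. cmod z = R \<Longrightarrow> cmod (f z) \<le> M" "cmod z \<le> R"
  shows "cmod (f z) \<le> M"
  by (rule maximum_modulus_frontier[of f "cball 0 R"])
     (use assms in \<open>auto intro: holomorphic_on_subset holomorphic_on_imp_continuous_on\<close>)

text \<open>
  Replacing a zero $\lambda$ with $|\lambda| \le R/2$ by the reflected zero $R^2/\bar\lambda$ keeps
  the modulus on the circle and multiplies $|f(0)|$ by $R/|\lambda| \ge 2$. As $|f(0)|$ cannot
  exceed the maximum on the circle, the process stops; this is why $n$ measures the number of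
  doublings left and no zeros have to be counted.
\<close>
lemma remove_zeros_half_disc:
  assumes "f holomorphic_on UNIV" and R: "R > 0" and "f 0 \<noteq> 0"
    and M: "\<And>z. cmod z = R \<Longrightarrow> cmod (f z) \<le> M" and "M < cmod (f 0) * 2 ^ n"
  shows "\<exists>g. g holomorphic_on UNIV \<and> (\<forall>z. cmod z = R \<longrightarrow> cmod (g z) = cmod (f z))
     \<and> cmod (f 0) \<le> cmod (g 0) \<and> (\<forall>z. cmod z \<le> R / 2 \<longrightarrow> g z \<noteq> 0)"
  using assms(1,3-)
proof (induction n arbitrary: f)
  case 0
  have "cmod (f 0) \<le> M" by (rule norm_le_of_sphere[OF 0(1) R 0(3)]) (use R in auto)
  thus ?case using 0 by simp
next
  case (Suc n)
  show ?case
  proof (cases "\<exists>l. cmod l \<le> R / 2 \<and> f l = 0")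
    case False
    thus ?thesis using Suc.prems by (intro exI[of _ f]) auto
  next
    case True
    then obtain l where l: "cmod l \<le> R / 2" "f l = 0" by blast
    have l0: "l \<noteq> 0" using l Suc.prems by auto
    \<comment> \<open>a Blaschke factor for the disc of radius R, inverted\<close>
    define g where "g z = divdiff f l z * (of_real (R^2) - cnj l * z) / of_real R" for z
    have hg: "g holomorphic_on UNIV"
      unfolding g_def by (intro holomorphic_intros holomorphic_divdiff Suc.prems) (use R in auto)
    have gs: "cmod (g z) = cmod (f z)" if z: "cmod z = R" for z
    proof -
      have "of_real (R^2) = z * cnj z"
        using z complex_norm_square[of z] by simp
      hence "of_real (R^2) - cnj l * z = z * cnj (z - l)" by (simp add: algebra_simps)
      hence "cmod (of_real (R^2) - cnj l * z) = R * cmod (z - l)"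
        by (simp add: norm_mult z del: complex_cnj_diff)
      hence "cmod (g z) = cmod (divdiff f l z * (z - l))"
        using R by (simp add: g_def norm_mult norm_divide)
      thus ?thesis by (simp add: divdiff_mult l)
    qed
    have "g 0 = - (f 0 / l) * of_real R"
      using l l0 R by (simp add: g_def divdiff_def power2_eq_square field_simps)
    hence "cmod (g 0) = cmod (f 0) * (R / cmod l)" using R by (simp add: norm_mult norm_divide)
    moreover have "2 \<le> R / cmod l" using l l0 by (simp add: field_simps)
    hence "cmod (f 0) * 2 \<le> cmod (f 0) * (R / cmod l)" by (intro mult_left_mono) auto
    ultimately have g0: "2 * cmod (f 0) \<le> cmod (g 0)" by simp
    have "\<exists>k. k holomorphic_on UNIV \<and> (\<forall>z. cmod z = R \<longrightarrow> cmod (k z) = cmod (g z))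
     \<and> cmod (g 0) \<le> cmod (k 0) \<and> (\<forall>z. cmod z \<le> R / 2 \<longrightarrow> k z \<noteq> 0)"
    proof (rule Suc.IH[OF hg])
      show "g 0 \<noteq> 0" using g0 Suc.prems by auto
      have "2 * cmod (f 0) * 2 ^ n \<le> cmod (g 0) * 2 ^ n" using g0 by (intro mult_right_mono) auto
      moreover have "M < 2 * cmod (f 0) * 2 ^ n" using Suc.prems(4) by (simp add: mult_ac)
      ultimately show "M < cmod (g 0) * 2 ^ n" by linarith
    qed (use gs Suc.prems in auto)
    then obtain k where k: "k holomorphic_on UNIV" "\<forall>z. cmod z = R \<longrightarrow> cmod (k z) = cmod (g z)"
      "cmod (g 0) \<le> cmod (k 0)" "\<forall>z. cmod z \<le> R / 2 \<longrightarrow> k z \<noteq> 0" by blast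
    have "cmod (f 0) \<le> cmod (k 0)" using k(3) g0 norm_ge_zero[of "f 0"] by linarith
    thus ?thesis using k gs by (intro exI[of _ k]) auto
  qed
qed

text \<open>
  After the zeros near the centre are removed from $f$, Harnack bounds $|f|$ from below, while the
  bound for $|hf|$ on the circle persists because the modulus of $f$ there is unchanged.
\<close>
lemma quotient_bound_on_disc:
  assumes f: "f holomorphic_on UNIV" and h: "h holomorphic_on UNIV" and R: "R > 0" and f0: "f 0 \<noteq> 0"
    and M: "\<And>z. cmod z = R \<Longrightarrow> cmod (f z) < M" and M': "\<And>z. cmod z = R \<Longrightarrow> cmod (h z * f z) \<le> M'"
    and z: "cmod z \<le> R / 4"
  shows "cmod (h z) \<le> M' * M^2 / cmod (f 0) ^ 3"
proof -
  obtain n where "M / cmod (f 0) < 2 ^ n" using real_arch_pow[of 2] by auto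
  hence n: "M < cmod (f 0) * 2 ^ n" using f0 by (simp add: field_simps)
  obtain g where g: "g holomorphic_on UNIV" "\<And>z. cmod z = R \<Longrightarrow> cmod (g z) = cmod (f z)"
     "cmod (f 0) \<le> cmod (g 0)" "\<And>z. cmod z \<le> R / 2 \<Longrightarrow> g z \<noteq> 0"
    using remove_zeros_half_disc[OF f R f0 less_imp_le[OF M] n] by blast
  obtain M1 where M1: "M1 < M" "\<And>z. cmod z = R \<Longrightarrow> cmod (f z) \<le> M1"
  proof -
    have "compact (sphere (0::complex) R)" "sphere (0::complex) R \<noteq> {}" using R by auto
    moreover have "continuous_on (sphere 0 R) (\<lambda>z. cmod (f z))"
      using f holomorphic_on_imp_continuous_on holomorphic_on_subset
      by (intro continuous_on_norm) blast
    ultimately obtain x where x: "x \<in> sphere 0 R" "\<And>y. y \<in> sphere 0 R \<Longrightarrow> cmod (f y) \<le> cmod (f x)"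
      using continuous_attains_sup[of "sphere 0 R" "\<lambda>z. cmod (f z)"] by metis
    show ?thesis by (rule that[of "cmod (f x)"]) (use x M in auto)
  qed
  have "cmod (g 0) ^ 3 \<le> cmod (g z) * M^2"
  proof (rule harnack_lower_bound[where r = "R / 2"])
    show "g holomorphic_on ball 0 (R / 2)" using g(1) holomorphic_on_subset by blast
    show "cmod (g x) < M" if "cmod x < R / 2" for x
    proof -
      have "cmod (g x) \<le> M1"
        by (rule norm_le_of_sphere[OF g(1) R]) (use g(2) M1(2) that R in auto)
      with M1(1) show ?thesis by linarith
    qed
  qed (use R g z in auto)
  moreover have "cmod (f 0) ^ 3 \<le> cmod (g 0) ^ 3" using g(3) by (intro power_mono) auto
  ultimately have lb: "cmod (f 0) ^ 3 \<le> cmod (g z) * M^2" by linarith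
  have "cmod (h z * g z) \<le> M'"
  proof (rule norm_le_of_sphere[of "\<lambda>z. h z * g z", OF _ R])
    show "(\<lambda>z. h z * g z) holomorphic_on UNIV" by (intro holomorphic_intros h g)
    show "cmod (h x * g x) \<le> M'" if "cmod x = R" for x
      using M'[OF that] g(2)[OF that] by (simp add: norm_mult)
  qed (use z R in linarith)
  hence "cmod (h z) * (cmod (g z) * M^2) \<le> M' * M^2"
    by (simp add: norm_mult mult_right_mono flip: mult.assoc)
  moreover have "cmod (h z) * cmod (f 0) ^ 3 \<le> cmod (h z) * (cmod (g z) * M^2)"
    by (intro mult_left_mono lb) auto
  ultimately have "cmod (h z) * cmod (f 0) ^ 3 \<le> M' * M^2" by linarith
  thus ?thesis using f0 by (simp add: field_simps)
qed

text \<open>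
  Finite type with respect to order two; the summand 1 makes one inequality serve all $z$.
\<close>
definition order_two :: "(complex \<Rightarrow> complex) \<Rightarrow> bool" where
  "order_two f \<longleftrightarrow> (\<exists>c. \<forall>z. cmod (f z) \<le> exp (c * (1 + (cmod z)^2)))"

lemma order_twoI:
  assumes "\<And>z. cmod (f z) \<le> A * exp (b * (1 + (cmod z)^2))"
  shows "order_two f"
proof -
  have "cmod (f z) \<le> exp ((\<bar>A\<bar> + b) * (1 + (cmod z)^2))" for z
  proof -
    have "A \<le> exp \<bar>A\<bar>" using exp_ge_add_one_self[of "\<bar>A\<bar>"] by linarith
    also have "\<bar>A\<bar> * 1 \<le> \<bar>A\<bar> * (1 + (cmod z)^2)" by (intro mult_left_mono) auto
    hence "exp \<bar>A\<bar> \<le> exp (\<bar>A\<bar> * (1 + (cmod z)^2))" by simp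
    finally have "A * exp (b * (1 + (cmod z)^2)) \<le> exp (\<bar>A\<bar> * (1 + (cmod z)^2)) * exp (b * (1 + (cmod z)^2))"
      by (rule mult_right_mono) simp
    also have "\<dots> = exp ((\<bar>A\<bar> + b) * (1 + (cmod z)^2))" by (simp add: mult_exp_exp distrib_right)
    finally show ?thesis using assms[of z] by linarith
  qed
  thus ?thesis unfolding order_two_def by blast
qed

lemma one_plus_square_shift:
  fixes a b x :: real
  assumes "x \<le> a + 4 * b" "0 \<le> x" "0 \<le> a" "0 \<le> b"
  shows "1 + x^2 \<le> (1 + 32 + 2 * a^2) * (1 + b^2)"
proof -
  have "x^2 \<le> (a + 4 * b)^2" using assms by (intro power_mono) auto
  also have "\<dots> \<le> 2 * a^2 + 32 * b^2"
    using zero_le_power2[of "a - 4 * b"] by (simp add: power2_eq_square algebra_simps)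
  finally have "1 + x^2 \<le> 1 + 2 * a^2 + 32 * b^2" by simp
  also have "\<dots> \<le> (1 + 32 + 2 * a^2) * (1 + b^2)" by (simp add: algebra_simps)
  finally show ?thesis .
qed

text \<open>
  Apply the bound for quotients on a disc around a point where $f$ does not vanish, with radius
  comparable to the distance of $z$ from that point.
\<close>
lemma order_two_quotient:
  assumes f: "f holomorphic_on UNIV" and h: "h holomorphic_on UNIV" and p: "f p \<noteq> 0"
    and "order_two f" "order_two (\<lambda>z. h z * f z)"
  shows "order_two h"
proof -
  obtain c1 c2 where c: "\<And>z. cmod (f z) \<le> exp (c1 * (1 + (cmod z)^2))"
      "\<And>z. cmod (h z * f z) \<le> exp (c2 * (1 + (cmod z)^2))"
    using assms(4,5) unfolding order_two_def by blast
  define c where "c = max \<bar>c1\<bar> \<bar>c2\<bar> + 1"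
  define B where "B = 1 + 32 + 2 * (5 * cmod p + 1)^2"
  have "cmod (h z) \<le> (1 / cmod (f p) ^ 3) * exp ((3 * c * B) * (1 + (cmod z)^2))" for z
  proof -
    define R where "R = 4 * cmod (z - p) + 1"
    define M where "M = exp (c * B * (1 + (cmod z)^2))"
    have M: "exp (b * (1 + (cmod (p + x))^2)) < M" if x: "cmod x = R" and b: "b < c" for x b
    proof -
      have "cmod (p + x) \<le> (5 * cmod p + 1) + 4 * cmod z"
        using x norm_triangle_ineq[of p x] norm_triangle_ineq4[of z p] by (simp add: R_def)
      hence "1 + (cmod (p + x))^2 \<le> B * (1 + (cmod z)^2)"
        unfolding B_def by (intro one_plus_square_shift) auto
      hence "c * (1 + (cmod (p + x))^2) \<le> c * (B * (1 + (cmod z)^2))"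
        by (intro mult_left_mono) (auto simp: c_def)
      moreover have "b * (1 + (cmod (p + x))^2) < c * (1 + (cmod (p + x))^2)"
        using b by (intro mult_strict_right_mono) (auto simp: add_pos_nonneg)
      ultimately show ?thesis by (simp add: M_def mult.assoc)
    qed
    have "cmod (h (p + (z - p))) \<le> M * M^2 / cmod (f (p + 0)) ^ 3"
    proof (rule quotient_bound_on_disc[where R = R and f = "\<lambda>x. f (p + x)" and h = "\<lambda>x. h (p + x)"])
      show "(\<lambda>x. f (p + x)) holomorphic_on UNIV" "(\<lambda>x. h (p + x)) holomorphic_on UNIV"
        using holomorphic_on_compose_gen[OF _ f, of "\<lambda>x. p + x" UNIV]
          holomorphic_on_compose_gen[OF _ h, of "\<lambda>x. p + x" UNIV]
        by (simp_all add: comp_def holomorphic_on_add holomorphic_on_ident)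
      show "cmod (f (p + x)) < M" "cmod (h (p + x) * f (p + x)) \<le> M" if "cmod x = R" for x
      proof -
        have "c1 < c" "c2 < c" by (auto simp: c_def)
        thus "cmod (f (p + x)) < M" "cmod (h (p + x) * f (p + x)) \<le> M"
          using c[of "p + x"] M[OF that, of c1] M[OF that, of c2] by linarith+
      qed
    qed (use p in \<open>auto simp: R_def add_nonneg_pos\<close>)
    also have "M * M^2 = exp ((3 * c * B) * (1 + (cmod z)^2))"
      by (simp add: M_def power2_eq_square[of "exp _"] mult_exp_exp)
    finally show ?thesis by simp
  qed
  thus ?thesis by (rule order_twoI)
qed

section \<open>Area of the set where an entire function is large\<close>

text \<open>
  Let vertices run through a small disc around the maximum point \<open>zs\<close> of $|K|$ on the
  disc of radius $R$, and choose the opening so that the paraboloid varies by $M/2$ over distance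
  $R/4$. The touching values are then at least $e^{M/2}$, and the bound $18M$ on $\log|K|$ keeps the
  touching points inside the disc of radius $3R$, since it gives a displacement below $3R/2$ and $R
  + R/4 + 3R/2 < 3R$.
\<close>
lemma superlevel_area_at:
  assumes hol: "K holomorphic_on UNIV" and R: "R > 0" and M: "M > 0"
    and zs: "cmod zs \<le> R" "cmod (K zs) = exp M"
    and le: "\<And>z. cmod z \<le> 3 * R \<Longrightarrow> cmod (K z) \<le> exp (18 * M)"
  shows "ennreal (pi * (R / 4)^2) \<le> emeasure lborel {z \<in> ball 0 (3 * R). cmod (K z) > 1}"
proof -
  define b where "b = 8 * M / R^2"
  have b: "b > 0" using M R by (simp add: b_def)
  define B where "B = {z \<in> ball 0 (3 * R). cmod (K z) > 1}"
  have cK: "continuous_on S K" for S by (rule entire_continuous[OF hol])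
  have opB: "open B"
  proof -
    have "open {z. cmod (K z) > 1}" by (intro open_Collect_less continuous_intros cK)
    hence "open (ball 0 (3 * R) \<inter> {z. cmod (K z) > 1})" by (intro open_Int) auto
    also have "\<dots> = B" by (auto simp: B_def)
    finally show ?thesis .
  qed
  have tc: "\<exists>w\<in>B. touches K b (ball 0 (3 * R)) y w" if y: "y \<in> ball zs (R / 4)" for y
  proof -
    define \<phi> where "\<phi> z = cmod (K z) * exp (- b * (cmod (z - y))^2)" for z
    have "continuous_on (cball 0 (3 * R)) \<phi>"
      unfolding \<phi>_def by (intro continuous_intros cK)
    moreover have "cball (0::complex) (3 * R) \<noteq> {}" using R by simp
    ultimately obtain w where w: "w \<in> cball 0 (3 * R)" "\<And>z. z \<in> cball 0 (3 * R) \<Longrightarrow> \<phi> z \<le> \<phi> w"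
      using continuous_attains_sup[of "cball 0 (3 * R)" \<phi>] by auto
    have "(cmod (zs - y))^2 \<le> (R / 4)^2"
      using y by (intro power_mono) (auto simp: dist_norm)
    hence "b * (cmod (zs - y))^2 \<le> b * (R / 4)^2"
      using b by (intro mult_left_mono) auto
    also have "\<dots> = M / 2" using R by (simp add: b_def power2_eq_square)
    finally have "exp (M / 2) \<le> exp (M - b * (cmod (zs - y))^2)" by simp
    also have "\<dots> = \<phi> zs" by (simp add: \<phi>_def zs exp_diff exp_minus field_simps)
    also have "\<dots> \<le> \<phi> w" using zs R by (intro w) auto
    finally have "exp (M / 2) * exp (b * (cmod (w - y))^2) \<le> \<phi> w * exp (b * (cmod (w - y))^2)"
      by (intro mult_right_mono) auto
    also have "\<dots> = cmod (K w)" by (simp add: \<phi>_def exp_minus)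
    finally have Kw: "exp (M / 2 + b * (cmod (w - y))^2) \<le> cmod (K w)" by (simp add: exp_add)
    have "1 < exp (M / 2 + b * (cmod (w - y))^2)" using M b by (simp add: add_pos_nonneg)
    with Kw have Kw1: "cmod (K w) > 1" by linarith
    have "exp (M / 2 + b * (cmod (w - y))^2) \<le> exp (18 * M)"
      by (rule order_trans[OF Kw le]) (use w(1) in auto)
    hence "M / 2 + b * (cmod (w - y))^2 \<le> 18 * M" by (simp only: exp_le_cancel_iff)
    hence "b * (cmod (w - y))^2 < 18 * M" using M by linarith
    also have "\<dots> = b * (3 / 2 * R)^2" using R by (simp add: b_def power2_eq_square)
    finally have "(cmod (w - y))^2 < (3 / 2 * R)^2" using b by simp
    hence "cmod (w - y) < 3 / 2 * R" by (rule power2_less_imp_less) (use R in simp)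
    moreover have "cmod w \<le> cmod (w - y) + cmod (y - zs) + cmod zs"
      using norm_triangle_ineq[of "w - y" y] norm_triangle_ineq[of "y - zs" zs] by simp
    moreover have "cmod (y - zs) < R / 4" using y by (simp add: dist_norm norm_minus_commute)
    ultimately have "w \<in> ball 0 (3 * R)" using zs(1) R by simp
    moreover have "touches K b (ball 0 (3 * R)) y w"
      using Kw1 w(2) by (auto simp: touches_def \<phi>_def)
    ultimately show ?thesis using Kw1 by (auto simp: B_def)
  qed
  have "emeasure lborel (ball zs (R / 4)) \<le> emeasure lborel (B \<inter> contact_set K b (ball 0 (3 * R)))"
  proof (intro contact_set_area[OF hol b _ opB])
    show "bounded B" by (rule bounded_subset[of "ball 0 (3 * R)"]) (auto simp: B_def)
  qed (use tc in \<open>auto simp: B_def\<close>)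
  also have "\<dots> \<le> emeasure lborel B" using opB by (intro emeasure_mono) auto
  finally show ?thesis using R by (simp add: emeasure_disc B_def)
qed

text \<open>
  If $M(3R) > 18 M(R)$ for all large $R$, where $M$ is the logarithm of the maximum modulus, then
  $M$ outgrows $R^2$, as $18 > 9$. So radii with $M(3R) \le 18 M(R)$ are unbounded.
\<close>
lemma superlevel_area:
  assumes hol: "K holomorphic_on UNIV" and K0: "cmod (K 0) > 1"
    and "order_two K"
  shows "\<exists>R\<ge>R0. R > 0 \<and> ennreal (pi * (R / 4)^2) \<le> emeasure lborel {z \<in> ball 0 (3 * R). cmod (K z) > 1}"
proof -
  obtain C where gr: "\<And>z. cmod (K z) \<le> exp (C * (1 + (cmod z)^2))"
    using assms(3) unfolding order_two_def by blast
  have cK: "continuous_on S K" for S by (rule entire_continuous[OF hol])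
  have "\<exists>zs. cmod zs \<le> R \<and> (\<forall>z. cmod z \<le> R \<longrightarrow> cmod (K z) \<le> cmod (K zs))" if "R \<ge> 0" for R
  proof -
    have "cball (0::complex) R \<noteq> {}" using that by simp
    moreover have "continuous_on (cball 0 R) (\<lambda>z. cmod (K z))" by (intro continuous_intros cK)
    ultimately show ?thesis
      using continuous_attains_sup[of "cball 0 R" "\<lambda>z. cmod (K z)"] by auto
  qed
  then obtain zs where zs: "\<And>R. R \<ge> 0 \<Longrightarrow> cmod (zs R) \<le> R"
      "\<And>R z. R \<ge> 0 \<Longrightarrow> cmod z \<le> R \<Longrightarrow> cmod (K z) \<le> cmod (K (zs R))"
    by metis
  define M where "M R = ln (cmod (K (zs R)))" for R
  have gt1: "cmod (K (zs R)) > 1" if "R \<ge> 0" for R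
    using zs(2)[of R 0] that K0 by simp
  have M: "M R > 0" "cmod (K (zs R)) = exp (M R)" if "R \<ge> 0" for R
    using gt1[OF that] order.strict_trans[OF zero_less_one gt1[OF that]]
    by (simp_all add: M_def)
  define R1 where "R1 = max R0 1"
  have R1: "R1 \<ge> R0" "R1 \<ge> 1" by (auto simp: R1_def)
  have "\<exists>R\<ge>R1. M (3 * R) \<le> 18 * M R"
  proof (rule ccontr)
    assume "\<not> ?thesis"
    hence *: "M (3 * R) \<ge> 18 * M R" if "R \<ge> R1" for R using that by force
    have lower: "18 ^ n * M R1 \<le> M (3 ^ n * R1)" for n
    proof (induction n)
      case (Suc n)
      have "1 * R1 \<le> 3 ^ n * R1" using R1 by (intro mult_right_mono) auto
      from *[of "3 ^ n * R1"] this Suc show ?case by (simp add: mult.assoc)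
    qed simp
    have upper: "M R \<le> C * (1 + R^2)" if "R \<ge> 0" for R
    proof -
      have "exp (M R) \<le> exp (C * (1 + (cmod (zs R))^2))" using gr M(2)[OF that] by metis
      hence "M R \<le> C * (1 + (cmod (zs R))^2)" by simp
      moreover have "C > 0"
      proof (rule ccontr)
        assume "\<not> C > 0"
        hence "exp (C * (1 + (cmod 0)^2)) \<le> 1" by simp
        with gr[of 0] K0 show False by linarith
      qed
      moreover have "(cmod (zs R))^2 \<le> R^2" using zs(1)[OF that] by (intro power_mono) auto
      ultimately show ?thesis by (smt (verit) mult_left_mono)
    qed
    have "2 ^ n * M R1 \<le> C * (1 + R1^2)" for n
    proof -
      have "9 ^ n * (2 ^ n * M R1) = 18 ^ n * M R1"
        by (simp flip: power_mult_distrib mult.assoc)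
      also have "\<dots> \<le> C * (1 + (3 ^ n * R1)^2)"
        using lower upper[of "3 ^ n * R1"] R1 by (meson order_trans zero_le_mult_iff zero_le_numeral zero_le_power zero_le_one)
      also have "\<dots> \<le> C * (9 ^ n * (1 + R1^2))"
      proof (rule mult_left_mono)
        have "(3 ^ n)^2 = (3^2 :: real) ^ n" by (simp only: power_mult[symmetric] mult.commute)
        hence "(3 ^ n * R1)^2 = 9 ^ n * R1^2" by (simp add: power_mult_distrib)
        moreover have "(1::real) \<le> 9 ^ n" by simp
        ultimately show "1 + (3 ^ n * R1)^2 \<le> 9 ^ n * (1 + R1^2)" by (simp only: distrib_left mult_1_right add_right_mono)
        have "0 < C * (1 + 0^2)" using upper[of 0] M(1)[of 0] by linarith
        thus "C \<ge> 0" by simp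
      qed
      finally show ?thesis by (simp add: mult.left_commute)
    qed
    moreover have "\<exists>n. 2 ^ n * M R1 > C * (1 + R1^2)"
    proof -
      obtain n where "C * (1 + R1^2) / M R1 < 2 ^ n"
        using real_arch_pow[of 2 "C * (1 + R1^2) / M R1"] by auto
      thus ?thesis using M(1)[of R1] R1 by (auto simp: field_simps)
    qed
    ultimately show False by (meson not_less)
  qed
  then obtain R where R: "R \<ge> R1" "M (3 * R) \<le> 18 * M R" by blast
  have R0: "R > 0" using R R1 by simp
  have "ennreal (pi * (R / 4)^2) \<le> emeasure lborel {z \<in> ball 0 (3 * R). cmod (K z) > 1}"
  proof (rule superlevel_area_at[OF hol R0])
    show "cmod (K z) \<le> exp (18 * M R)" if "cmod z \<le> 3 * R" for z
    proof -
      have "cmod (K z) \<le> exp (M (3 * R))" using zs(2)[of "3 * R" z] that R0 M(2)[of "3 * R"] by simp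
      also have "\<dots> \<le> exp (18 * M R)" using R(2) by simp
      finally show ?thesis .
    qed
  qed (use M[of R] zs[of R] R0 in auto)
  thus ?thesis using R R1 R0 by (intro exI[of _ R]) auto
qed

text \<open>
  A form of the three circles theorem with a factor 2. Each Taylor coefficient satisfies the Cauchy
  estimates from both circles, hence also their geometric mean, and the resulting series is
  geometric.
\<close>
lemma norm_le_geometric_mean_of_circles:
  assumes hol: "f holomorphic_on UNIV" and r: "0 < r1" "0 < r2" "0 < r3" "4 * r2^2 \<le> r1 * r3"
    and m: "\<And>z. cmod (y - z) = r1 \<Longrightarrow> cmod (f z) \<le> m"
    and M: "\<And>z. cmod (y - z) = r3 \<Longrightarrow> cmod (f z) \<le> M"
    and z: "cmod (z - y) \<le> r2"
  shows "cmod (f z) \<le> 2 * sqrt (m * M)"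
proof -
  define a where "a n = (deriv ^^ n) f y / fact n" for n
  have c: "continuous_on S f" for S by (rule entire_continuous[OF hol])
  have hb: "f holomorphic_on S" for S using hol holomorphic_on_subset by blast
  have a1: "cmod (a n) \<le> m / r1 ^ n" for n
    using Cauchy_inequality[of f y r1 m n, OF hb c r(1) m] by (simp add: a_def norm_divide field_simps)
  have a3: "cmod (a n) \<le> M / r3 ^ n" for n
    using Cauchy_inequality[of f y r3 M n, OF hb c r(3) M] by (simp add: a_def norm_divide field_simps)
  have m0: "m \<ge> 0" "M \<ge> 0"
    using order_trans[OF norm_ge_zero a1[of 0]] order_trans[OF norm_ge_zero a3[of 0]] by simp_all
  have b: "cmod (a n * (z - y) ^ n) \<le> sqrt (m * M) * (1 / 2) ^ n" for n
  proof (rule power2_le_imp_le)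
    have "(cmod (a n * (z - y) ^ n))^2 = cmod (a n) * cmod (a n) * (cmod (z - y) ^ n)^2"
      by (simp add: norm_mult norm_power power2_eq_square)
    also have "\<dots> \<le> (m / r1 ^ n) * (M / r3 ^ n) * (r2 ^ n)^2"
      using a1[of n] a3[of n] z r m0 by (intro mult_mono power_mono) auto
    also have "\<dots> = m * M * (r2^2 / (r1 * r3)) ^ n"
      by (simp add: power_divide power_mult_distrib mult.commute flip: power_mult)
    also have "\<dots> \<le> m * M * (1 / 4) ^ n"
      using r m0 by (intro mult_left_mono power_mono) (auto simp: field_simps)
    also have "\<dots> = (sqrt (m * M) * (1 / 2) ^ n)^2"
    proof -
      have "((1 / 2) ^ n)^2 = ((1 / 2)^2 :: real) ^ n" by (simp only: power_mult[symmetric] mult.commute)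
      also have "((1 / 2)^2) = (1 / 4 :: real)" by (simp add: power2_eq_square)
      finally show ?thesis using m0 by (simp add: power_mult_distrib)
    qed
    finally show "(cmod (a n * (z - y) ^ n))^2 \<le> (sqrt (m * M) * (1 / 2) ^ n)^2" .
  qed (use m0 in auto)
  have "(\<lambda>n. a n * (z - y) ^ n) sums f z"
    unfolding a_def
    by (rule holomorphic_power_series[of f y "r2 + 1"]) (use z hb in \<open>auto simp: dist_norm norm_minus_commute\<close>)
  hence "f z = (\<Sum>n. a n * (z - y) ^ n)" by (simp add: sums_iff)
  also have "cmod \<dots> \<le> (\<Sum>n. sqrt (m * M) * (1 / 2) ^ n)"
    by (intro norm_suminf_le b summable_mult summable_geometric) auto
  also have "\<dots> = 2 * sqrt (m * M)"
    by (subst suminf_mult) (auto simp: suminf_geometric summable_geometric)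
  finally show ?thesis .
qed

section \<open>Touching points of functions of small type\<close>

text \<open>
  If $F$ were tiny on a small circle around $y$, the three circles estimate would make it tiny at
  the fixed point $p$, because the type $\kappa$ is small. So $|F|$ is not too small somewhere
  within $R/400$ of each vertex $y$, and $|F(z)| e^{-|z-y|^2}$ takes its maximum within $R/200$ of
  $y$. The constants are chosen so that the missing area $9\pi R^2 - \pi(599R/200)^2$ stays below
  the area $\pi R^2/16$ of a superlevel set.
\<close>
lemma contact_set_nearly_full:
  fixes \<kappa> :: real
  defines "\<kappa> \<equiv> 1 / 10 ^ 15"
  assumes hol: "F holomorphic_on UNIV" and p: "F p \<noteq> 0"
    and gr: "\<And>z. cmod (F z) \<le> C * exp (\<kappa> * (cmod z)^2)"
  shows "eventually (\<lambda>R. ennreal (pi * ((3 - 1 / 200) * R)^2)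
           \<le> emeasure lborel (ball 0 (3 * R) \<inter> contact_set F 1 UNIV)) at_top"
proof -
  have C: "C > 0"
  proof -
    have "0 < cmod (F p)" using p by simp
    also have "\<dots> \<le> C * exp (\<kappa> * (cmod p)^2)" by (rule gr)
    finally show ?thesis by (simp add: zero_less_mult_iff)
  qed
  have ev: "eventually (\<lambda>R. K * exp (- c * R^2) < e) at_top" if "c > 0" "e > 0" for c e K :: real
  proof -
    have "((\<lambda>R. K * exp (- c * R^2)) \<longlongrightarrow> K * 0) at_top"
      using that(1) by (intro tendsto_intros) real_asymp
    thus ?thesis using that by (auto elim: order_tendstoD)
  qed
  have "eventually (\<lambda>R. C * exp (- (1 / 10 ^ 6) * R^2) < 1) at_top"
    by (rule ev) auto
  moreover have "eventually (\<lambda>R. C * exp (- (5 / 10 ^ 6) * R^2) < (cmod (F p))^2 / 4) at_top"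
    using p by (intro ev) auto
  moreover have "eventually (\<lambda>R. R > cmod p) at_top" by (rule eventually_gt_at_top)
  ultimately show ?thesis
  proof eventually_elim
    fix R assume R1: "C * exp (- (1 / 10 ^ 6) * R^2) < 1"
      and R2: "C * exp (- (5 / 10 ^ 6) * R^2) < (cmod (F p))^2 / 4" and R3: "R > cmod p"
    have R: "R > 0" using R3 norm_ge_zero[of p] by linarith
    have cF: "continuous_on S F" for S by (rule entire_continuous[OF hol])
    have low: "\<exists>z. cmod (z - y) = R / 400 \<and> cmod (F z) > exp (- (1 / 160000) * R^2)"
      if y: "cmod y < 3 * R" for y
    proof (rule ccontr)
      assume "\<not> ?thesis"
      hence m: "cmod (F z) \<le> exp (- (1 / 160000) * R^2)" if "cmod (y - z) = R / 400" for z
        using that by (force simp: norm_minus_commute)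
      have M: "cmod (F z) \<le> C * exp (\<kappa> * (25603 * R)^2)" if "cmod (y - z) = 25600 * R" for z
      proof -
        have "cmod z \<le> cmod y + cmod (y - z)" using norm_triangle_sub[of z y] by (simp add: norm_minus_commute)
        hence "(cmod z)^2 \<le> (25603 * R)^2" using that y by (intro power_mono) auto
        hence "C * exp (\<kappa> * (cmod z)^2) \<le> C * exp (\<kappa> * (25603 * R)^2)"
          using C by (intro mult_left_mono) (auto simp: \<kappa>_def)
        with gr show ?thesis by (rule order_trans)
      qed
      have "cmod (p - y) \<le> 4 * R" using norm_triangle_ineq4[of p y] R3 y by linarith
      hence "cmod (F p) \<le> 2 * sqrt (exp (- (1 / 160000) * R^2) * (C * exp (\<kappa> * (25603 * R)^2)))"
      proof (intro norm_le_geometric_mean_of_circles[where f = F and y = y and ?r1.0 = "R / 400" and ?r2.0 = "4 * R" and ?r3.0 = "25600 * R"])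
        show "4 * (4 * R)^2 \<le> R / 400 * (25600 * R)" by (simp add: power2_eq_square)
      qed (use hol R m M in auto)
      hence "(cmod (F p))^2 \<le> (2 * sqrt (exp (- (1 / 160000) * R^2) * (C * exp (\<kappa> * (25603 * R)^2))))^2"
        by (intro power_mono) auto
      also have "\<dots> = 4 * (C * exp (- (1 / 160000) * R^2 + \<kappa> * (25603 * R)^2))"
        using C by (simp add: power_mult_distrib mult_ac mult_exp_exp)
      also have "\<dots> \<le> 4 * (C * exp (- (5 / 10 ^ 6) * R^2))"
      proof -
        have "- (1 / 160000) * R^2 + \<kappa> * (25603 * R)^2 = (- (1 / 160000) + \<kappa> * 25603^2) * R^2"
          by (simp add: power_mult_distrib algebra_simps)
        also have "\<dots> \<le> - (5 / 10 ^ 6) * R^2"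
          by (intro mult_right_mono) (auto simp: \<kappa>_def)
        finally show ?thesis using C by simp
      qed
      finally show False using R2 by simp
    qed
    have tc: "\<exists>w\<in>ball 0 (3 * R). touches F 1 UNIV y w" if y: "y \<in> ball 0 ((3 - 1 / 200) * R)" for y
    proof -
      have y3: "cmod y < 3 * R" using y R by auto
      obtain z0 where z0: "cmod (z0 - y) = R / 400" "cmod (F z0) > exp (- (1 / 160000) * R^2)"
        using low[OF y3] by blast
      define \<phi> where "\<phi> z = cmod (F z) * exp (- 1 * (cmod (z - y))^2)" for z
      have "continuous_on (cball y (R / 200)) \<phi>"
        unfolding \<phi>_def by (intro continuous_intros cF)
      moreover have "cball y (R / 200) \<noteq> {}" using R by simp
      ultimately obtain w where w: "w \<in> cball y (R / 200)" "\<And>z. z \<in> cball y (R / 200) \<Longrightarrow> \<phi> z \<le> \<phi> w"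
        using continuous_attains_sup[of "cball y (R / 200)" \<phi>] by auto
      have "exp (- (1 / 80000) * R^2) = exp (- (1 / 160000) * R^2) * exp (- 1 * (R / 400)^2)"
        by (simp add: power_divide flip: exp_add)
      also have "\<dots> < \<phi> z0"
        unfolding \<phi>_def z0(1) using z0(2) by (intro mult_strict_right_mono) auto
      finally have \<phi>z0: "exp (- (1 / 80000) * R^2) < \<phi> z0" .
      have "\<phi> z0 \<le> \<phi> w" using z0 R by (intro w) (auto simp: dist_norm norm_minus_commute)
      have far: "\<phi> z \<le> \<phi> w" if "z \<notin> cball y (R / 200)" for z
      proof -
        define d where "d = cmod (z - y)"
        have d: "d > R / 200" using that by (simp add: d_def dist_norm norm_minus_commute)
        have "cmod z \<le> d + 3 * R" using norm_triangle_sub[of z y] y3 by (simp add: d_def)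
        hence "(cmod z)^2 \<le> (d + 3 * R)^2" by (intro power_mono) auto
        also have "\<dots> \<le> 2 * d^2 + 18 * R^2"
          using sum_squares_bound[of d "3 * R"] by (simp add: power2_eq_square algebra_simps)
        finally have z2: "(cmod z)^2 \<le> 2 * d^2 + 18 * R^2" .
        have "\<phi> z \<le> C * exp (\<kappa> * (cmod z)^2) * exp (- 1 * d^2)"
          unfolding \<phi>_def d_def by (intro mult_right_mono gr) auto
        also have "\<dots> = C * exp (\<kappa> * (cmod z)^2 - d^2)" by (simp add: exp_diff exp_minus field_simps)
        also have "\<dots> \<le> C * exp (- (1 / 10 ^ 6) * R^2 - (1 / 80000) * R^2)"
        proof -
          have "(R / 200)^2 \<le> d^2" using d R by (intro power_mono) auto
          hence "R^2 / 40000 \<le> d^2" by (simp add: power_divide)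
          moreover have "\<kappa> * (cmod z)^2 = (cmod z)^2 / 1000000000000000" by (simp add: \<kappa>_def)
          moreover have "0 \<le> R^2" "0 \<le> d^2" by auto
          moreover have "- (1 / 10 ^ 6) * R^2 = - (R^2 / 1000000)" by simp
          ultimately have "\<kappa> * (cmod z)^2 - d^2 \<le> - (1 / 10 ^ 6) * R^2 - (1 / 80000) * R^2"
            using z2 by linarith
          thus ?thesis using C by simp
        qed
        also have "\<dots> = (C * exp (- (1 / 10 ^ 6) * R^2)) * exp (- (1 / 80000) * R^2)"
          by (simp flip: exp_add)
        also have "\<dots> \<le> 1 * exp (- (1 / 80000) * R^2)"
          using R1 by (intro mult_right_mono) auto
        finally show ?thesis using \<phi>z0 \<open>\<phi> z0 \<le> \<phi> w\<close> by linarith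
      qed
      have "\<phi> w > 0" using \<phi>z0 \<open>\<phi> z0 \<le> \<phi> w\<close> by (smt (verit) exp_gt_zero)
      hence "F w \<noteq> 0" by (auto simp: \<phi>_def)
      moreover have "\<phi> z \<le> \<phi> w" for z using w(2) far by blast
      ultimately have "touches F 1 UNIV y w" by (auto simp: touches_def \<phi>_def)
      moreover have "cmod w < 3 * R"
        using w(1) y norm_triangle_sub[of w y] R by (simp add: dist_norm norm_minus_commute algebra_simps)
      ultimately show ?thesis by auto
    qed
    have "emeasure lborel (ball (0 :: complex) ((3 - 1 / 200) * R)) \<le> emeasure lborel (ball 0 (3 * R) \<inter> contact_set F 1 UNIV)"
    proof (rule contact_set_area[OF hol])
      show "\<exists>w\<in>ball 0 (3 * R). touches F 1 UNIV y w" if "y \<in> ball 0 ((3 - 1 / 200) * R)" for y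
        using tc that by blast
    qed auto
    thus "ennreal (pi * ((3 - 1 / 200) * R)^2)
           \<le> emeasure lborel (ball 0 (3 * R) \<inter> contact_set F 1 UNIV)"
      using R by (subst (asm) emeasure_disc) auto
  qed
qed

section \<open>Rotation invariance and the mean value inequality\<close>

text \<open>
  A rotation and its inverse both have Jacobian 1, so the area estimate applies in both directions.
\<close>
lemma lborel_rotation:
  assumes u: "cmod u = 1"
  shows "distr lborel borel (\<lambda>z. u * z) = (lborel :: complex measure)"
proof (rule lborel_eqI[symmetric])
  have mult [measurable]: "(\<lambda>z. v * z) \<in> borel_measurable borel" for v :: complex by measurable
  have le: "emeasure lborel V \<le> emeasure lborel E"
    if "V \<in> sets borel" "E \<in> sets borel" "bounded E" "V \<subseteq> (\<lambda>z. v * z) ` E" "cmod v = 1" for V E and v :: complex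
  proof (rule measure_le_of_subset_image[where f = "\<lambda>z. v * z" and \<alpha> = "\<lambda>_. v" and \<beta> = "\<lambda>_. 0"])
    show "((\<lambda>z. v * z) has_derivative (\<lambda>h. v * h + 0 * cnj h)) (at w)" for w
      by (auto intro!: derivative_eq_intros)
  qed (use that in auto)
  have uu: "cnj u * u = 1" "u * cnj u = 1" using complex_norm_square[of u] u by (simp_all add: mult.commute)
  fix l r :: complex
  assume *: "\<And>b. b \<in> Basis \<Longrightarrow> l \<bullet> b \<le> r \<bullet> b"
  define E where "E = (\<lambda>z. u * z) -` box l r"
  have E_eq: "E = (\<lambda>z. cnj u * z) ` box l r"
  proof safe
    fix z assume "z \<in> E"
    moreover have "z = cnj u * (u * z)" by (simp add: uu flip: mult.assoc)
    ultimately show "z \<in> (\<lambda>z. cnj u * z) ` box l r" unfolding E_def by blast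
  qed (simp add: E_def uu flip: mult.assoc)
  have E: "E \<in> sets borel" using measurable_sets[OF mult[of u], of "box l r"] by (simp add: E_def)
  have bE: "bounded E"
    unfolding E_eq by (intro bounded_linear_image bounded_box bounded_linear_mult_right)
  have sub: "box l r \<subseteq> (\<lambda>z. u * z) ` E"
  proof
    fix z assume "z \<in> box l r"
    hence "cnj u * z \<in> E" unfolding E_eq by (rule imageI)
    moreover have "z = u * (cnj u * z)" by (simp add: uu flip: mult.assoc)
    ultimately show "z \<in> (\<lambda>z. u * z) ` E" by blast
  qed
  have "emeasure lborel E = emeasure lborel (box l r)"
  proof (rule antisym)
    show "emeasure lborel E \<le> emeasure lborel (box l r)"
      by (rule le[of _ _ "cnj u"]) (use E E_eq u in auto)
    show "emeasure lborel (box l r) \<le> emeasure lborel E"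
      by (rule le[of _ _ u]) (use E bE sub u in auto)
  qed
  thus "emeasure (distr lborel borel (\<lambda>z. u * z)) (box l r) = ennreal (\<Prod>b\<in>Basis. (r - l) \<bullet> b)"
    using * by (simp add: emeasure_distr E_def emeasure_lborel_box_eq inner_diff_left)
qed simp

text \<open>
  Cauchy's formula for the unit circle, with the contour integral written as an integral over
  $[0,1]$.
\<close>
lemma circle_submean:
  assumes H: "H holomorphic_on UNIV"
  shows "ennreal (cmod (H 0)) \<le> (\<integral>\<^sup>+x. indicator {0..1} x * ennreal (cmod (H (exp (2 * of_real pi * \<i> * of_real x)))) \<partial>lborel)"
proof -
  define f where "f x = H (exp (2 * of_real pi * \<i> * of_real x))" for x :: real
  have cH: "continuous_on S H" for S by (rule entire_continuous[OF H])
  have "((\<lambda>u. H u / (u - 0)) has_contour_integral (2 * of_real pi * \<i> * H 0)) (circlepath 0 1)"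
    using H by (intro Cauchy_integral_circlepath cH) (auto intro: holomorphic_on_subset)
  hence "((\<lambda>x. 2 * of_real pi * \<i> * f x) has_integral (2 * of_real pi * \<i> * H 0)) {0..1}"
    unfolding has_contour_integral
    by (subst (asm) vector_derivative_circlepath) (simp add: circlepath f_def mult_ac)
  from has_integral_mult_right[OF this, of "1 / (2 * of_real pi * \<i>)"]
  have int: "(f has_integral H 0) {0..1}" by simp
  have cf: "continuous_on S f" for S
    unfolding f_def by (intro continuous_on_compose2[OF cH[of UNIV]] continuous_intros) auto
  have [measurable]: "f \<in> borel_measurable borel"
    by (intro borel_measurable_continuous_onI cf)
  have ni: "(\<lambda>x. cmod (f x)) integrable_on {0..1}"
    by (intro integrable_continuous_real continuous_intros cf)
  have "cmod (H 0) \<le> integral {0..1} (\<lambda>x. cmod (f x))"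
    using integral_norm_bound_integral[OF has_integral_integrable[OF int] ni] int
    by (simp add: integral_unique)
  moreover have "((\<lambda>x. indicator {0..1} x * cmod (f x)) has_integral integral {0..1} (\<lambda>x. cmod (f x))) UNIV"
  proof -
    have "(\<lambda>x. indicator {0..1} x * cmod (f x)) = (\<lambda>x. if x \<in> {0..1} then cmod (f x) else 0)"
      by (auto simp: indicator_def)
    thus ?thesis using ni by (simp only: has_integral_restrict_UNIV has_integral_integral)
  qed
  hence "(\<integral>\<^sup>+x. ennreal (indicator {0..1} x * cmod (f x)) \<partial>lborel) = ennreal (integral {0..1} (\<lambda>x. cmod (f x)))"
    by (intro nn_integral_has_integral_lborel) auto
  moreover have "(\<integral>\<^sup>+x. ennreal (indicator {0..1} x * cmod (f x)) \<partial>lborel)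
     = (\<integral>\<^sup>+x. indicator {0..1} x * ennreal (cmod (f x)) \<partial>lborel)"
    by (intro nn_integral_cong) (auto simp: indicator_def)
  ultimately show ?thesis unfolding f_def by (metis ennreal_leI)
qed

text \<open>
  Average the mean value inequality for the square of $G$ over all circles around $w$ at once:
  integrate over the disc, exchange the integrals, and use that each rotation preserves area. This
  avoids polar coordinates.
\<close>
lemma disc_submean:
  assumes G: "G holomorphic_on UNIV"
  shows "ennreal (pi * (cmod (G w))^2) \<le> (\<integral>\<^sup>+z. indicator (ball w 1) z * ennreal ((cmod (G z))^2) \<partial>lborel)"
proof -
  have cG: "continuous_on S G" for S by (rule entire_continuous[OF G])
  have [measurable]: "G \<in> borel_measurable borel"
    by (intro borel_measurable_continuous_onI cG)
  define e where "e x = exp (2 * of_real pi * \<i> * of_real x)" for x :: real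
  have e1: "cmod (e x) = 1" for x by (simp add: e_def)
  have [measurable]: "e \<in> borel_measurable borel"
    unfolding e_def by (intro borel_measurable_continuous_onI continuous_intros)
  define B where "B = ball (0::complex) 1"
  have B [measurable]: "B \<in> sets borel" by (simp add: B_def)
  define f where "f \<zeta> x = indicator B \<zeta> * (indicator {0..1} x * ennreal ((cmod (G (w + e x * \<zeta>)))^2))" for \<zeta> :: complex and x :: real
  have [measurable]: "case_prod f \<in> borel_measurable (lborel \<Otimes>\<^sub>M lborel)"
    unfolding f_def by measurable
  have sub: "ennreal ((cmod (G w))^2) \<le> (\<integral>\<^sup>+x. indicator {0..1} x * ennreal ((cmod (G (w + e x * \<zeta>)))^2) \<partial>lborel)" for \<zeta>
  proof -
    have "(\<lambda>u. (G (w + u * \<zeta>))^2) holomorphic_on UNIV"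
    proof -
      have "(\<lambda>u. w + u * \<zeta>) holomorphic_on UNIV" by (intro holomorphic_intros)
      hence "(G \<circ> (\<lambda>u. w + u * \<zeta>)) holomorphic_on UNIV"
        by (rule holomorphic_on_compose_gen[OF _ G]) auto
      thus ?thesis by (auto simp: comp_def intro!: holomorphic_intros)
    qed
    from circle_submean[OF this] show ?thesis by (simp add: e_def norm_power)
  qed
  have rot: "(\<integral>\<^sup>+\<zeta>. f \<zeta> x \<partial>lborel) = indicator {0..1} x * (\<integral>\<^sup>+\<zeta>. indicator B \<zeta> * ennreal ((cmod (G (w + \<zeta>)))^2) \<partial>lborel)" for x
  proof -
    have "(\<integral>\<^sup>+\<zeta>. indicator B \<zeta> * ennreal ((cmod (G (w + \<zeta>)))^2) \<partial>lborel)
       = (\<integral>\<^sup>+\<zeta>. indicator B \<zeta> * ennreal ((cmod (G (w + \<zeta>)))^2) \<partial>distr lborel borel (\<lambda>z. e x * z))"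
      by (simp only: lborel_rotation[OF e1])
    also have "\<dots> = (\<integral>\<^sup>+\<zeta>. indicator B (e x * \<zeta>) * ennreal ((cmod (G (w + e x * \<zeta>)))^2) \<partial>lborel)"
      by (subst nn_integral_distr) auto
    also have "\<dots> = (\<integral>\<^sup>+\<zeta>. indicator B \<zeta> * ennreal ((cmod (G (w + e x * \<zeta>)))^2) \<partial>lborel)"
      by (intro nn_integral_cong) (auto simp: B_def indicator_def norm_mult e1)
    finally have eq: "(\<integral>\<^sup>+\<zeta>. indicator B \<zeta> * ennreal ((cmod (G (w + \<zeta>)))^2) \<partial>lborel) = \<dots>" .
    show ?thesis
      unfolding f_def eq by (subst nn_integral_cmult[symmetric]) (auto simp: mult.left_commute)
  qed
  have "ennreal (pi * (cmod (G w))^2) = emeasure lborel B * ennreal ((cmod (G w))^2)"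
    by (simp add: B_def emeasure_disc ennreal_mult)
  also have "\<dots> = (\<integral>\<^sup>+\<zeta>. ennreal ((cmod (G w))^2) * indicator B \<zeta> \<partial>lborel)"
    by (subst nn_integral_cmult_indicator) (auto simp: mult_ac)
  also have "\<dots> \<le> (\<integral>\<^sup>+\<zeta>. (\<integral>\<^sup>+x. f \<zeta> x \<partial>lborel) \<partial>lborel)"
  proof (rule nn_integral_mono)
    fix \<zeta>
    have "(\<integral>\<^sup>+x. f \<zeta> x \<partial>lborel) = indicator B \<zeta> * (\<integral>\<^sup>+x. indicator {0..1} x * ennreal ((cmod (G (w + e x * \<zeta>)))^2) \<partial>lborel)"
      unfolding f_def by (intro nn_integral_cmult) measurable
    thus "ennreal ((cmod (G w))^2) * indicator B \<zeta> \<le> (\<integral>\<^sup>+x. f \<zeta> x \<partial>lborel)"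
      using mult_left_mono[OF sub[of \<zeta>], of "indicator B \<zeta>"] by (simp add: mult.commute)
  qed
  also have "\<dots> = (\<integral>\<^sup>+x. (\<integral>\<^sup>+\<zeta>. f \<zeta> x \<partial>lborel) \<partial>lborel)"
    by (rule lborel_pair.Fubini'[symmetric]) measurable
  also have "\<dots> = (\<integral>\<^sup>+\<zeta>. indicator B \<zeta> * ennreal ((cmod (G (w + \<zeta>)))^2) \<partial>lborel)"
    unfolding rot by (subst nn_integral_multc) auto
  also have "\<dots> = (\<integral>\<^sup>+z. indicator (ball w 1) z * ennreal ((cmod (G z))^2) \<partial>distr lborel borel ((+) w))"
    by (subst nn_integral_distr) (auto intro!: nn_integral_cong simp: B_def indicator_def dist_norm)
  also have "distr lborel borel ((+) w) = lborel" by (rule lborel_distr_plus)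
  finally show ?thesis .
qed

section \<open>Integrals of Gaussians and of the Cauchy kernel\<close>

lemma ball_measurable [measurable]: "ball (w::complex) r \<in> sets borel"
  by simp

text \<open>
  Comparison with a superposition of indicator functions of concentric discs. With radii in
  geometric progression this estimates radial integrals without polar coordinates.
\<close>
lemma nn_integral_le_of_balls:
  fixes g :: "complex \<Rightarrow> ennreal"
  assumes le: "\<And>z. \<exists>k. g z \<le> ennreal (a k) * indicator (ball w (r k)) z"
    and pos: "\<And>k::nat. a k \<ge> 0" "\<And>k. r k \<ge> 0" and S: "(\<lambda>k. a k * (pi * (r k)^2)) sums S"
  shows "(\<integral>\<^sup>+z. g z \<partial>lborel) \<le> ennreal S"
proof -
  have "(\<integral>\<^sup>+z. g z \<partial>lborel) \<le> (\<integral>\<^sup>+z. (\<Sum>k. ennreal (a k) * indicator (ball w (r k)) z) \<partial>lborel)"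
  proof (rule nn_integral_mono)
    fix z
    obtain k where "g z \<le> ennreal (a k) * indicator (ball w (r k)) z" using le by blast
    also have "ennreal (a k) * indicator (ball w (r k)) z = (\<Sum>k\<in>{k}. ennreal (a k) * indicator (ball w (r k)) z)"
      by (simp only: sum.insert[OF finite.emptyI] sum.empty empty_iff not_False_eq_True add_0_right)
    also have "\<dots> \<le> (\<Sum>k. ennreal (a k) * indicator (ball w (r k)) z)"
      by (intro sum_le_suminf) auto
    finally show "g z \<le> (\<Sum>k. ennreal (a k) * indicator (ball w (r k)) z)" .
  qed
  also have "\<dots> = (\<Sum>k. \<integral>\<^sup>+z. ennreal (a k) * indicator (ball w (r k)) z \<partial>lborel)"
    by (intro nn_integral_suminf) measurable
  also have "\<dots> = (\<Sum>k. ennreal (a k * (pi * (r k)^2)))"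
    using pos by (simp add: nn_integral_cmult_indicator emeasure_disc ennreal_mult)
  also have "\<dots> = ennreal S"
    using S pos by (intro suminf_ennreal_eq) auto
  finally show ?thesis .
qed

lemma nn_integral_inverse_dist_ball:
  assumes "\<rho> \<ge> 0"
  shows "(\<integral>\<^sup>+z. indicator (ball w \<rho>) z * ennreal (1 / cmod (z - w)) \<partial>lborel) \<le> ennreal (4 * pi * \<rho>)"
proof (cases "\<rho> = 0")
  case False
  with assms have \<rho>: "\<rho> > 0" by simp
  show ?thesis
  proof (rule nn_integral_le_of_balls[where a = "\<lambda>k. 2 ^ Suc k / \<rho>" and r = "\<lambda>k. \<rho> / 2 ^ k" and w = w])
    fix z :: complex
    show "\<exists>k. indicator (ball w \<rho>) z * ennreal (1 / cmod (z - w)) \<le> ennreal (2 ^ Suc k / \<rho>) * indicator (ball w (\<rho> / 2 ^ k)) z"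
    proof (cases "z \<in> ball w \<rho> \<and> z \<noteq> w")
      case True
      define P where "P k \<longleftrightarrow> \<rho> / 2 ^ Suc k \<le> cmod (z - w)" for k
      have "\<exists>k. P k"
      proof -
        obtain k where "\<rho> / cmod (z - w) < 2 ^ k" using real_arch_pow[of 2] by auto
        moreover have "(2::real) ^ k \<le> 2 ^ Suc k" by simp
        ultimately have "\<rho> / cmod (z - w) \<le> 2 ^ Suc k" by linarith
        thus ?thesis using True by (intro exI[of _ k]) (simp add: P_def field_simps)
      qed
      define k where "k = (LEAST k. P k)"
      have Pk: "P k" unfolding k_def by (rule LeastI_ex) fact
      have "cmod (z - w) < \<rho> / 2 ^ k"
      proof (cases k)
        case 0
        thus ?thesis using True by (simp add: dist_norm norm_minus_commute)
      next
        case (Suc j)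
        hence "\<not> P j" using not_less_Least[of j P] by (simp add: k_def)
        thus ?thesis by (simp add: P_def Suc)
      qed
      moreover have "1 / cmod (z - w) \<le> 2 ^ Suc k / \<rho>"
        using Pk True \<rho> by (simp add: P_def field_simps)
      ultimately show ?thesis using True
        by (intro exI[of _ k]) (auto simp: dist_norm norm_minus_commute intro!: ennreal_leI)
    qed auto
  next
    have "(\<lambda>k. 2 * pi * \<rho> * (1 / 2) ^ k) sums (2 * pi * \<rho> * (1 / (1 - 1 / 2)))"
      by (intro sums_mult geometric_sums) auto
    moreover have "2 ^ Suc k / \<rho> * (pi * (\<rho> / 2 ^ k)^2) = 2 * pi * \<rho> * (1 / 2) ^ k" for k
      using \<rho> by (simp add: field_simps power2_eq_square)
    ultimately show "(\<lambda>k. 2 ^ Suc k / \<rho> * (pi * (\<rho> / 2 ^ k)^2)) sums (4 * pi * \<rho>)" by (simp add: mult.assoc)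
  qed (use \<rho> in auto)
qed auto

lemma nn_integral_gaussian_finite:
  assumes c: "c > 0"
  shows "(\<integral>\<^sup>+z. ennreal (exp (- c * (cmod (z::complex))^2)) \<partial>lborel) < \<infinity>"
proof -
  define A where "A = 1 + 32 / c^2"
  have A: "A \<ge> 1" by (simp add: A_def)
  have "(\<integral>\<^sup>+z. ennreal (exp (- c * (cmod (z::complex))^2)) \<partial>lborel) \<le> ennreal (A * pi * (1 / (1 - 1 / 4)))"
  proof (rule nn_integral_le_of_balls[where a = "\<lambda>k. A / 16 ^ k" and r = "\<lambda>k. 2 ^ k" and w = 0])
    fix z :: complex
    obtain n where n: "cmod z < 2 ^ n" using real_arch_pow[of 2] by auto
    define k where "k = (LEAST k. cmod z < 2 ^ k)"
    have k: "cmod z < 2 ^ k" unfolding k_def by (rule LeastI[of _ n]) fact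
    have "exp (- c * (cmod z)^2) \<le> A / 16 ^ k"
    proof (cases k)
      case 0
      have "exp (- c * (cmod z)^2) \<le> 1" using c by simp
      also have "\<dots> \<le> A / 16 ^ k" using A 0 by simp
      finally show ?thesis .
    next
      case (Suc j)
      hence "\<not> cmod z < 2 ^ j" using not_less_Least[of j "\<lambda>k. cmod z < 2 ^ k"] by (simp add: k_def)
      hence "(2 ^ j)^2 \<le> (cmod z)^2" by (intro power_mono) auto
      moreover have "(2 ^ j)^2 = (2^2 :: real) ^ j" by (simp only: power_mult[symmetric] mult.commute)
      ultimately have z: "4 ^ j \<le> (cmod z)^2" by simp
      define y where "y = c * 4 ^ j"
      have y: "y > 0" using c by (simp add: y_def)
      have "exp (- c * (cmod z)^2) \<le> exp (- y)" using z c by (simp add: y_def)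
      also have "\<dots> \<le> 2 / y^2"
      proof -
        have "y^2 / 2 \<le> exp y" using exp_lower_Taylor_quadratic[of y] y by simp
        thus ?thesis using y by (simp add: exp_minus field_simps)
      qed
      also have "\<dots> = (32 / c^2) / 16 ^ k"
      proof -
        have "(4 ^ j)^2 = (4^2 :: real) ^ j" by (simp only: power_mult[symmetric] mult.commute)
        thus ?thesis by (simp add: y_def Suc power_mult_distrib)
      qed
      also have "\<dots> \<le> A / 16 ^ k" by (intro divide_right_mono) (auto simp: A_def)
      finally show ?thesis .
    qed
    thus "\<exists>k. ennreal (exp (- c * (cmod z)^2)) \<le> ennreal (A / 16 ^ k) * indicator (ball 0 (2 ^ k)) z"
      using k by (intro exI[of _ k]) (auto intro!: ennreal_leI)
  next
    have "(\<lambda>k. A * pi * (1 / 4) ^ k) sums (A * pi * (1 / (1 - 1 / 4)))"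
      by (intro sums_mult geometric_sums) auto
    moreover have "A / 16 ^ k * (pi * (2 ^ k)^2) = A * pi * (1 / 4) ^ k" for k
    proof -
      have "(2 ^ k)^2 = (2^2 :: real) ^ k" by (simp only: power_mult[symmetric] mult.commute)
      moreover have "(16::real) ^ k = 4 ^ k * 4 ^ k" by (simp flip: power_mult_distrib)
      ultimately show ?thesis by (simp add: field_simps)
    qed
    ultimately show "(\<lambda>k. A / 16 ^ k * (pi * (2 ^ k)^2)) sums (A * pi * (1 / (1 - 1 / 4)))" by simp
  qed (use A in auto)
  thus ?thesis by (rule le_less_trans) simp
qed

lemma nn_integral_singular_gaussian_finite:
  assumes c: "c > 0"
  shows "(\<integral>\<^sup>+z. ennreal (exp (- c * (cmod (z::complex))^2) / cmod z) \<partial>lborel) < \<infinity>"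
proof -
  have "ennreal (exp (- c * (cmod z)^2) / cmod z) \<le> indicator (ball 0 1) z * ennreal (1 / cmod (z - 0)) + ennreal (exp (- c * (cmod z)^2))" for z :: complex
  proof (cases "cmod z < 1")
    case True
    have "exp (- c * (cmod z)^2) / cmod z \<le> 1 / cmod z" using c by (intro divide_right_mono) auto
    thus ?thesis using True by (simp add: ennreal_leI add_increasing2)
  next
    case False
    hence "exp (- c * (cmod z)^2) / cmod z \<le> exp (- c * (cmod z)^2) / 1" by (intro divide_left_mono) auto
    thus ?thesis using False by (simp add: ennreal_leI)
  qed
  hence "(\<integral>\<^sup>+z. ennreal (exp (- c * (cmod (z::complex))^2) / cmod z) \<partial>lborel) \<le>
     (\<integral>\<^sup>+z. (indicator (ball 0 1) z * ennreal (1 / cmod (z - 0)) + ennreal (exp (- c * (cmod z)^2))) \<partial>lborel)"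
    by (intro nn_integral_mono)
  also have "\<dots> = (\<integral>\<^sup>+z. indicator (ball 0 1) z * ennreal (1 / cmod (z - 0)) \<partial>lborel) + (\<integral>\<^sup>+z. ennreal (exp (- c * (cmod (z::complex))^2)) \<partial>lborel)"
    by (intro nn_integral_add) measurable
  also have "\<dots> < \<infinity>"
    using nn_integral_gaussian_finite[OF c] le_less_trans[OF nn_integral_inverse_dist_ball[of 1 0] ennreal_less_top]
    by simp
  finally show ?thesis .
qed

text \<open>
  For $|z| \le 2\rho$ the disc lies in the disc of radius $3\rho$ around $z$; for larger $|z|$ the
  kernel is at most $2/|z|$.
\<close>
lemma nn_integral_inverse_dist_centred:
  assumes \<rho>: "\<rho> > 0"
  shows "ennreal (cmod z) * (\<integral>\<^sup>+w. indicator (ball 0 \<rho>) w * ennreal (1 / cmod (z - w)) \<partial>lborel) \<le> ennreal (24 * pi * \<rho> * min (cmod z) \<rho>)"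
proof -
  let ?I = "\<integral>\<^sup>+w. indicator (ball 0 \<rho>) w * ennreal (1 / cmod (z - w)) \<partial>lborel"
  show ?thesis
  proof (cases "cmod z \<le> 2 * \<rho>")
    case True
    have "?I
       \<le> (\<integral>\<^sup>+w. indicator (ball z (3 * \<rho>)) w * ennreal (1 / cmod (w - z)) \<partial>lborel)"
    proof (rule nn_integral_mono)
      fix w :: complex
      have "w \<in> ball z (3 * \<rho>)" if "w \<in> ball 0 \<rho>"
        using that True norm_triangle_ineq4[of z w] by (simp add: dist_norm)
      thus "indicator (ball 0 \<rho>) w * ennreal (1 / cmod (z - w)) \<le> indicator (ball z (3 * \<rho>)) w * ennreal (1 / cmod (w - z))"
        by (auto simp: indicator_def norm_minus_commute)
    qed
    also have "\<dots> \<le> ennreal (12 * pi * \<rho>)"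
      using nn_integral_inverse_dist_ball[of "3 * \<rho>" z] \<rho> by (simp add: mult_ac)
    finally have "ennreal (cmod z) * ?I \<le> ennreal (cmod z) * ennreal (12 * pi * \<rho>)"
      by (intro mult_left_mono) auto
    also have "\<dots> = ennreal (12 * pi * \<rho> * cmod z)" by (subst ennreal_mult[symmetric]) (use \<rho> in \<open>auto simp: mult_ac\<close>)
    also have "\<dots> \<le> ennreal (24 * pi * \<rho> * min (cmod z) \<rho>)"
    proof (rule ennreal_leI)
      have "cmod z \<le> 2 * min (cmod z) \<rho>" using True by (auto simp: min_def)
      hence "(12 * pi * \<rho>) * cmod z \<le> (12 * pi * \<rho>) * (2 * min (cmod z) \<rho>)" using \<rho> by (intro mult_left_mono) auto
      thus "12 * pi * \<rho> * cmod z \<le> 24 * pi * \<rho> * min (cmod z) \<rho>" by simp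
    qed
    finally show ?thesis .
  next
    case False
    have "?I
       \<le> (\<integral>\<^sup>+w. ennreal (2 / cmod z) * indicator (ball (0::complex) \<rho>) w \<partial>lborel)"
    proof (rule nn_integral_mono)
      fix w :: complex
      have "1 / cmod (z - w) \<le> 2 / cmod z" if "w \<in> ball 0 \<rho>"
      proof -
        have "cmod z / 2 \<le> cmod (z - w)" using that False norm_triangle_ineq2[of z w] by simp
        moreover have "cmod z > 0" using False \<rho> by linarith
        ultimately have "cmod (z - w) > 0" "cmod z > 0" "cmod z / 2 \<le> cmod (z - w)" by linarith+
        thus ?thesis by (simp add: field_simps)
      qed
      thus "indicator (ball 0 \<rho>) w * ennreal (1 / cmod (z - w)) \<le> ennreal (2 / cmod z) * indicator (ball 0 \<rho>) w"
        by (auto simp: indicator_def intro!: ennreal_leI)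
    qed
    also have "\<dots> = ennreal (2 / cmod z * (pi * \<rho>^2))"
    proof -
      have "(\<integral>\<^sup>+w. ennreal (2 / cmod z) * indicator (ball (0::complex) \<rho>) w \<partial>lborel) = ennreal (2 / cmod z) * emeasure lborel (ball (0::complex) \<rho>)"
        by (intro nn_integral_cmult_indicator) auto
      also have "\<dots> = ennreal (2 / cmod z) * ennreal (pi * \<rho>^2)" using \<rho> by (subst emeasure_disc) auto
      also have "\<dots> = ennreal (2 / cmod z * (pi * \<rho>^2))" by (rule ennreal_mult[symmetric]) auto
      finally show ?thesis .
    qed
    finally have "ennreal (cmod z) * ?I \<le> ennreal (cmod z) * ennreal (2 / cmod z * (pi * \<rho>^2))"
      by (intro mult_left_mono) auto
    also have "\<dots> = ennreal (cmod z * (2 / cmod z * (pi * \<rho>^2)))" by (subst ennreal_mult[symmetric]) auto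
    also have "\<dots> \<le> ennreal (24 * pi * \<rho> * min (cmod z) \<rho>)"
      using False \<rho> by (intro ennreal_leI) (auto simp: min_def power2_eq_square)
    finally show ?thesis .
  qed
qed

section \<open>The inner product of the Fock space\<close>

definition gauss :: "complex \<Rightarrow> real" where
  "gauss z = exp (- pi * (cmod z)^2)"

text \<open>
  The factor $1/\pi$ makes this the inner product whose norm is \<open>fock_norm\<close>.
\<close>
definition fock_inner :: "(complex \<Rightarrow> complex) \<Rightarrow> (complex \<Rightarrow> complex) \<Rightarrow> complex" where
  "fock_inner X Y = (1 / of_real pi) * (LINT z|lborel. X z * cnj (Y z) * of_real (gauss z))"

lemma gauss_pos [simp]: "gauss z > 0" "gauss z \<ge> 0"
  by (simp_all add: gauss_def)

lemma continuous_gauss: "continuous_on S gauss"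
  unfolding gauss_def[abs_def] by (intro continuous_intros)

lemma gauss_measurable [measurable]: "gauss \<in> borel_measurable borel"
  by (intro borel_measurable_continuous_onI continuous_gauss)

lemma cnj_measurable [measurable]: "cnj \<in> borel_measurable borel"
  by (intro borel_measurable_continuous_onI continuous_intros)

lemma of_real_measurable [measurable]: "(of_real :: real \<Rightarrow> complex) \<in> borel_measurable borel"
  by (intro borel_measurable_continuous_onI continuous_intros)

lemma entire_measurable: "X holomorphic_on UNIV \<Longrightarrow> X \<in> borel_measurable borel"
  by (intro borel_measurable_continuous_onI holomorphic_on_imp_continuous_on)

lemma fock_spaceD:
  assumes "X \<in> fock_space"
  shows "X holomorphic_on UNIV" "X \<in> borel_measurable borel"
    "integrable lborel (\<lambda>z. (cmod (X z))^2 * gauss z)"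
  using assms entire_measurable by (auto simp: fock_space_def entire_functions_def gauss_def)

lemma integrable_fock_product:
  assumes [measurable]: "X \<in> borel_measurable borel" "Y \<in> borel_measurable borel"
    and iX: "integrable lborel (\<lambda>z. (cmod (X z))^2 * gauss z)"
    and iY: "integrable lborel (\<lambda>z. (cmod (Y z))^2 * gauss z)"
  shows "integrable lborel (\<lambda>z. X z * cnj (Y z) * of_real (gauss z))"
proof (rule Bochner_Integration.integrable_bound)
  show "integrable lborel (\<lambda>z. (cmod (X z))^2 * gauss z + (cmod (Y z))^2 * gauss z)"
    using iX iY by simp
  have "cmod (X z * cnj (Y z) * of_real (gauss z)) \<le> (cmod (X z))^2 * gauss z + (cmod (Y z))^2 * gauss z" for z
  proof -
    have "cmod (X z) * cmod (Y z) \<le> (cmod (X z))^2 + (cmod (Y z))^2"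
      using sum_squares_bound[of "cmod (X z)" "cmod (Y z)"] by (simp add: add_increasing mult.assoc)
        (smt (verit) mult_nonneg_nonneg norm_ge_zero)
    hence "cmod (X z) * cmod (Y z) * gauss z \<le> ((cmod (X z))^2 + (cmod (Y z))^2) * gauss z"
      by (intro mult_right_mono) auto
    thus ?thesis by (simp add: norm_mult distrib_right)
  qed
  thus "AE z in lborel. cmod (X z * cnj (Y z) * of_real (gauss z)) \<le> norm ((cmod (X z))^2 * gauss z + (cmod (Y z))^2 * gauss z)"
    by simp
qed measurable

lemma integrable_fock_inner:
  assumes "X \<in> fock_space" "Y \<in> fock_space"
  shows "integrable lborel (\<lambda>z. X z * cnj (Y z) * of_real (gauss z))"
  using assms by (intro integrable_fock_product fock_spaceD)

lemma fock_inner_self: "X \<in> fock_space \<Longrightarrow> fock_inner X X = of_real ((fock_norm X)^2)"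
proof -
  have "(LINT z|lborel. X z * cnj (X z) * of_real (gauss z)) = (LINT z|lborel. complex_of_real ((cmod (X z))^2 * gauss z))"
    by (intro Bochner_Integration.integral_cong) (simp_all only: of_real_mult complex_norm_square)
  also have "\<dots> = of_real (LINT z|lborel. (cmod (X z))^2 * gauss z)" by (rule integral_complex_of_real)
  finally show ?thesis by (simp add: fock_inner_def fock_norm_power2 gauss_def)
qed

lemma fock_inner_commute: "fock_inner Y X = cnj (fock_inner X Y)"
proof -
  have eq: "(LINT z|lborel. Y z * cnj (X z) * of_real (gauss z)) = (LINT z|lborel. cnj (X z * cnj (Y z) * of_real (gauss z)))"
    by (intro Bochner_Integration.integral_cong) (auto simp: mult_ac)
  show ?thesis unfolding fock_inner_def eq Bochner_Integration.integral_cnj by simp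
qed

lemma fock_inner_add_scale:
  assumes "X \<in> fock_space" "Y \<in> fock_space" "Z \<in> fock_space"
  shows "fock_inner (\<lambda>z. X z + c * Y z) Z = fock_inner X Z + c * fock_inner Y Z"
proof -
  have "(LINT z|lborel. (X z + c * Y z) * cnj (Z z) * of_real (gauss z))
     = (LINT z|lborel. X z * cnj (Z z) * of_real (gauss z) + c * (Y z * cnj (Z z) * of_real (gauss z)))"
    by (intro Bochner_Integration.integral_cong) (auto simp: algebra_simps)
  also have "\<dots> = (LINT z|lborel. X z * cnj (Z z) * of_real (gauss z)) + c * (LINT z|lborel. Y z * cnj (Z z) * of_real (gauss z))"
    using integrable_fock_inner[OF assms(1,3)] integrable_fock_inner[OF assms(2,3)] by simp
  finally show ?thesis by (simp add: fock_inner_def algebra_simps)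
qed

lemma fock_space_scale: "X \<in> fock_space \<Longrightarrow> (\<lambda>z. c * X z) \<in> fock_space"
  by (auto simp: fock_space_def entire_functions_def norm_mult power_mult_distrib mult.assoc intro!: holomorphic_intros)

lemma fock_space_add_scale: "X \<in> fock_space \<Longrightarrow> Y \<in> fock_space \<Longrightarrow> (\<lambda>z. X z + c * Y z) \<in> fock_space"
  by (intro fock_space_add fock_space_scale)

text \<open>
  This expansion is the only form in which the parallelogram law and the variational argument for
  orthogonality are used.
\<close>
lemma fock_norm_add_scale_power2:
  assumes X: "X \<in> fock_space" and Y: "Y \<in> fock_space"
  shows "(fock_norm (\<lambda>z. X z + c * Y z))^2
    = (fock_norm X)^2 + 2 * Re (c * fock_inner Y X) + (cmod c)^2 * (fock_norm Y)^2"
proof -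
  let ?Z = "\<lambda>z. X z + c * Y z"
  have Z: "?Z \<in> fock_space" by (rule fock_space_add_scale[OF X Y])
  have "of_real ((fock_norm ?Z)^2) = fock_inner ?Z ?Z" by (rule fock_inner_self[OF Z, symmetric])
  also have "\<dots> = fock_inner X ?Z + c * fock_inner Y ?Z" by (rule fock_inner_add_scale[OF X Y Z])
  also have "fock_inner X ?Z = cnj (fock_inner X X + c * fock_inner Y X)"
    by (subst fock_inner_commute, subst fock_inner_add_scale[OF X Y X]) simp
  also have "fock_inner Y ?Z = cnj (fock_inner X Y + c * fock_inner Y Y)"
    by (subst fock_inner_commute, subst fock_inner_add_scale[OF X Y Y]) simp
  finally have "of_real ((fock_norm ?Z)^2) = of_real ((fock_norm X)^2) + cnj (c * fock_inner Y X)
     + (c * cnj (fock_inner X Y) + c * cnj c * of_real ((fock_norm Y)^2))"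
    by (simp add: fock_inner_self[OF X] fock_inner_self[OF Y] algebra_simps)
  also have "cnj (fock_inner X Y) = fock_inner Y X" by (simp add: fock_inner_commute[of Y X])
  also have "c * cnj c = of_real ((cmod c)^2)" by (simp only: complex_norm_square)
  finally have "Re (of_real ((fock_norm ?Z)^2)) = Re (of_real ((fock_norm X)^2) + cnj (c * fock_inner Y X)
     + (c * fock_inner Y X + of_real ((cmod c)^2) * of_real ((fock_norm Y)^2)))" by (rule arg_cong)
  thus ?thesis by (simp flip: of_real_power of_real_mult)
qed

lemma fock_pointwise_bound:
  assumes X: "X \<in> fock_space"
  shows "cmod (X w) \<le> exp (pi * (cmod w + 1)^2) * fock_norm X"
proof (rule power2_le_imp_le)
  note D = fock_spaceD[OF X]
  have [measurable]: "X \<in> borel_measurable borel" by (rule D)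
  define E where "E = exp (pi * (cmod w + 1)^2)"
  have E: "E \<ge> 1" by (simp add: E_def)
  have "ennreal (pi * (cmod (X w))^2) \<le> (\<integral>\<^sup>+z. indicator (ball w 1) z * ennreal ((cmod (X z))^2) \<partial>lborel)"
    by (rule disc_submean[OF D(1)])
  also have "\<dots> \<le> (\<integral>\<^sup>+z. ennreal E * ennreal ((cmod (X z))^2 * gauss z) \<partial>lborel)"
  proof (rule nn_integral_mono)
    fix z
    have "(cmod (X z))^2 \<le> E * ((cmod (X z))^2 * gauss z)" if "z \<in> ball w 1"
    proof -
      have "cmod z \<le> cmod w + 1"
        using that norm_triangle_sub[of z w] by (simp add: dist_norm norm_minus_commute)
      hence "pi * (cmod z)^2 \<le> pi * (cmod w + 1)^2" by (intro mult_left_mono power_mono) auto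
      hence "1 \<le> E * gauss z" by (simp add: E_def gauss_def mult_exp_exp)
      hence "(cmod (X z))^2 * 1 \<le> (cmod (X z))^2 * (E * gauss z)" by (intro mult_left_mono) auto
      thus ?thesis by (simp add: mult_ac)
    qed
    thus "indicator (ball w 1) z * ennreal ((cmod (X z))^2) \<le> ennreal E * ennreal ((cmod (X z))^2 * gauss z)"
      using E by (auto simp: indicator_def ennreal_leI simp flip: ennreal_mult)
  qed
  also have "\<dots> = ennreal E * ennreal (LINT z|lborel. (cmod (X z))^2 * gauss z)"
    by (subst nn_integral_cmult) (auto simp: nn_integral_eq_integral[OF D(3)])
  also have "\<dots> = ennreal (pi * (E * (fock_norm X)^2))"
    using E by (simp add: fock_norm_power2 gauss_def flip: ennreal_mult)
  finally have "pi * (cmod (X w))^2 \<le> pi * (E * (fock_norm X)^2)"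
    using E by (subst (asm) ennreal_le_iff) auto
  hence "(cmod (X w))^2 \<le> E * (fock_norm X)^2" by simp
  also have "\<dots> \<le> E^2 * (fock_norm X)^2"
    using E by (intro mult_right_mono) (auto simp: power2_eq_square)
  finally show "(cmod (X w))^2 \<le> (exp (pi * (cmod w + 1)^2) * fock_norm X)^2"
    by (simp add: E_def power_mult_distrib)
qed (simp add: fock_norm_nonneg)

section \<open>Completeness and orthogonal projection\<close>

lemma fock_norm_scale_power2: "(fock_norm (\<lambda>z. c * X z))^2 = (cmod c)^2 * (fock_norm X)^2"
  by (simp add: fock_norm_power2 norm_mult power_mult_distrib mult.assoc)

text \<open>
  Stated for functions that are uniformly Cauchy near each point, since the limit function is not
  known in advance in either of its two uses: completeness of the Fock space and limits of cofactors
  $h_n$.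
\<close>
lemma entire_locally_uniform_limit:
  assumes hol: "\<And>n. f n holomorphic_on UNIV"
    and cau: "\<And>p. \<exists>r>0. uniformly_Cauchy_on (cball p r) f"
  shows "(\<lambda>z. lim (\<lambda>n. f n z)) holomorphic_on UNIV" and "(\<lambda>n. f n z) \<longlonglongrightarrow> lim (\<lambda>n. f n z)"
proof -
  have ul: "\<exists>r>0. uniform_limit (cball p r) f (\<lambda>z. lim (\<lambda>n. f n z)) sequentially" for p
  proof -
    obtain r where r: "r > 0" "uniformly_Cauchy_on (cball p r) f" using cau by blast
    hence "uniformly_convergent_on (cball p r) f" by (simp add: Cauchy_uniformly_convergent)
    thus ?thesis using r uniformly_convergent_uniform_limit_iff by blast
  qed
  show "(\<lambda>z. lim (\<lambda>n. f n z)) holomorphic_on UNIV"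
    by (rule holomorphic_uniform_sequence[of UNIV f]) (use hol ul in auto)
  obtain r where r: "r > 0" "uniform_limit (cball z r) f (\<lambda>z. lim (\<lambda>n. f n z)) sequentially" using ul by blast
  show "(\<lambda>n. f n z) \<longlonglongrightarrow> lim (\<lambda>n. f n z)"
    using tendsto_uniform_limitI[OF r(2), of z] r(1) by simp
qed

text \<open>
  Point evaluations bound a Cauchy sequence locally uniformly, which gives an entire limit; Fatou's
  lemma shows that the limit is also the limit in norm.
\<close>
lemma fock_Cauchy_converges:
  assumes S: "\<And>n. S n \<in> fock_space"
    and cau: "\<And>e. e > 0 \<Longrightarrow> \<exists>N. \<forall>m\<ge>N. \<forall>n\<ge>N. fock_dist (S m) (S n) < e"
  shows "\<exists>X\<in>fock_space. (\<lambda>n. fock_dist (S n) X) \<longlonglongrightarrow> 0"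
proof -
  note D = fock_spaceD[OF S]
  define X where "X z = lim (\<lambda>n. S n z)" for z
  have ptw: "cmod (S m z - S n z) \<le> exp (pi * (cmod z + 1)^2) * fock_dist (S m) (S n)" for m n z
    using fock_pointwise_bound[OF fock_space_diff[OF S[of m] S[of n]], of z] by (simp add: fock_dist_def)
  have uc: "uniformly_Cauchy_on (cball p 1) S" for p
    unfolding uniformly_Cauchy_on_def
  proof (intro allI impI)
    fix e :: real assume e: "e > 0"
    define E where "E = exp (pi * (cmod p + 2)^2)"
    have E: "E > 0" by (simp add: E_def)
    obtain N where N: "\<And>m n. m \<ge> N \<Longrightarrow> n \<ge> N \<Longrightarrow> fock_dist (S m) (S n) < e / E"
      using cau[of "e / E"] e E by auto
    have "dist (S m z) (S n z) < e" if "z \<in> cball p 1" "m \<ge> N" "n \<ge> N" for z m n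
    proof -
      have "cmod z \<le> cmod p + 1" using that norm_triangle_sub[of z p] by (simp add: dist_norm norm_minus_commute)
      hence "pi * (cmod z + 1)^2 \<le> pi * (cmod p + 2)^2" by (intro mult_left_mono power_mono) auto
      hence "exp (pi * (cmod z + 1)^2) * fock_dist (S m) (S n) \<le> E * fock_dist (S m) (S n)"
        unfolding E_def by (intro mult_right_mono) (auto simp: fock_dist_def fock_norm_nonneg)
      also have "\<dots> < e" using N[OF that(2,3)] E by (simp add: field_simps)
      finally show ?thesis using ptw[of m z n] by (simp add: dist_norm)
    qed
    thus "\<exists>M. \<forall>x\<in>cball p 1. \<forall>m\<ge>M. \<forall>n\<ge>M. dist (S m x) (S n x) < e" by blast
  qed
  have X: "X holomorphic_on UNIV" "\<And>z. (\<lambda>n. S n z) \<longlonglongrightarrow> X z"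
    unfolding X_def[abs_def]
    using entire_locally_uniform_limit[of S, OF D(1)] uc zero_less_one by blast+
  have [measurable]: "X \<in> borel_measurable borel" "\<And>n. S n \<in> borel_measurable borel"
    using entire_measurable[OF X(1)] D(2) by auto
  have fat: "(\<integral>\<^sup>+z. ennreal ((cmod (X z - S n z))^2 * gauss z) \<partial>lborel) \<le> ennreal (pi * e^2)"
    if N: "\<And>m. m \<ge> N \<Longrightarrow> fock_dist (S m) (S n) \<le> e" for n N e
  proof -
    have "(\<integral>\<^sup>+z. ennreal ((cmod (X z - S n z))^2 * gauss z) \<partial>lborel)
      = (\<integral>\<^sup>+z. liminf (\<lambda>m. ennreal ((cmod (S m z - S n z))^2 * gauss z)) \<partial>lborel)"
    proof (rule nn_integral_cong)
      fix z
      have "(\<lambda>m. ennreal ((cmod (S m z - S n z))^2 * gauss z)) \<longlonglongrightarrow> ennreal ((cmod (X z - S n z))^2 * gauss z)"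
        by (intro tendsto_intros X)
      thus "ennreal ((cmod (X z - S n z))^2 * gauss z) = liminf (\<lambda>m. ennreal ((cmod (S m z - S n z))^2 * gauss z))"
        using lim_imp_Liminf[OF trivial_limit_sequentially] by metis
    qed
    also have "\<dots> \<le> liminf (\<lambda>m. \<integral>\<^sup>+z. ennreal ((cmod (S m z - S n z))^2 * gauss z) \<partial>lborel)"
      by (rule nn_integral_liminf) measurable
    also have "\<dots> \<le> liminf (\<lambda>m. ennreal (pi * e^2))"
    proof (rule Liminf_mono, rule eventually_sequentiallyI[of N])
      fix m assume m: "m \<ge> N"
      have "(\<integral>\<^sup>+z. ennreal ((cmod (S m z - S n z))^2 * gauss z) \<partial>lborel) = ennreal (LINT z|lborel. (cmod (S m z - S n z))^2 * gauss z)"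
        by (intro nn_integral_eq_integral fock_spaceD(3) fock_space_diff S) auto
      also have "\<dots> = ennreal (pi * (fock_dist (S m) (S n))^2)"
        by (simp add: fock_dist_def fock_norm_power2 gauss_def)
      also have "\<dots> \<le> ennreal (pi * e^2)"
        using N[OF m] by (intro ennreal_leI mult_left_mono power_mono) (auto simp: fock_dist_def fock_norm_nonneg)
      finally show "(\<integral>\<^sup>+z. ennreal ((cmod (S m z - S n z))^2 * gauss z) \<partial>lborel) \<le> ennreal (pi * e^2)" .
    qed
    also have "\<dots> = ennreal (pi * e^2)" by (simp add: Liminf_const)
    finally show ?thesis .
  qed
  have diff: "(\<lambda>z. X z - S n z) \<in> fock_space \<and> fock_dist X (S n) \<le> e"
    if N: "\<And>m. m \<ge> N \<Longrightarrow> fock_dist (S m) (S n) \<le> e" for n N e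
  proof
    have e0: "e \<ge> 0" using N[of N] fock_norm_nonneg by (metis fock_dist_def order_refl order_trans)
    have le: "(\<integral>\<^sup>+z. ennreal ((cmod (X z - S n z))^2 * gauss z) \<partial>lborel) \<le> ennreal (pi * e^2)"
      by (rule fat[OF N])
    have int: "integrable lborel (\<lambda>z. (cmod (X z - S n z))^2 * gauss z)"
      by (rule integrableI_nonneg) (use le in \<open>auto intro: le_less_trans\<close>)
    thus "(\<lambda>z. X z - S n z) \<in> fock_space"
      using X(1) D(1) by (auto simp: fock_space_def entire_functions_def gauss_def intro!: holomorphic_intros)
    have "ennreal (LINT z|lborel. (cmod (X z - S n z))^2 * gauss z) \<le> ennreal (pi * e^2)"
      using le by (subst (asm) nn_integral_eq_integral[OF int]) auto
    hence "(LINT z|lborel. (cmod (X z - S n z))^2 * gauss z) \<le> pi * e^2" by (subst (asm) ennreal_le_iff) auto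
    hence "(fock_dist X (S n))^2 \<le> e^2" by (simp add: fock_dist_def fock_norm_power2 gauss_def field_simps)
    thus "fock_dist X (S n) \<le> e" using e0 by (rule power2_le_imp_le)
  qed
  have XF: "X \<in> fock_space"
  proof -
    obtain N where N: "\<And>m n. m \<ge> N \<Longrightarrow> n \<ge> N \<Longrightarrow> fock_dist (S m) (S n) < 1" using cau[of 1] by auto
    have "(\<lambda>z. X z - S N z) \<in> fock_space" using diff[of N N 1] N by (simp add: less_imp_le)
    from fock_space_add[OF this S[of N]] show ?thesis by simp
  qed
  moreover have "(\<lambda>n. fock_dist (S n) X) \<longlonglongrightarrow> 0"
  proof (rule LIMSEQ_I)
    fix e :: real assume e: "e > 0"
    obtain N where N: "\<And>m n. m \<ge> N \<Longrightarrow> n \<ge> N \<Longrightarrow> fock_dist (S m) (S n) < e / 2" using cau[of "e / 2"] e by auto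
    have "norm (fock_dist (S n) X - 0) < e" if "n \<ge> N" for n
    proof -
      have "fock_dist X (S n) \<le> e / 2" using diff[of N n "e / 2"] N that by (simp add: less_imp_le)
      moreover have "fock_dist (S n) X = fock_dist X (S n)" by (rule Fock.commute)
      ultimately show ?thesis using e fock_norm_nonneg by (simp add: fock_dist_def)
    qed
    thus "\<exists>N. \<forall>n\<ge>N. norm (fock_dist (S n) X - 0) < e" by blast
  qed
  ultimately show ?thesis by blast
qed

text \<open>
  The residual $g$ of the best approximation of $G$ by the closure of $S$. A minimising sequence is
  Cauchy by the parallelogram law, and minimality of $\|g\|$ under all perturbations $g + cY$ forces
  orthogonality. If $g$ were orthogonal to $G$ as well, the residuals of the minimising sequence
  would stay at distance $\|g\|$ from $g$.
\<close>
lemma fock_orthogonal_complement: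
  assumes SF: "S \<subseteq> fock_space" and S0: "S \<noteq> {}"
    and lin: "\<And>X Y c. X \<in> S \<Longrightarrow> Y \<in> S \<Longrightarrow> (\<lambda>z. X z + c * Y z) \<in> S"
    and G: "G \<in> fock_space" and d: "d > 0" and far: "\<And>s. s \<in> S \<Longrightarrow> fock_dist G s \<ge> d"
  shows "\<exists>g\<in>fock_space. (\<forall>s\<in>S. fock_inner s g = 0) \<and> fock_inner G g \<noteq> 0"
proof -
  define Q where "Q s = (fock_norm (\<lambda>z. G z - s z))^2" for s
  define D where "D = (INF s\<in>S. Q s)"
  have Qd: "Q s \<ge> d^2" if "s \<in> S" for s
    using far[OF that] d by (simp add: Q_def fock_dist_def power_mono)
  have bdd: "bdd_below (Q ` S)" using Qd by (intro bdd_belowI2[of _ "d^2"]) auto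
  have DQ: "D \<le> Q s" if "s \<in> S" for s unfolding D_def using bdd that by (rule cINF_lower)
  have "d^2 \<le> D" unfolding D_def using Qd S0 by (intro cINF_greatest) auto
  hence Dpos: "D > 0" using d by (meson less_le_trans zero_less_power)
  have "\<exists>s\<in>S. Q s < D + 1 / real (Suc n)" for n
    using cINF_less_iff[OF S0 bdd, of "D + 1 / real (Suc n)"] by (simp add: D_def)
  then obtain s where s: "\<And>n. s n \<in> S" "\<And>n. Q (s n) < D + 1 / real (Suc n)" by metis
  have sF: "s n \<in> fock_space" for n using s SF by blast
  define T where "T n z = G z - s n z" for n z
  have TF: "T n \<in> fock_space" for n unfolding T_def[abs_def] by (intro fock_space_diff G sF)
  have par: "(fock_dist (T m) (T n))^2 \<le> 2 / real (Suc m) + 2 / real (Suc n)" for m n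
  proof -
    have "(fock_norm (\<lambda>z. T m z + 1 * T n z))^2 + (fock_norm (\<lambda>z. T m z + (- 1) * T n z))^2
       = 2 * (fock_norm (T m))^2 + 2 * (fock_norm (T n))^2"
      by (simp only: fock_norm_add_scale_power2[OF TF TF]) simp
    moreover have "(fock_norm (\<lambda>z. T m z + 1 * T n z))^2 \<ge> 4 * D"
    proof -
      have half: "(\<lambda>z. (\<lambda>z. s m z + (- 1 / 2) * s m z) z + (1 / 2) * s n z) \<in> S"
        by (intro lin s)
      \<comment> \<open>the midpoint of s m and s n lies in S, so the mean of the two residuals has squared norm at least D\<close>
      have "(\<lambda>z. T m z + 1 * T n z) = (\<lambda>z. 0 + 2 * (G z - (s m z + (- 1 / 2) * s m z + (1 / 2) * s n z)))"
        by (simp add: T_def fun_eq_iff algebra_simps)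
      moreover have "(fock_norm (\<lambda>z. 2 * (G z - (s m z + (- 1 / 2) * s m z + (1 / 2) * s n z))))^2 
         = 4 * Q (\<lambda>z. s m z + (- 1 / 2) * s m z + (1 / 2) * s n z)"
        unfolding fock_norm_scale_power2 Q_def by simp
      ultimately show ?thesis using DQ[OF half] by simp
    qed
    moreover have "(fock_norm (T n))^2 = Q (s n)" for n by (simp add: T_def[abs_def] Q_def)
    moreover have "(fock_norm (\<lambda>z. T m z + (- 1) * T n z))^2 = (fock_dist (T m) (T n))^2" by (simp add: fock_dist_def)
    moreover note s(2)[of m] s(2)[of n]
    ultimately show ?thesis by (simp add: algebra_simps)
  qed
  have "\<exists>N. \<forall>m\<ge>N. \<forall>n\<ge>N. fock_dist (T m) (T n) < e" if e: "e > 0" for e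
  proof -
    obtain N where N: "1 / real (Suc N) < e^2 / 4" using nat_approx_posE[of "e^2 / 4"] e by auto
    have "fock_dist (T m) (T n) < e" if "m \<ge> N" "n \<ge> N" for m n
    proof (rule power2_less_imp_less)
      have "1 / real (Suc m) \<le> 1 / real (Suc N)" "1 / real (Suc n) \<le> 1 / real (Suc N)"
        using that by (auto intro!: divide_left_mono)
      with N par[of m n] show "(fock_dist (T m) (T n))^2 < e^2" by (simp add: algebra_simps)
    qed (use e in simp)
    thus ?thesis by blast
  qed
  from fock_Cauchy_converges[OF TF this] obtain g where g: "g \<in> fock_space" "(\<lambda>n. fock_dist (T n) g) \<longlonglongrightarrow> 0" by blast
  have normlim: "(\<lambda>n. (fock_norm (\<lambda>z. T n z + c * Y z))^2) \<longlonglongrightarrow> (fock_norm (\<lambda>z. g z + c * Y z))^2"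
    if Y: "Y \<in> fock_space" for c Y
  proof -
    have "\<bar>fock_norm (\<lambda>z. T n z + c * Y z) - fock_norm (\<lambda>z. g z + c * Y z)\<bar> \<le> fock_dist (T n) g" for n
    proof -
      let ?A = "\<lambda>z. T n z + c * Y z" and ?B = "\<lambda>z. g z + c * Y z"
      have A: "?A \<in> fock_space" "?B \<in> fock_space" by (intro fock_space_add_scale TF g Y)+
      have "fock_norm (\<lambda>z. (T n z - g z) + ?B z) \<le> fock_norm (\<lambda>z. T n z - g z) + fock_norm ?B"
        by (intro fock_norm_triangle A fock_space_diff TF g)
      moreover have "fock_norm (\<lambda>z. (g z - T n z) + ?A z) \<le> fock_norm (\<lambda>z. g z - T n z) + fock_norm ?A"
        by (intro fock_norm_triangle A fock_space_diff TF g)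
      moreover have "fock_norm (\<lambda>z. g z - T n z) = fock_norm (\<lambda>z. T n z - g z)"
        using fock_norm_uminus[of "\<lambda>z. T n z - g z"] by simp
      ultimately show ?thesis by (simp add: fock_dist_def)
    qed
    hence "(\<lambda>n. fock_norm (\<lambda>z. T n z + c * Y z)) \<longlonglongrightarrow> fock_norm (\<lambda>z. g z + c * Y z)"
      by (intro LIM_zero_cancel[OF Lim_null_comparison[OF _ g(2)]]) auto
    thus ?thesis by (rule tendsto_power)
  qed
  have gmin: "(fock_norm (\<lambda>z. g z + c * Y z))^2 \<ge> D" if "Y \<in> S" for c Y
  proof (rule tendsto_lowerbound[OF normlim])
    have "D \<le> (fock_norm (\<lambda>z. T n z + c * Y z))^2" for n
    proof -
      have "(\<lambda>z. s n z + (- c) * Y z) \<in> S" by (intro lin s that)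
      from DQ[OF this] show ?thesis by (simp add: Q_def T_def algebra_simps)
    qed
    thus "eventually (\<lambda>n. D \<le> (fock_norm (\<lambda>z. T n z + c * Y z))^2) sequentially" by simp
  qed (use that SF in auto)
  have gD: "(fock_norm g)^2 = D"
  proof -
    have "(\<lambda>n. Q (s n)) \<longlonglongrightarrow> (fock_norm g)^2"
      using normlim[OF G, of 0] by (simp add: Q_def T_def)
    moreover have "(\<lambda>n. Q (s n)) \<longlonglongrightarrow> D"
    proof (rule tendsto_sandwich)
      show "eventually (\<lambda>n. D \<le> Q (s n)) sequentially" using DQ s by simp
      show "eventually (\<lambda>n. Q (s n) \<le> D + 1 / real (Suc n)) sequentially" using s by (simp add: less_imp_le)
      have "(\<lambda>n. D + 1 / real (Suc n)) \<longlonglongrightarrow> D + 0" by (intro tendsto_intros LIMSEQ_Suc lim_1_over_n)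
      thus "(\<lambda>n. D + 1 / real (Suc n)) \<longlonglongrightarrow> D" by simp
    qed auto
    ultimately show ?thesis by (rule LIMSEQ_unique)
  qed
  have orth: "fock_inner Y g = 0" if Y: "Y \<in> S" for Y
  proof -
    have YF: "Y \<in> fock_space" using Y SF by blast
    define a where "a = fock_inner Y g"
    have key: "t * (2 * (cmod a)^2) \<le> t^2 * ((cmod a)^2 * (fock_norm Y)^2)" if "t > 0" for t
    proof -
      have "D \<le> D + 2 * Re (- of_real t * cnj a * a) + (cmod (- of_real t * cnj a))^2 * (fock_norm Y)^2"
        using gmin[OF Y, of "- of_real t * cnj a"] fock_norm_add_scale_power2[OF g(1) YF, of "- of_real t * cnj a"]
        by (simp add: gD a_def)
      moreover have "Re (- of_real t * cnj a * a) = - t * (cmod a)^2"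
        unfolding cmod_power2 by (simp add: power2_eq_square algebra_simps)
      moreover have "(cmod (- of_real t * cnj a))^2 = t^2 * (cmod a)^2"
        by (simp add: norm_mult power_mult_distrib)
      ultimately have "D \<le> D + 2 * (- t * (cmod a)^2) + t^2 * (cmod a)^2 * (fock_norm Y)^2" by metis
      thus ?thesis by (simp add: mult.assoc)
    qed
    have "2 * (cmod a)^2 \<le> 0"
    proof (rule tendsto_lowerbound)
      show "((\<lambda>t. t * ((cmod a)^2 * (fock_norm Y)^2)) \<longlongrightarrow> 0) (at_right 0)"
        by (auto intro!: tendsto_eq_intros)
      have "2 * (cmod a)^2 \<le> t * ((cmod a)^2 * (fock_norm Y)^2)" if "t > 0" for t
        using key[OF that] that by (simp add: power2_eq_square mult.assoc)
      thus "eventually (\<lambda>t. 2 * (cmod a)^2 \<le> t * ((cmod a)^2 * (fock_norm Y)^2)) (at_right 0)"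
        by (auto simp: eventually_at_right_field intro: exI[of _ 1])
    qed simp
    thus ?thesis by (simp add: a_def)
  qed
  have "fock_inner G g \<noteq> 0"
  proof
    assume Gg: "fock_inner G g = 0"
    have "fock_inner (T n) g = 0" for n
      using fock_inner_add_scale[OF G sF g(1), of "-1" n] Gg orth[OF s(1)] by (simp add: T_def[abs_def])
    hence "fock_inner g (T n) = 0" for n by (metis fock_inner_commute complex_cnj_zero)
    hence "(fock_norm (\<lambda>z. T n z + (-1) * g z))^2 = (fock_norm (T n))^2 + D" for n
      by (subst fock_norm_add_scale_power2[OF TF g(1)]) (simp add: gD)
    hence "D \<le> (fock_dist (T n) g)^2" for n by (simp add: fock_dist_def)
    moreover have "(\<lambda>n. (fock_dist (T n) g)^2) \<longlonglongrightarrow> 0^2" by (intro tendsto_power g)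
    ultimately have "D \<le> 0^2" using LIMSEQ_le_const by blast
    thus False using Dpos by simp
  qed
  thus ?thesis using g(1) orth by blast
qed

section \<open>Limits of entire multiples\<close>

lemma nonzero_on_small_sphere:
  assumes F: "F holomorphic_on UNIV" and p: "F p \<noteq> 0"
  shows "\<exists>r>0. r \<le> 1 \<and> (\<forall>z. cmod (z - x) = r \<longrightarrow> F z \<noteq> 0)"
proof -
  obtain r where r: "r > 0" "\<And>z. z \<in> ball x r - {x} \<Longrightarrow> F z \<noteq> 0"
  proof (cases "F x = 0")
    case True
    thus ?thesis using isolated_zeros[OF F open_UNIV connected_UNIV UNIV_I True UNIV_I p] that by metis
  next
    case False
    have "open {z. F z \<noteq> 0}" by (intro open_Collect_neq continuous_on_const entire_continuous F)
    then obtain r where "r > 0" "ball x r \<subseteq> {z. F z \<noteq> 0}" using False open_contains_ball by blast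
    thus ?thesis by (intro that[of r]) auto
  qed
  have "F z \<noteq> 0" if "cmod (z - x) = min (r / 2) 1" for z
  proof -
    have "z \<noteq> x" "cmod (z - x) < r" using that r(1) by (auto simp: min_def split: if_splits)
    thus ?thesis using r(2)[of z] by (auto simp: dist_norm norm_minus_commute)
  qed
  thus ?thesis using r(1) by (intro exI[of _ "min (r / 2) 1"]) auto
qed

text \<open>
  Around each point choose a circle free of zeros of $F$. There $h_m - h_n$ is controlled by the
  pointwise difference of $h_m F$ and $h_n F$, and the maximum principle carries the bound into the
  disc, over the zeros of $F$.
\<close>
lemma entire_multiples_closed:
  assumes F: "F holomorphic_on UNIV" and p: "F p \<noteq> 0"
    and S: "\<And>n. S n \<in> fock_space" "\<And>n. S n \<in> entire_multiples F"
    and X: "X \<in> fock_space" and lim: "(\<lambda>n. fock_dist (S n) X) \<longlonglongrightarrow> 0"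
  shows "X \<in> entire_multiples F"
proof -
  have "\<exists>h. h holomorphic_on UNIV \<and> S n = (\<lambda>z. h z * F z)" for n
    using S(2)[of n] by (auto simp: entire_multiples_def entire_functions_def)
  then obtain h where h: "\<And>n. h n holomorphic_on UNIV" "\<And>n. S n = (\<lambda>z. h n z * F z)" by metis
  have "\<exists>r>0. uniformly_Cauchy_on (cball x r) h" for x
  proof -
    obtain r where r: "r > 0" "r \<le> 1" "\<And>z. cmod (z - x) = r \<Longrightarrow> F z \<noteq> 0"
      using nonzero_on_small_sphere[OF F p] by blast
    have "continuous_on (sphere x r) (\<lambda>z. cmod (F z))"
      using F holomorphic_on_imp_continuous_on holomorphic_on_subset
      by (intro continuous_on_norm) blast
    moreover have "compact (sphere x r)" "sphere x r \<noteq> {}" using r by auto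
    ultimately obtain y where y: "y \<in> sphere x r" "\<And>z. z \<in> sphere x r \<Longrightarrow> cmod (F y) \<le> cmod (F z)"
      using continuous_attains_inf[of "sphere x r" "\<lambda>z. cmod (F z)"] by metis
    define m where "m = cmod (F y)"
    have m: "m > 0" using y r(3)[of y] by (auto simp: m_def dist_norm norm_minus_commute)
    define E where "E = exp (pi * (cmod x + 2)^2) / m"
    have E: "E > 0" using m by (simp add: E_def)
    have bd: "cmod (h j z - h k z) \<le> E * fock_dist (S j) (S k)" if z: "z \<in> cball x r" for j k z
    proof (rule maximum_modulus_frontier[where S = "cball x r" and f = "\<lambda>z. h j z - h k z"])
      have holjk: "(\<lambda>z. h j z - h k z) holomorphic_on UNIV" by (intro holomorphic_intros h)
      show "(\<lambda>z. h j z - h k z) holomorphic_on interior (cball x r)"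
        using holjk by (rule holomorphic_on_subset) auto
      show "continuous_on (closure (cball x r)) (\<lambda>z. h j z - h k z)"
        by (rule holomorphic_on_imp_continuous_on[OF holomorphic_on_subset[OF holjk]]) auto
      fix z assume "z \<in> frontier (cball x r)"
      hence zs: "z \<in> sphere x r" by simp
      have "m * cmod (h j z - h k z) \<le> cmod (F z) * cmod (h j z - h k z)"
        using y(2)[OF zs] by (intro mult_right_mono) (auto simp: m_def)
      also have "\<dots> = cmod (S j z - S k z)" by (simp add: h(2) norm_mult[symmetric] algebra_simps)
      also have "\<dots> \<le> exp (pi * (cmod z + 1)^2) * fock_dist (S j) (S k)"
        using fock_pointwise_bound[OF fock_space_diff[OF S(1)[of j] S(1)[of k]], of z] by (simp add: fock_dist_def)
      also have "\<dots> \<le> exp (pi * (cmod x + 2)^2) * fock_dist (S j) (S k)"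
      proof (rule mult_right_mono)
        have "cmod z \<le> cmod x + 1"
          using zs r(2) norm_triangle_sub[of z x] by (simp add: dist_norm norm_minus_commute)
        hence "pi * (cmod z + 1)^2 \<le> pi * (cmod x + 2)^2" by (intro mult_left_mono power_mono) auto
        thus "exp (pi * (cmod z + 1)^2) \<le> exp (pi * (cmod x + 2)^2)" by simp
      qed (simp add: fock_dist_def fock_norm_nonneg)
      finally show "cmod (h j z - h k z) \<le> E * fock_dist (S j) (S k)"
        using m by (simp add: E_def field_simps)
    qed (use z in auto)
    have "uniformly_Cauchy_on (cball x r) h"
      unfolding uniformly_Cauchy_on_def
    proof (intro allI impI)
      fix e :: real assume e: "e > 0"
      have "eventually (\<lambda>n. fock_dist (S n) X < e / (2 * E)) sequentially"
        using lim e E by (intro order_tendstoD) auto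
      then obtain N where N: "\<And>n. n \<ge> N \<Longrightarrow> fock_dist (S n) X < e / (2 * E)"
        by (auto simp: eventually_sequentially)
      have "dist (h j z) (h k z) < e" if "z \<in> cball x r" "j \<ge> N" "k \<ge> N" for z j k
      proof -
        have "fock_dist (S j) (S k) \<le> fock_dist (S j) X + fock_dist X (S k)" by (rule Fock.triangle[OF S(1) X S(1)])
        also have "fock_dist X (S k) = fock_dist (S k) X" by (rule Fock.commute)
        also have "fock_dist (S j) X + fock_dist (S k) X < e / (2 * E) + e / (2 * E)"
          using N that by (intro add_strict_mono) auto
        finally have "E * fock_dist (S j) (S k) < E * (e / E)" using E by (simp add: field_simps)
        thus ?thesis using bd[OF that(1), of j k] E by (simp add: dist_norm)
      qed
      thus "\<exists>M. \<forall>z\<in>cball x r. \<forall>j\<ge>M. \<forall>k\<ge>M. dist (h j z) (h k z) < e" by blast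
    qed
    thus ?thesis using r by blast
  qed
  note lm = entire_locally_uniform_limit[of h, OF h(1) this]
  have "X z = lim (\<lambda>n. h n z) * F z" for z
  proof -
    have "(\<lambda>n. S n z) \<longlonglongrightarrow> lim (\<lambda>n. h n z) * F z"
      unfolding h(2) by (intro tendsto_mult lm tendsto_const)
    moreover have "(\<lambda>n. S n z) \<longlonglongrightarrow> X z"
    proof -
      have "cmod (S n z - X z) \<le> exp (pi * (cmod z + 1)^2) * fock_dist (S n) X" for n
        using fock_pointwise_bound[OF fock_space_diff[OF S(1)[of n] X], of z] by (simp add: fock_dist_def)
      hence "eventually (\<lambda>n. norm (S n z - X z) \<le> exp (pi * (cmod z + 1)^2) * fock_dist (S n) X) sequentially"
        by (simp only: eventually_True)
      moreover have "(\<lambda>n. exp (pi * (cmod z + 1)^2) * fock_dist (S n) X) \<longlonglongrightarrow> 0"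
        using tendsto_mult_left[OF lim, of "exp (pi * (cmod z + 1)^2)"] by simp
      ultimately have "(\<lambda>n. S n z - X z) \<longlonglongrightarrow> 0" by (rule Lim_null_comparison)
      thus ?thesis by (rule LIM_zero_cancel)
    qed
    ultimately show ?thesis by (rule LIMSEQ_unique[rotated])
  qed
  hence "X = (\<lambda>z. lim (\<lambda>n. h n z) * F z)" by (rule ext)
  thus ?thesis unfolding entire_multiples_def entire_functions_def
    by (intro CollectI exI[of _ "\<lambda>z. lim (\<lambda>n. h n z)"] conjI lm(1))
qed

section \<open>Pairing divided differences with a Fock function\<close>

abbreviation divdiff_pairing :: "(complex \<Rightarrow> complex) \<Rightarrow> (complex \<Rightarrow> complex) \<Rightarrow> (complex \<Rightarrow> complex) \<Rightarrow> complex \<Rightarrow> complex" where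
  "divdiff_pairing F g h w \<equiv> fock_inner (\<lambda>z. divdiff h w z * F z) g"

abbreviation interpolant :: "(complex \<Rightarrow> complex) \<Rightarrow> (complex \<Rightarrow> complex) \<Rightarrow> (complex \<Rightarrow> complex) \<Rightarrow> complex \<Rightarrow> complex" where
  "interpolant F g h w \<equiv> fock_inner (\<lambda>z. h z * F z) g + w * divdiff_pairing F g h w"

lemma entire_bounded_on_disc:
  assumes "k holomorphic_on UNIV"
  obtains B where "\<And>\<zeta>. cmod (\<zeta> - w) \<le> r \<Longrightarrow> cmod (k \<zeta>) \<le> B"
proof -
  have "compact (k ` cball w r)"
    by (intro compact_continuous_image holomorphic_on_imp_continuous_on holomorphic_on_subset[OF assms]) auto
  then obtain B where "\<forall>x\<in>k ` cball w r. cmod x \<le> B"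
    using compact_imp_bounded bounded_iff by metis
  thus ?thesis by (intro that[of B]) (auto simp: dist_norm norm_minus_commute)
qed

text \<open>
  At distance at least 1 from $w$ the quotient is bounded directly; closer to $w$ the maximum
  principle for the unit circle around $w$ applies.
\<close>
lemma norm_divdiff_le:
  assumes k: "k holomorphic_on UNIV" and B: "\<And>\<zeta>. cmod (\<zeta> - w) \<le> 1 \<Longrightarrow> cmod (k \<zeta>) \<le> B"
  shows "cmod (divdiff k w z) \<le> cmod (k z) + 2 * B"
proof -
  have Bw: "cmod (k w) \<le> B" "B \<ge> 0" using B[of w] order_trans[OF norm_ge_zero B[of w]] by simp_all
  have far: "cmod (divdiff k w \<zeta>) \<le> cmod (k \<zeta>) + cmod (k w)" if "cmod (\<zeta> - w) \<ge> 1" for \<zeta>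
  proof -
    have "\<zeta> \<noteq> w" using that by auto
    hence "cmod (divdiff k w \<zeta>) = cmod (k \<zeta> - k w) / cmod (\<zeta> - w)" by (simp add: divdiff_def norm_divide)
    also have "\<dots> \<le> cmod (k \<zeta> - k w) / 1" using that by (intro divide_left_mono) auto
    also have "\<dots> \<le> cmod (k \<zeta>) + cmod (k w)" using norm_triangle_ineq4 by simp
    finally show ?thesis .
  qed
  show ?thesis
  proof (cases "cmod (z - w) \<ge> 1")
    case True
    thus ?thesis using far[of z] Bw by simp
  next
    case False
    have "cmod (divdiff k w z) \<le> 2 * B"
    proof (rule maximum_modulus_frontier[where S = "cball w 1" and f = "divdiff k w"])
      show "divdiff k w holomorphic_on interior (cball w 1)"
        using holomorphic_divdiff[OF k] by (rule holomorphic_on_subset) auto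
      show "continuous_on (closure (cball w 1)) (divdiff k w)"
        by (rule holomorphic_on_imp_continuous_on[OF holomorphic_on_subset[OF holomorphic_divdiff[OF k]]]) auto
      fix \<zeta> assume "\<zeta> \<in> frontier (cball w 1)"
      hence "cmod (\<zeta> - w) = 1" by (simp add: dist_norm norm_minus_commute)
      thus "cmod (divdiff k w \<zeta>) \<le> 2 * B" using far[of \<zeta>] B[of \<zeta>] Bw by simp
    qed (use False in \<open>auto simp: dist_norm norm_minus_commute\<close>)
    thus ?thesis using norm_ge_zero[of "k z"] by linarith
  qed
qed

text \<open>
  The resolvent identity for divided differences. It reduces differentiability of the pairing in $w$
  to continuity, and continuity to local boundedness.
\<close>
lemma divdiff_diff:
  assumes "w \<noteq> w0" "z \<noteq> w" "z \<noteq> w0"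
  shows "divdiff k w z - divdiff k w0 z = (w - w0) * divdiff (divdiff k w0) w z"
  using assms by (simp add: divdiff_def divide_simps) (simp add: algebra_simps)

text \<open>
  The constant $N$ does not depend on $w$. That is what makes the bound usable both for local
  boundedness in $w$ and for the growth as $w$ tends to infinity.
\<close>
lemma fock_space_divdiff:
  assumes k: "k holomorphic_on UNIV" and F: "F \<in> fock_space" and kF: "(\<lambda>z. k z * F z) \<in> fock_space"
    and g: "g \<in> fock_space"
  shows "(\<lambda>z. divdiff k w z * F z) \<in> fock_space"
    and "\<exists>N. \<forall>w B. (\<forall>\<zeta>. cmod (\<zeta> - w) \<le> 1 \<longrightarrow> cmod (k \<zeta>) \<le> B) \<longrightarrow>
           cmod (divdiff_pairing F g k w) \<le> N * (1 + B)"
proof -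
  have hol: "(\<lambda>z. divdiff k w z * F z) holomorphic_on UNIV" for w
    by (intro holomorphic_intros holomorphic_divdiff k fock_spaceD F)
  have [measurable]: "(\<lambda>z. divdiff k w z * F z) \<in> borel_measurable borel" for w
    by (rule entire_measurable[OF hol])
  have [measurable]: "F \<in> borel_measurable borel" "g \<in> borel_measurable borel" "k \<in> borel_measurable borel"
    using fock_spaceD(2) F g entire_measurable[OF k] by auto
  have bd: "cmod (divdiff k w z * F z) \<le> cmod (k z * F z) + 2 * B * cmod (F z)"
    if "\<And>\<zeta>. cmod (\<zeta> - w) \<le> 1 \<Longrightarrow> cmod (k \<zeta>) \<le> B" for w B z
  proof -
    have "cmod (divdiff k w z) * cmod (F z) \<le> (cmod (k z) + 2 * B) * cmod (F z)"
      using norm_divdiff_le[OF k that] by (intro mult_right_mono) auto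
    thus ?thesis by (simp add: norm_mult algebra_simps)
  qed
  have fock: "(\<lambda>z. divdiff k w z * F z) \<in> fock_space" for w
  proof -
    obtain B where B: "\<And>\<zeta>. cmod (\<zeta> - w) \<le> 1 \<Longrightarrow> cmod (k \<zeta>) \<le> B"
      using entire_bounded_on_disc[OF k, of w 1] by metis
    have "integrable lborel (\<lambda>z. (cmod (divdiff k w z * F z))^2 * gauss z)"
    proof (rule Bochner_Integration.integrable_bound)
      show "integrable lborel (\<lambda>z. 2 * ((cmod (k z * F z))^2 * gauss z) + 2 * (2 * B)^2 * ((cmod (F z))^2 * gauss z))"
        using fock_spaceD(3)[OF F] fock_spaceD(3)[OF kF] by simp
      have "(cmod (divdiff k w z * F z))^2 * gauss z \<le> 2 * ((cmod (k z * F z))^2 * gauss z) + 2 * (2 * B)^2 * ((cmod (F z))^2 * gauss z)" for z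
      proof -
        define a b where "a = cmod (k z * F z)" and "b = 2 * B * cmod (F z)"
        have "(cmod (divdiff k w z * F z))^2 \<le> (a + b)^2"
          unfolding a_def b_def using bd[OF B] by (intro power_mono) auto
        also have "\<dots> \<le> 2 * a^2 + 2 * b^2"
          using zero_le_power2[of "a - b"] by (simp add: power2_eq_square algebra_simps)
        finally have "(cmod (divdiff k w z * F z))^2 * gauss z \<le> (2 * a^2 + 2 * b^2) * gauss z"
          by (intro mult_right_mono) auto
        thus ?thesis by (simp add: a_def b_def power_mult_distrib algebra_simps)
      qed
      thus "AE z in lborel. norm ((cmod (divdiff k w z * F z))^2 * gauss z) \<le>
         norm (2 * ((cmod (k z * F z))^2 * gauss z) + 2 * (2 * B)^2 * ((cmod (F z))^2 * gauss z))"
        by simp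
    qed measurable
    thus ?thesis using hol by (auto simp: fock_space_def entire_functions_def gauss_def)
  qed
  thus "(\<lambda>z. divdiff k w z * F z) \<in> fock_space" .
  define I1 where "I1 = (LINT z|lborel. norm (k z * F z * cnj (g z) * of_real (gauss z)))"
  define I2 where "I2 = (LINT z|lborel. norm (F z * cnj (g z) * of_real (gauss z)))"
  have i1: "integrable lborel (\<lambda>z. norm (k z * F z * cnj (g z) * of_real (gauss z)))"
    using integrable_fock_inner[OF kF g] by simp
  have i2: "integrable lborel (\<lambda>z. norm (F z * cnj (g z) * of_real (gauss z)))"
    using integrable_fock_inner[OF F g] by simp
  have I0: "I1 \<ge> 0" "I2 \<ge> 0" by (auto simp: I1_def I2_def)
  have "cmod (divdiff_pairing F g k w) \<le> (I1 + 2 * I2) * (1 + B)"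
    if B: "\<And>\<zeta>. cmod (\<zeta> - w) \<le> 1 \<Longrightarrow> cmod (k \<zeta>) \<le> B" for w B
  proof -
    have B0: "B \<ge> 0" using order_trans[OF norm_ge_zero B[of w]] by simp
    have "cmod (LINT z|lborel. divdiff k w z * F z * cnj (g z) * of_real (gauss z))
       \<le> (LINT z|lborel. norm (k z * F z * cnj (g z) * of_real (gauss z)) + 2 * B * norm (F z * cnj (g z) * of_real (gauss z)))"
    proof (rule order_trans[OF integral_norm_bound], rule integral_mono)
      fix z
      have "cmod (divdiff k w z * F z) * (cmod (g z) * gauss z) \<le> (cmod (k z * F z) + 2 * B * cmod (F z)) * (cmod (g z) * gauss z)"
        by (intro mult_right_mono bd B) auto
      thus "norm (divdiff k w z * F z * cnj (g z) * of_real (gauss z)) \<le> norm (k z * F z * cnj (g z) * of_real (gauss z)) + 2 * B * norm (F z * cnj (g z) * of_real (gauss z))"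
        by (simp add: norm_mult algebra_simps)
    next
      show "integrable lborel (\<lambda>z. norm (divdiff k w z * F z * cnj (g z) * of_real (gauss z)))"
        by (intro integrable_norm integrable_fock_inner[OF fock g])
    qed (use i1 i2 in auto)
    also have "\<dots> = I1 + 2 * B * I2" using i1 i2 by (simp add: I1_def I2_def)
    also have "\<dots> \<le> (I1 + 2 * I2) * (1 + B)" using I0 B0 by (simp add: algebra_simps)
    finally have *: "cmod (LINT z|lborel. divdiff k w z * F z * cnj (g z) * of_real (gauss z)) \<le> (I1 + 2 * I2) * (1 + B)" .
    have "cmod (divdiff_pairing F g k w) = (1 / pi) * cmod (LINT z|lborel. divdiff k w z * F z * cnj (g z) * of_real (gauss z))"
      by (simp add: fock_inner_def norm_mult norm_divide)
    also have "\<dots> \<le> 1 * cmod (LINT z|lborel. divdiff k w z * F z * cnj (g z) * of_real (gauss z))"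
      using pi_ge_two by (intro mult_right_mono) auto
    finally show ?thesis using * by simp
  qed
  thus "\<exists>N. \<forall>w B. (\<forall>\<zeta>. cmod (\<zeta> - w) \<le> 1 \<longrightarrow> cmod (k \<zeta>) \<le> B) \<longrightarrow>
           cmod (divdiff_pairing F g k w) \<le> N * (1 + B)" by blast
qed

lemma fock_inner_divdiff_diff:
  assumes k: "k holomorphic_on UNIV" and F: "F \<in> fock_space" and kF: "(\<lambda>z. k z * F z) \<in> fock_space"
    and g: "g \<in> fock_space" and w: "w \<noteq> w0"
  shows "divdiff_pairing F g k w - divdiff_pairing F g k w0
    = (w - w0) * divdiff_pairing F g (divdiff k w0) w"
proof -
  define k' where "k' = divdiff k w0"
  have k': "k' holomorphic_on UNIV" "(\<lambda>z. k' z * F z) \<in> fock_space"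
    unfolding k'_def using holomorphic_divdiff[OF k] fock_space_divdiff(1)[OF k F kF g] by auto
  let ?P = "\<lambda>k z. k z * F z * cnj (g z) * of_real (gauss z)"
  have i: "integrable lborel (?P (divdiff k w))" "integrable lborel (?P k')" "integrable lborel (?P (divdiff k' w))"
    using integrable_fock_inner[OF _ g] fock_space_divdiff(1)[OF k F kF g] k' fock_space_divdiff(1)[OF k'(1) F k'(2) g] by auto
  have "(LINT z|lborel. ?P (divdiff k w) z - ?P k' z) = (LINT z|lborel. (w - w0) * ?P (divdiff k' w) z)"
  proof (rule integral_cong_AE)
    have "AE z in lborel. z \<notin> {w, w0}" by (rule AE_I'[of "{w, w0}"]) (auto simp: finite_imp_null_set_lborel)
    thus "AE z in lborel. ?P (divdiff k w) z - ?P k' z = (w - w0) * ?P (divdiff k' w) z"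
    proof eventually_elim
      case (elim z)
      have "?P (divdiff k w) z - ?P k' z = (divdiff k w z - divdiff k w0 z) * (F z * cnj (g z) * of_real (gauss z))"
        by (simp add: k'_def algebra_simps)
      also have "divdiff k w z - divdiff k w0 z = (w - w0) * divdiff k' w z"
        unfolding k'_def using elim w by (intro divdiff_diff) auto
      finally show ?case by (simp add: mult.assoc)
    qed
  qed (use i in auto)
  also have "\<dots> = (w - w0) * (LINT z|lborel. ?P (divdiff k' w) z)" by simp
  also have "(LINT z|lborel. ?P (divdiff k w) z - ?P k' z) = (LINT z|lborel. ?P (divdiff k w) z) - (LINT z|lborel. ?P k' z)"
    using i by simp
  finally show ?thesis by (simp add: fock_inner_def k'_def diff_divide_distrib[symmetric])
qed

text \<open>
  By the resolvent identity the difference quotient at $w_0$ is the same pairing for the function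
  \<open>divdiff k w0\<close>, which again satisfies the hypotheses. So continuity of all such
  pairings yields the derivative, and local boundedness of all such pairings yields continuity.
\<close>
lemma holomorphic_fock_inner_divdiff:
  assumes k: "k holomorphic_on UNIV" and F: "F \<in> fock_space" and kF: "(\<lambda>z. k z * F z) \<in> fock_space"
    and g: "g \<in> fock_space"
  shows "(\<lambda>w. divdiff_pairing F g k w) holomorphic_on UNIV"
proof -
  define \<Phi> where "\<Phi> k w = divdiff_pairing F g k w" for k w
  have cont: "isCont (\<Phi> k) w0" if k: "k holomorphic_on UNIV" and kF: "(\<lambda>z. k z * F z) \<in> fock_space" for k w0
  proof -
    define k' where "k' = divdiff k w0"
    have k': "k' holomorphic_on UNIV" "(\<lambda>z. k' z * F z) \<in> fock_space"
      unfolding k'_def using holomorphic_divdiff[OF k] fock_space_divdiff(1)[OF k F kF g] by auto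
    obtain N where N: "\<And>w B. (\<forall>\<zeta>. cmod (\<zeta> - w) \<le> 1 \<longrightarrow> cmod (k' \<zeta>) \<le> B) \<Longrightarrow> cmod (\<Phi> k' w) \<le> N * (1 + B)"
      using fock_space_divdiff(2)[OF k'(1) F k'(2) g] unfolding \<Phi>_def by blast
    obtain B where B: "\<And>\<zeta>. cmod (\<zeta> - w0) \<le> 2 \<Longrightarrow> cmod (k' \<zeta>) \<le> B"
      using entire_bounded_on_disc[OF k'(1), of w0 2] by metis
    have bd: "cmod (\<Phi> k w - \<Phi> k w0) \<le> cmod (w - w0) * (N * (1 + B))" if w: "cmod (w - w0) < 1" for w
    proof (cases "w = w0")
      case False
      have "cmod (\<Phi> k' w) \<le> N * (1 + B)"
      proof (rule N, intro allI impI B)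
        fix \<zeta> assume "cmod (\<zeta> - w) \<le> 1"
        thus "cmod (\<zeta> - w0) \<le> 2" using w norm_triangle_ineq[of "\<zeta> - w" "w - w0"] by simp
      qed
      thus ?thesis using fock_inner_divdiff_diff[OF k F kF g False]
        by (simp add: \<Phi>_def k'_def norm_mult mult_left_mono)
    qed simp
    have "((\<lambda>w. \<Phi> k w - \<Phi> k w0) \<longlongrightarrow> 0) (at w0)"
    proof (rule Lim_null_comparison)
      show "eventually (\<lambda>w. norm (\<Phi> k w - \<Phi> k w0) \<le> cmod (w - w0) * (N * (1 + B))) (at w0)"
        unfolding eventually_at using bd by (intro exI[of _ 1]) (auto simp: dist_norm)
      show "((\<lambda>w. cmod (w - w0) * (N * (1 + B))) \<longlongrightarrow> 0) (at w0)"
        by (auto intro!: tendsto_eq_intros)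
    qed
    thus ?thesis unfolding isCont_def by (rule LIM_zero_cancel)
  qed
  have "(\<Phi> k has_field_derivative \<Phi> (divdiff k w0) w0) (at w0)" for w0
    unfolding has_field_derivative_iff
  proof (rule Lim_transform_eventually)
    have "isCont (\<Phi> (divdiff k w0)) w0"
      by (intro cont holomorphic_divdiff k fock_space_divdiff(1)[OF k F kF g])
    thus "(\<Phi> (divdiff k w0) \<longlongrightarrow> \<Phi> (divdiff k w0) w0) (at w0)" by (simp add: isCont_def)
    have "\<Phi> (divdiff k w0) w = (\<Phi> k w - \<Phi> k w0) / (w - w0)" if "w \<noteq> w0" for w
      using fock_inner_divdiff_diff[OF k F kF g that] that by (simp add: \<Phi>_def)
    thus "eventually (\<lambda>w. \<Phi> (divdiff k w0) w = (\<Phi> k w - \<Phi> k w0) / (w - w0)) (at w0)"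
      by (auto simp: eventually_at_filter)
  qed
  thus ?thesis unfolding \<Phi>_def holomorphic_on_open[OF open_UNIV] by blast
qed

section \<open>Functions orthogonal to all exponential multiples\<close>

lemma integrable_gaussian:
  assumes "c > 0"
  shows "integrable lborel (\<lambda>z::complex. exp (- c * (cmod z)^2))"
proof (rule integrableI_nonneg)
  show "(\<lambda>z::complex. exp (- c * (cmod z)^2)) \<in> borel_measurable lborel" by measurable
qed (use nn_integral_gaussian_finite[OF assms] in auto)

lemma integrable_square_of_growth:
  assumes [measurable]: "X \<in> borel_measurable borel" and b: "b < pi / 2"
    and le: "\<And>z. cmod (X z) \<le> A * exp (b * (cmod z)^2)"
  shows "integrable lborel (\<lambda>z. (cmod (X z))^2 * gauss z)"
proof (rule Bochner_Integration.integrable_bound)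
  show "integrable lborel (\<lambda>z::complex. A^2 * exp (- (pi - 2 * b) * (cmod z)^2))"
    using b by (intro integrable_mult_right integrable_gaussian) simp
  have "(cmod (X z))^2 * gauss z \<le> A^2 * exp (- (pi - 2 * b) * (cmod z)^2)" for z
  proof -
    have "(cmod (X z))^2 * gauss z \<le> (A * exp (b * (cmod z)^2))^2 * gauss z"
      by (intro mult_right_mono power_mono le) auto
    also have "\<dots> = A^2 * (exp (b * (cmod z)^2) * exp (b * (cmod z)^2) * exp (- pi * (cmod z)^2))"
      by (simp add: power_mult_distrib power2_eq_square[of "exp _"] gauss_def)
    also have "exp (b * (cmod z)^2) * exp (b * (cmod z)^2) * exp (- pi * (cmod z)^2) = exp (- (pi - 2 * b) * (cmod z)^2)"
      by (simp add: mult_exp_exp algebra_simps)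
    finally show ?thesis .
  qed
  thus "AE z in lborel. norm ((cmod (X z))^2 * gauss z) \<le> norm (A^2 * exp (- (pi - 2 * b) * (cmod z)^2))"
    by simp
qed measurable

text \<open>
  By $t|z| \le t^2 + |z|^2/4$ an exponential factor raises the type by at most $1/4$, and $\kappa +
  1/4$ is still below the exponent $\pi/2$ of the half weight when $\kappa \le 1/4$.
\<close>
lemma exp_multiple_growth:
  assumes gr: "\<And>z. cmod (F z) \<le> C * exp (\<kappa> * (cmod z)^2)" and C: "C \<ge> 0"
  shows "exp (t * cmod (z - w)) * cmod (F z) \<le> (C * exp (t^2 + \<bar>t\<bar> * cmod w)) * exp ((\<kappa> + 1 / 4) * (cmod z)^2)"
proof -
  have "t * cmod (z - w) \<le> \<bar>t\<bar> * cmod (z - w)" by (intro mult_right_mono) auto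
  also have "\<dots> \<le> \<bar>t\<bar> * (cmod z + cmod w)" by (intro mult_left_mono norm_triangle_ineq4) auto
  also have "\<dots> \<le> t^2 + \<bar>t\<bar> * cmod w + 1 / 4 * (cmod z)^2"
    using zero_le_power2[of "\<bar>t\<bar> - cmod z / 2"] by (simp add: power2_eq_square algebra_simps)
  finally have "exp (t * cmod (z - w)) * cmod (F z) \<le> exp (t^2 + \<bar>t\<bar> * cmod w + 1 / 4 * (cmod z)^2) * (C * exp (\<kappa> * (cmod z)^2))"
    by (intro mult_mono gr) auto
  also have "\<dots> = (C * exp (t^2 + \<bar>t\<bar> * cmod w)) * exp ((\<kappa> + 1 / 4) * (cmod z)^2)"
    by (simp add: exp_add distrib_right)
  finally show ?thesis .
qed

lemma exp_multiple_in_fock: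
  assumes hol: "F holomorphic_on UNIV" and gr: "\<And>z. cmod (F z) \<le> C * exp (\<kappa> * (cmod z)^2)" and \<kappa>: "\<kappa> \<le> 1 / 4"
  shows "(\<lambda>z. exp (l * z) * F z) \<in> fock_space"
proof -
  have C: "C \<ge> 0" using order_trans[OF norm_ge_zero gr[of 0]] by simp
  have h: "(\<lambda>z. exp (l * z) * F z) holomorphic_on UNIV" by (intro holomorphic_intros hol)
  have "integrable lborel (\<lambda>z. (cmod (exp (l * z) * F z))^2 * gauss z)"
  proof (rule integrable_square_of_growth[OF entire_measurable[OF h]])
    show "cmod (exp (l * z) * F z) \<le> (C * exp ((cmod l)^2 + \<bar>cmod l\<bar> * cmod 0)) * exp ((\<kappa> + 1 / 4) * (cmod z)^2)" for z
    proof -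
      have "cmod (exp (l * z)) \<le> exp (cmod l * cmod (z - 0))"
        using complex_Re_le_cmod[of "l * z"] by (simp add: norm_mult)
      hence "cmod (exp (l * z) * F z) \<le> exp (cmod l * cmod (z - 0)) * cmod (F z)"
        unfolding norm_mult by (intro mult_right_mono) auto
      also note exp_multiple_growth[OF gr C]
      finally show ?thesis .
    qed
  qed (use \<kappa> pi_ge_two in linarith)
  thus ?thesis using h by (simp add: fock_space_def entire_functions_def gauss_def)
qed

text \<open>
  These are Riemann sums of $\int_0^1 l e^{s l \zeta}\,ds$; being geometric, they are computed in
  closed form, and the limit comes from the derivative of the exponential function at 0.
\<close>
lemma riemann_sum_exp_tendsto:
  fixes l \<zeta> :: complex
  assumes \<zeta>: "\<zeta> \<noteq> 0"
  shows "(\<lambda>n. \<Sum>k<Suc n. l / of_nat (Suc n) * exp (of_nat k * (l * \<zeta> / of_nat (Suc n)))) \<longlonglongrightarrow> (exp (l * \<zeta>) - 1) / \<zeta>"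
proof (cases "l = 0")
  case False
  define a where "a = l * \<zeta>"
  have a: "a \<noteq> 0" using False \<zeta> by (simp add: a_def)
  define q where "q n = exp (a / of_nat (Suc n))" for n
  have "((\<lambda>h. (exp h - 1) / h) \<longlongrightarrow> 1) (at (0::complex))"
    using DERIV_exp[of "0::complex"] by (simp add: has_field_derivative_iff)
  moreover have "filterlim (\<lambda>n. a / of_nat (Suc n)) (at 0) sequentially"
  proof -
    have "(\<lambda>n. a * (1 / of_nat (Suc n))) \<longlonglongrightarrow> a * 0"
      by (intro tendsto_mult tendsto_const LIMSEQ_Suc lim_1_over_n)
    thus ?thesis using a by (auto simp: filterlim_at simp del: of_nat_Suc)
  qed
  ultimately have "(\<lambda>n. (q n - 1) / (a / of_nat (Suc n))) \<longlonglongrightarrow> 1"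
    unfolding q_def by (rule filterlim_compose)
  hence lim: "(\<lambda>n. (exp a - 1) / \<zeta> / ((q n - 1) / (a / of_nat (Suc n)))) \<longlonglongrightarrow> (exp a - 1) / \<zeta> / 1"
    by (intro tendsto_divide tendsto_const) auto
  have "eventually (\<lambda>n. (q n - 1) / (a / of_nat (Suc n)) \<noteq> 0) sequentially"
    using \<open>(\<lambda>n. (q n - 1) / (a / of_nat (Suc n))) \<longlonglongrightarrow> 1\<close> by (rule tendsto_imp_eventually_ne) simp
  hence "eventually (\<lambda>n. (exp a - 1) / \<zeta> / ((q n - 1) / (a / of_nat (Suc n)))
     = (\<Sum>k<Suc n. l / of_nat (Suc n) * exp (of_nat k * (a / of_nat (Suc n))))) sequentially"
  proof eventually_elim
    case (elim n)
    hence q: "q n \<noteq> 1" by auto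
    have "(\<Sum>k<Suc n. l / of_nat (Suc n) * exp (of_nat k * (a / of_nat (Suc n)))) = l / of_nat (Suc n) * (\<Sum>k<Suc n. q n ^ k)"
      by (simp only: sum_distrib_left q_def exp_of_nat_mult)
    also have "(\<Sum>k<Suc n. q n ^ k) = (q n ^ Suc n - 1) / (q n - 1)" by (rule geometric_sum[OF q])
    also have "q n ^ Suc n = exp a"
      by (simp only: q_def exp_of_nat_mult[symmetric]) (simp del: of_nat_Suc)
    finally have eq: "(\<Sum>k<Suc n. l / of_nat (Suc n) * exp (of_nat k * (a / of_nat (Suc n)))) = l / of_nat (Suc n) * ((exp a - 1) / (q n - 1))" .
    have "x / \<zeta> / (y / (a / m)) = l / m * (x / y)" for x y m :: complex
      using False \<zeta> by (simp add: a_def mult.commute)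
    thus ?case unfolding eq .
  qed
  from Lim_transform_eventually[OF lim this] show ?thesis by (simp add: a_def)
qed simp

text \<open>
  The quotient is a limit of linear combinations of exponentials, by
  \<open>riemann_sum_exp_tendsto\<close>, and the sums are dominated by $|l| e^{|l||z-w|}$, which is
  integrable against the weight.
\<close>
lemma orthogonal_exp_quotient:
  assumes hol: "F holomorphic_on UNIV" and gr: "\<And>z. cmod (F z) \<le> C * exp (\<kappa> * (cmod z)^2)" and \<kappa>: "\<kappa> \<le> 1 / 4"
    and g: "g \<in> fock_space" and orth: "\<And>l. fock_inner (\<lambda>z. exp (l * z) * F z) g = 0"
  shows "integrable lborel (\<lambda>z. (exp (l * (z - w)) - 1) / (z - w) * (F z * cnj (g z) * of_real (gauss z)))"
    and "(LINT z|lborel. (exp (l * (z - w)) - 1) / (z - w) * (F z * cnj (g z) * of_real (gauss z))) = 0"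
proof -
  define P where "P z = F z * cnj (g z) * of_real (gauss z)" for z
  have C: "C \<ge> 0" using order_trans[OF norm_ge_zero gr[of 0]] by simp
  have [measurable]: "F \<in> borel_measurable borel" "g \<in> borel_measurable borel"
    using entire_measurable[OF hol] fock_spaceD(2)[OF g] by auto
  have [measurable]: "(\<lambda>z. exp (c * z)) \<in> borel_measurable borel" for c :: complex
    by (intro borel_measurable_continuous_onI continuous_intros)
  have mexp [measurable]: "(\<lambda>z. exp (c * (z - w))) \<in> borel_measurable borel" for c :: complex
    by (intro borel_measurable_continuous_onI continuous_intros)
  have P [measurable]: "P \<in> borel_measurable borel" unfolding P_def by measurable
  have eP: "integrable lborel (\<lambda>z. exp (c * z) * P z)" "(LINT z|lborel. exp (c * z) * P z) = 0" for c
  proof -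
    show "integrable lborel (\<lambda>z. exp (c * z) * P z)"
      using integrable_fock_inner[OF exp_multiple_in_fock[OF hol gr \<kappa>] g, of c] by (simp add: P_def mult_ac)
    have "(LINT z|lborel. exp (c * z) * P z) = (LINT z|lborel. exp (c * z) * F z * cnj (g z) * of_real (gauss z))"
      by (simp add: P_def mult_ac)
    thus "(LINT z|lborel. exp (c * z) * P z) = 0" using orth[of c] by (simp add: fock_inner_def)
  qed
  define s where "s n z = (\<Sum>k<Suc n. l / of_nat (Suc n) * exp (of_nat k * (l * (z - w) / of_nat (Suc n)))) * P z" for n z
  define c where "c n k = of_nat k * l / (of_nat (Suc n) :: complex)" for n k
  have s_eq: "s n z = (\<Sum>k<Suc n. (l / of_nat (Suc n) * exp (- c n k * w)) * (exp (c n k * z) * P z))" for n z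
  proof -
    have "exp (of_nat k * (l * (z - w) / of_nat (Suc n))) = exp (- c n k * w) * exp (c n k * z)" for k
      by (simp add: c_def mult_exp_exp algebra_simps diff_divide_distrib del: of_nat_Suc)
    thus ?thesis by (simp add: s_def sum_distrib_right mult.assoc del: sum.lessThan_Suc of_nat_Suc)
  qed
  have ints: "(LINT z|lborel. s n z) = 0" for n
    unfolding s_eq by (subst Bochner_Integration.integral_sum) (use eP in auto)
  define D where "D z = cmod l * (exp (cmod l * cmod (z - w)) * cmod (P z))" for z
  have intD: "integrable lborel D"
  proof -
    define X where "X z = of_real (exp (cmod l * cmod (z - w))) * F z" for z
    have [measurable]: "X \<in> borel_measurable borel" unfolding X_def by measurable
    have "integrable lborel (\<lambda>z. (cmod (X z))^2 * gauss z)"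
    proof (rule integrable_square_of_growth)
      show "cmod (X z) \<le> (C * exp ((cmod l)^2 + \<bar>cmod l\<bar> * cmod w)) * exp ((\<kappa> + 1 / 4) * (cmod z)^2)" for z
        using exp_multiple_growth[of F C \<kappa> "cmod l", OF gr C] by (simp add: X_def norm_mult)
    qed (use \<kappa> pi_ge_two in \<open>auto simp: X_def\<close>)
    hence "integrable lborel (\<lambda>z. X z * cnj (g z) * of_real (gauss z))"
      by (intro integrable_fock_product fock_spaceD(2,3)[OF g]) auto
    hence "integrable lborel (\<lambda>z. cmod l * norm (X z * cnj (g z) * of_real (gauss z)))"
      by (intro integrable_mult_right integrable_norm)
    thus ?thesis by (simp add: D_def[abs_def] X_def P_def norm_mult mult_ac)
  qed
  have sD: "norm (s n z) \<le> D z" for n z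
  proof -
    have "cmod (\<Sum>k<Suc n. l / of_nat (Suc n) * exp (of_nat k * (l * (z - w) / of_nat (Suc n))))
       \<le> (\<Sum>k<Suc n. cmod l / real (Suc n) * exp (cmod l * cmod (z - w)))"
    proof (rule sum_norm_le)
      fix k assume k: "k \<in> {..<Suc n}"
      have "cmod (of_nat k * (l * (z - w) / of_nat (Suc n))) = (real k / real (Suc n)) * (cmod l * cmod (z - w))"
        by (simp add: norm_mult norm_divide del: of_nat_Suc)
      also have "\<dots> \<le> 1 * (cmod l * cmod (z - w))"
        using k by (intro mult_right_mono) auto
      finally have "Re (of_nat k * (l * (z - w) / of_nat (Suc n))) \<le> cmod l * cmod (z - w)"
        unfolding mult_1_left by (rule order_trans[OF complex_Re_le_cmod])
      hence "cmod (exp (of_nat k * (l * (z - w) / of_nat (Suc n)))) \<le> exp (cmod l * cmod (z - w))"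
        by (simp only: norm_exp_eq_Re exp_le_cancel_iff)
      thus "cmod (l / of_nat (Suc n) * exp (of_nat k * (l * (z - w) / of_nat (Suc n)))) \<le> cmod l / real (Suc n) * exp (cmod l * cmod (z - w))"
        by (simp add: norm_mult norm_divide mult_left_mono divide_right_mono del: of_nat_Suc)
    qed
    also have "\<dots> = cmod l * exp (cmod l * cmod (z - w))" by (simp del: of_nat_Suc sum.lessThan_Suc)
    finally show ?thesis
      by (simp add: s_def D_def norm_mult mult_right_mono flip: mult.assoc del: sum.lessThan_Suc of_nat_Suc)
  qed
  have ae: "AE z in lborel. (\<lambda>n. s n z) \<longlonglongrightarrow> (exp (l * (z - w)) - 1) / (z - w) * P z"
  proof -
    have "AE z in lborel. z \<noteq> w" by (rule AE_lborel_singleton)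
    thus ?thesis
    proof eventually_elim
      case (elim z)
      hence "z - w \<noteq> 0" by simp
      from riemann_sum_exp_tendsto[OF this, of l] show ?case unfolding s_def by (intro tendsto_mult tendsto_const)
    qed
  qed
  have ms: "s n \<in> borel_measurable lborel" for n unfolding s_eq[abs_def] by measurable
  have mf: "(\<lambda>z. (exp (l * (z - w)) - 1) / (z - w) * P z) \<in> borel_measurable lborel" by measurable
  have "(\<lambda>n. LINT z|lborel. s n z) \<longlonglongrightarrow> (LINT z|lborel. (exp (l * (z - w)) - 1) / (z - w) * P z)"
    by (rule integral_dominated_convergence[OF mf ms intD ae]) (use sD in auto)
  hence "(LINT z|lborel. (exp (l * (z - w)) - 1) / (z - w) * P z) = 0"
    unfolding ints by (simp add: LIMSEQ_const_iff)
  thus "(LINT z|lborel. (exp (l * (z - w)) - 1) / (z - w) * (F z * cnj (g z) * of_real (gauss z))) = 0"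
    by (simp add: P_def)
  have "integrable lborel (\<lambda>z. (exp (l * (z - w)) - 1) / (z - w) * P z)"
    by (rule integrable_dominated_convergence[OF mf ms intD ae]) (use sD in auto)
  thus "integrable lborel (\<lambda>z. (exp (l * (z - w)) - 1) / (z - w) * (F z * cnj (g z) * of_real (gauss z)))"
    by (simp add: P_def)
qed

section \<open>The interpolation function at touching points\<close>

text \<open>
  The square root of the weight, which is shared between the two factors of a product.
\<close>
definition half_gauss :: "complex \<Rightarrow> real" where
  "half_gauss z = exp (- (pi / 2) * (cmod z)^2)"

text \<open>
  The modulus of the Cauchy kernel times the Gaussian that remains when the opening 1 of the
  touching paraboloid is subtracted from the exponent $\pi/2$ of the half weight.
\<close>
definition sing_gauss :: "complex \<Rightarrow> real" where
  "sing_gauss z = exp (- (pi / 2 - 1) * (cmod z)^2) / cmod z"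

lemma half_gauss_square: "half_gauss z * half_gauss z = gauss z"
  by (simp add: half_gauss_def gauss_def mult_exp_exp)

lemma half_gauss_pos [simp]: "half_gauss z > 0" "half_gauss z \<ge> 0"
  by (simp_all add: half_gauss_def)

lemma sing_gauss_nonneg [simp]: "sing_gauss z \<ge> 0"
  by (simp add: sing_gauss_def)

lemma half_gauss_measurable [measurable]: "half_gauss \<in> borel_measurable borel"
  unfolding half_gauss_def by measurable

lemma sing_gauss_measurable [measurable]: "sing_gauss \<in> borel_measurable borel"
  unfolding sing_gauss_def by measurable

text \<open>
  The exponent $l$ cancels the terms of $|z-y|^2 - |w-y|^2 - \frac{\pi}{2}(|z|^2 - |w|^2)$ that are
  linear in $z - w$; what remains is $-(\pi/2 - 1)|z-w|^2$.
\<close>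
lemma contact_exp_bound:
  assumes w: "w \<in> contact_set F 1 UNIV"
  shows "\<exists>l. \<forall>z. cmod (exp (l * (z - w)) * F z) * half_gauss z
    \<le> cmod (F w) * half_gauss w * exp (- (pi / 2 - 1) * (cmod (z - w))^2)"
proof -
  define y where "y = foot F 1 w"
  have t: "cmod (F z) * exp (- 1 * (cmod (z - y))^2) \<le> cmod (F w) * exp (- 1 * (cmod (w - y))^2)" for z
    using w by (simp add: contact_set_def touches_def y_def)
  \<comment> \<open>conjugate of the difference between the gradients at w of (pi/2)|z|^2 and of |z-y|^2\<close>
  define l where "l = of_real pi * cnj w - 2 * cnj (w - y)"
  have "cmod (exp (l * (z - w)) * F z) * half_gauss z
    \<le> cmod (F w) * half_gauss w * exp (- (pi / 2 - 1) * (cmod (z - w))^2)" for z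
  proof -
    define \<zeta> where "\<zeta> = z - w"
    have z: "z = w + \<zeta>" by (simp add: \<zeta>_def)
    have "cmod (F z) \<le> cmod (F w) * exp ((cmod (z - y))^2 - (cmod (w - y))^2)"
      using t[of z] by (simp add: exp_diff exp_minus field_simps)
    hence "cmod (exp (l * \<zeta>) * F z) * half_gauss z
      \<le> exp (Re (l * \<zeta>)) * (cmod (F w) * exp ((cmod (z - y))^2 - (cmod (w - y))^2)) * half_gauss z"
      unfolding norm_mult norm_exp_eq_Re by (intro mult_right_mono mult_left_mono) auto
    also have "\<dots> = cmod (F w) * exp (Re (l * \<zeta>) + ((cmod (z - y))^2 - (cmod (w - y))^2) + - (pi / 2) * (cmod z)^2)"
      unfolding half_gauss_def exp_add by (simp only: mult_ac)
    also have "Re (l * \<zeta>) + ((cmod (z - y))^2 - (cmod (w - y))^2) + - (pi / 2) * (cmod z)^2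
       = - (pi / 2) * (cmod w)^2 + - (pi / 2 - 1) * (cmod \<zeta>)^2"
      unfolding cmod_power2 z l_def by (simp add: power2_eq_square algebra_simps)
    finally show ?thesis unfolding exp_add half_gauss_def \<zeta>_def by (simp only: mult_ac)
  qed
  thus ?thesis by blast
qed

lemma nn_integral_translate:
  fixes f :: "complex \<Rightarrow> ennreal"
  assumes [measurable]: "f \<in> borel_measurable borel"
  shows "(\<integral>\<^sup>+z. f (z - w) \<partial>lborel) = (\<integral>\<^sup>+z. f z \<partial>lborel)"
proof -
  have "(\<integral>\<^sup>+z. f z \<partial>lborel) = (\<integral>\<^sup>+z. f z \<partial>distr lborel borel ((+) (- w)))"
    by (simp only: lborel_distr_plus)
  also have "\<dots> = (\<integral>\<^sup>+z. f (- w + z) \<partial>lborel)" by (intro nn_integral_distr) auto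
  finally show ?thesis by simp
qed

text \<open>
  A special case of Young's inequality: the product is at most the sum of the squares, and the
  kernel is integrable.
\<close>
lemma nn_integral_convolution_finite:
  fixes \<Gamma> \<gamma> :: "complex \<Rightarrow> real"
  assumes [measurable]: "\<Gamma> \<in> borel_measurable borel" "\<gamma> \<in> borel_measurable borel"
    and fin: "(\<integral>\<^sup>+z. ennreal ((\<Gamma> z)^2) \<partial>lborel) < \<infinity>" "(\<integral>\<^sup>+z. ennreal ((\<gamma> z)^2) \<partial>lborel) < \<infinity>"
  shows "(\<integral>\<^sup>+w. (\<integral>\<^sup>+z. ennreal (\<Gamma> w * \<gamma> z * sing_gauss (z - w)) \<partial>lborel) \<partial>lborel) < \<infinity>"
proof -
  define I where "I = (\<integral>\<^sup>+z. ennreal (sing_gauss z) \<partial>lborel)"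
  have I: "I < \<infinity>" unfolding I_def sing_gauss_def
    by (rule nn_integral_singular_gaussian_finite) (use pi_gt3 in simp)
  have It: "(\<integral>\<^sup>+z. ennreal (sing_gauss (z - w)) \<partial>lborel) = I" for w
    unfolding I_def by (rule nn_integral_translate) measurable
  have even: "sing_gauss (z - w) = sing_gauss (w - z)" for z w
    by (simp add: sing_gauss_def norm_minus_commute)
  have le: "ennreal (\<Gamma> w * \<gamma> z * sing_gauss (z - w)) \<le> ennreal ((\<Gamma> w)^2) * ennreal (sing_gauss (z - w)) + ennreal ((\<gamma> z)^2) * ennreal (sing_gauss (z - w))" for z w
  proof -
    have "0 \<le> (\<Gamma> w - \<gamma> z)^2" "0 \<le> (\<Gamma> w)^2" "0 \<le> (\<gamma> z)^2" by auto
    hence "\<Gamma> w * \<gamma> z \<le> (\<Gamma> w)^2 + (\<gamma> z)^2" unfolding power2_diff by linarith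
    hence "\<Gamma> w * \<gamma> z * sing_gauss (z - w) \<le> ((\<Gamma> w)^2 + (\<gamma> z)^2) * sing_gauss (z - w)"
      by (intro mult_right_mono) auto
    hence "ennreal (\<Gamma> w * \<gamma> z * sing_gauss (z - w)) \<le> ennreal ((\<Gamma> w)^2 * sing_gauss (z - w) + (\<gamma> z)^2 * sing_gauss (z - w))"
      by (intro ennreal_leI) (simp add: distrib_right)
    thus ?thesis by (simp add: ennreal_mult)
  qed
  have "(\<integral>\<^sup>+w. (\<integral>\<^sup>+z. ennreal (\<Gamma> w * \<gamma> z * sing_gauss (z - w)) \<partial>lborel) \<partial>lborel)
     \<le> (\<integral>\<^sup>+w. (\<integral>\<^sup>+z. ennreal ((\<Gamma> w)^2) * ennreal (sing_gauss (z - w)) + ennreal ((\<gamma> z)^2) * ennreal (sing_gauss (z - w)) \<partial>lborel) \<partial>lborel)"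
    by (intro nn_integral_mono le)
  also have "\<dots> = (\<integral>\<^sup>+w. (ennreal ((\<Gamma> w)^2) * I + (\<integral>\<^sup>+z. ennreal ((\<gamma> z)^2) * ennreal (sing_gauss (z - w)) \<partial>lborel)) \<partial>lborel)"
    by (subst nn_integral_add) (auto simp: nn_integral_cmult It)
  also have "\<dots> = (\<integral>\<^sup>+w. ennreal ((\<Gamma> w)^2) * I \<partial>lborel) + (\<integral>\<^sup>+w. (\<integral>\<^sup>+z. ennreal ((\<gamma> z)^2) * ennreal (sing_gauss (z - w)) \<partial>lborel) \<partial>lborel)"
    by (rule nn_integral_add) measurable
  also have "(\<integral>\<^sup>+w. (\<integral>\<^sup>+z. ennreal ((\<gamma> z)^2) * ennreal (sing_gauss (z - w)) \<partial>lborel) \<partial>lborel)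
     = (\<integral>\<^sup>+z. (\<integral>\<^sup>+w. ennreal ((\<gamma> z)^2) * ennreal (sing_gauss (z - w)) \<partial>lborel) \<partial>lborel)"
    by (rule lborel_pair.Fubini') measurable
  also have "\<dots> = (\<integral>\<^sup>+z. ennreal ((\<gamma> z)^2) * I \<partial>lborel)"
    by (subst even, subst nn_integral_cmult) (auto simp: It)
  also have "(\<integral>\<^sup>+w. ennreal ((\<Gamma> w)^2) * I \<partial>lborel) + (\<integral>\<^sup>+z. ennreal ((\<gamma> z)^2) * I \<partial>lborel) < \<infinity>"
    using fin I by (simp add: nn_integral_multc ennreal_mult_less_top)
  finally show ?thesis .
qed

text \<open>
  Adding a multiple of the vanishing integral from \<open>orthogonal_exp_quotient\<close> turns the
  integrand into $(z\,h(z) - w\,h(w) e^{l(z-w)}) F(z)/(z-w)$ times the conjugate of $g$ and the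
  weight. The two terms are estimated separately, the second by the choice of $l$ at a touching
  point.
\<close>
lemma interpolation_bound_at_contact:
  assumes hol: "F holomorphic_on UNIV" and gr: "\<And>z. cmod (F z) \<le> C * exp (\<kappa> * (cmod z)^2)" and \<kappa>: "\<kappa> \<le> 1 / 4"
    and g: "g \<in> fock_space" and orth: "\<And>l. fock_inner (\<lambda>z. exp (l * z) * F z) g = 0"
    and h: "h holomorphic_on UNIV" and hF: "(\<lambda>z. h z * F z) \<in> fock_space"
    and w: "w \<in> contact_set F 1 UNIV"
  shows "ennreal (pi * cmod (interpolant F g h w))
    \<le> (\<integral>\<^sup>+z. ennreal (cmod z * (cmod (h z * F z) * cmod (g z) * gauss z) * (1 / cmod (z - w))) \<partial>lborel)
     + ennreal (cmod w) * (\<integral>\<^sup>+z. ennreal ((cmod (h w * F w) * half_gauss w) * (cmod (g z) * half_gauss z) * sing_gauss (z - w)) \<partial>lborel)"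
proof -
  have F: "F \<in> fock_space" using exp_multiple_in_fock[OF hol gr \<kappa>, of 0] by simp
  have [measurable]: "F \<in> borel_measurable borel" "g \<in> borel_measurable borel" "h \<in> borel_measurable borel"
    using entire_measurable[OF hol] entire_measurable[OF h] fock_spaceD(2)[OF g] by auto
  obtain l where l: "\<And>z. cmod (exp (l * (z - w)) * F z) * half_gauss z
    \<le> cmod (F w) * half_gauss w * exp (- (pi / 2 - 1) * (cmod (z - w))^2)"
    using contact_exp_bound[OF w] by blast
  define P where "P z = F z * cnj (g z) * of_real (gauss z)" for z
  define Y where "Y z = h z * F z * cnj (g z) * of_real (gauss z) + w * (divdiff h w z * F z * cnj (g z) * of_real (gauss z))
     - w * h w * ((exp (l * (z - w)) - 1) / (z - w) * P z)" for z
  note oq = orthogonal_exp_quotient[OF hol gr \<kappa> g orth, of l w, folded P_def]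
  note i1 = integrable_fock_inner[OF hF g] and i2 = integrable_fock_inner[OF fock_space_divdiff(1)[OF h F hF g] g, of w]
  have iY: "integrable lborel Y"
    unfolding Y_def using i1 i2 oq(1) by (intro Bochner_Integration.integrable_diff Bochner_Integration.integrable_add integrable_mult_right)
  have lin: "(LINT z|lborel. A z + a * B z - b * Q z) = (LINT z|lborel. A z) + a * (LINT z|lborel. B z) - b * (LINT z|lborel. Q z)"
    if "integrable lborel A" "integrable lborel B" "integrable lborel Q" for A B Q :: "complex \<Rightarrow> complex" and a b
    using that by simp
  have "(LINT z|lborel. Y z) = of_real pi * (interpolant F g h w)"
    unfolding Y_def lin[OF i1 i2 oq(1)] oq(2) by (simp add: fock_inner_def distrib_left)
  hence "ennreal (pi * cmod (interpolant F g h w)) = ennreal (norm (LINT z|lborel. Y z))"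
    by (simp add: norm_mult)
  also have "\<dots> \<le> (\<integral>\<^sup>+z. ennreal (norm (Y z)) \<partial>lborel)" by (rule integral_norm_bound_ennreal[OF iY])
  also have "\<dots> \<le> (\<integral>\<^sup>+z. (ennreal (cmod z * (cmod (h z * F z) * cmod (g z) * gauss z) * (1 / cmod (z - w)))
     + ennreal (cmod w) * ennreal ((cmod (h w * F w) * half_gauss w) * (cmod (g z) * half_gauss z) * sing_gauss (z - w))) \<partial>lborel)"
  proof (rule nn_integral_mono_AE)
    have "AE z in lborel. z \<noteq> w" by (rule AE_lborel_singleton)
    thus "AE z in lborel. ennreal (norm (Y z)) \<le> ennreal (cmod z * (cmod (h z * F z) * cmod (g z) * gauss z) * (1 / cmod (z - w)))
     + ennreal (cmod w) * ennreal ((cmod (h w * F w) * half_gauss w) * (cmod (g z) * half_gauss z) * sing_gauss (z - w))"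
    proof eventually_elim
      case (elim z)
      define e where "e = exp (l * (z - w))"
      have eq: "h z + w * divdiff h w z - w * h w * ((e - 1) / (z - w)) = (z * h z - w * h w * e) / (z - w)"
      proof -
        have "A + w * ((A - B) / d) - w * B * ((e - 1) / d) = ((w + d) * A - w * B * e) / d" if "d \<noteq> 0" for A B d
          using that by (simp add: field_simps)
        from this[of "z - w" "h z" "h w"] elim show ?thesis by (simp add: divdiff_def)
      qed
      have "Y z = (h z + w * divdiff h w z - w * h w * ((e - 1) / (z - w))) * P z"
        unfolding Y_def P_def e_def[symmetric] by (simp only: distrib_right left_diff_distrib mult.assoc)
      also have "\<dots> = (z * h z - w * h w * e) / (z - w) * P z" by (simp only: eq)
      also have "\<dots> = z * h z * P z / (z - w) - w * h w * e * P z / (z - w)"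
        by (simp add: diff_divide_distrib algebra_simps)
      finally have "norm (Y z) \<le> norm (z * h z * P z / (z - w)) + norm (w * h w * e * P z / (z - w))"
        using norm_triangle_ineq4 by metis
      moreover have "norm (z * h z * P z / (z - w)) = cmod z * (cmod (h z * F z) * cmod (g z) * gauss z) * (1 / cmod (z - w))"
        by (simp add: P_def norm_mult norm_divide)
      moreover have "norm (w * h w * e * P z / (z - w)) \<le> cmod w * ((cmod (h w * F w) * half_gauss w) * (cmod (g z) * half_gauss z) * sing_gauss (z - w))"
      proof -
        have "norm (w * h w * e * P z / (z - w)) = (cmod w * cmod (h w) * (cmod (g z) * half_gauss z) / cmod (z - w)) * (cmod (e * F z) * half_gauss z)"
          by (simp add: P_def norm_mult norm_divide half_gauss_square[symmetric])
        also have "\<dots> \<le> (cmod w * cmod (h w) * (cmod (g z) * half_gauss z) / cmod (z - w)) * (cmod (F w) * half_gauss w * exp (- (pi / 2 - 1) * (cmod (z - w))^2))"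
          unfolding e_def by (intro mult_left_mono l) auto
        also have "\<dots> = cmod w * ((cmod (h w * F w) * half_gauss w) * (cmod (g z) * half_gauss z) * sing_gauss (z - w))"
          by (simp add: sing_gauss_def norm_mult)
        finally show ?thesis .
      qed
      ultimately have "norm (Y z) \<le> cmod z * (cmod (h z * F z) * cmod (g z) * gauss z) * (1 / cmod (z - w))
        + cmod w * ((cmod (h w * F w) * half_gauss w) * (cmod (g z) * half_gauss z) * sing_gauss (z - w))"
        by linarith
      hence "ennreal (norm (Y z)) \<le> ennreal (cmod z * (cmod (h z * F z) * cmod (g z) * gauss z) * (1 / cmod (z - w))
        + cmod w * ((cmod (h w * F w) * half_gauss w) * (cmod (g z) * half_gauss z) * sing_gauss (z - w)))"
        by (rule ennreal_leI)
      thus ?case by (subst (asm) ennreal_plus) (auto simp: ennreal_mult)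
    qed
  qed
  also have "\<dots> = (\<integral>\<^sup>+z. ennreal (cmod z * (cmod (h z * F z) * cmod (g z) * gauss z) * (1 / cmod (z - w))) \<partial>lborel)
     + ennreal (cmod w) * (\<integral>\<^sup>+z. ennreal ((cmod (h w * F w) * half_gauss w) * (cmod (g z) * half_gauss z) * sing_gauss (z - w)) \<partial>lborel)"
    by (subst nn_integral_add) (auto intro: nn_integral_cmult)
  finally show ?thesis .
qed

section \<open>Mean size of the interpolation function\<close>

text \<open>
  Integrate the pointwise bound over $w$ and exchange the integrals. In the first term the Cauchy
  kernel integrated over the disc gives $\min(|z|/\rho, 1)$ against an integrable function, hence
  $o(\rho^2)$; the second term is $O(\rho)$ by the convolution estimate.
\<close>
lemma interpolation_integral_bound:
  assumes hol: "F holomorphic_on UNIV" and gr: "\<And>z. cmod (F z) \<le> C * exp (\<kappa> * (cmod z)^2)" and \<kappa>: "\<kappa> \<le> 1 / 4"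
    and g: "g \<in> fock_space" and orth: "\<And>l. fock_inner (\<lambda>z. exp (l * z) * F z) g = 0"
    and h: "h holomorphic_on UNIV" and hF: "(\<lambda>z. h z * F z) \<in> fock_space"
  shows "\<exists>c\<ge>0. \<forall>\<rho>>0. \<forall>A\<in>sets borel. A \<subseteq> ball 0 \<rho> \<inter> contact_set F 1 UNIV \<longrightarrow>
    (\<integral>\<^sup>+w. indicator A w * ennreal (pi * cmod (interpolant F g h w)) \<partial>lborel)
    \<le> ennreal (24 * pi * \<rho>^2 * (LINT z|lborel. cmod (h z * F z) * cmod (g z) * gauss z * min (cmod z / \<rho>) 1) + \<rho> * c)"
proof -
  have [measurable]: "F \<in> borel_measurable borel" "g \<in> borel_measurable borel" "h \<in> borel_measurable borel"
    using entire_measurable[OF hol] entire_measurable[OF h] fock_spaceD(2)[OF g] by auto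
  define k where "k z = cmod (h z * F z) * cmod (g z) * gauss z" for z
  have k0: "k z \<ge> 0" for z by (simp add: k_def)
  have [measurable]: "k \<in> borel_measurable borel" unfolding k_def by measurable
  have ik: "integrable lborel k"
    using integrable_norm[OF integrable_fock_inner[OF hF g]] by (simp add: k_def[abs_def] norm_mult)
  define \<Gamma> where "\<Gamma> w = cmod (h w * F w) * half_gauss w" for w
  define \<gamma> where "\<gamma> z = cmod (g z) * half_gauss z" for z
  have [measurable]: "\<Gamma> \<in> borel_measurable borel" "\<gamma> \<in> borel_measurable borel" unfolding \<Gamma>_def \<gamma>_def by measurable
  define C2 where "C2 = (\<integral>\<^sup>+w. (\<integral>\<^sup>+z. ennreal (\<Gamma> w * \<gamma> z * sing_gauss (z - w)) \<partial>lborel) \<partial>lborel)"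
  have sq: "(\<integral>\<^sup>+z. ennreal ((cmod (X z) * half_gauss z)^2) \<partial>lborel) < \<infinity>" if "X \<in> fock_space" for X
  proof -
    have "(\<integral>\<^sup>+z. ennreal ((cmod (X z) * half_gauss z)^2) \<partial>lborel) = (\<integral>\<^sup>+z. ennreal ((cmod (X z))^2 * gauss z) \<partial>lborel)"
      by (simp add: power_mult_distrib power2_eq_square[of "half_gauss _"] half_gauss_square)
    also have "\<dots> = ennreal (LINT z|lborel. (cmod (X z))^2 * gauss z)"
      by (intro nn_integral_eq_integral fock_spaceD(3) that) auto
    finally show ?thesis by simp
  qed
  have C2: "C2 < \<infinity>" unfolding C2_def
    using sq[OF hF] sq[OF g] by (intro nn_integral_convolution_finite) (simp_all add: \<Gamma>_def \<gamma>_def)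
  define c where "c = enn2real C2"
  have c: "c \<ge> 0" "C2 = ennreal c" using C2 by (simp_all add: c_def)
  have "(\<integral>\<^sup>+w. indicator A w * ennreal (pi * cmod (interpolant F g h w)) \<partial>lborel)
    \<le> ennreal (24 * pi * \<rho>^2 * (LINT z|lborel. k z * min (cmod z / \<rho>) 1) + \<rho> * c)"
    if \<rho>: "\<rho> > 0" and A: "A \<in> sets borel" "A \<subseteq> ball 0 \<rho> \<inter> contact_set F 1 UNIV" for \<rho> A
  proof -
    have [measurable]: "A \<in> sets borel" by (rule A)
    have ikm: "integrable lborel (\<lambda>z. k z * min (cmod z / \<rho>) 1)"
    proof (rule Bochner_Integration.integrable_bound[OF ik])
      show "AE z in lborel. norm (k z * min (cmod z / \<rho>) 1) \<le> norm (k z)"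
        using k0 \<rho> by (auto simp: abs_mult intro!: mult_left_le)
    qed measurable
    let ?B = "\<lambda>w z. indicator (ball 0 \<rho>) w * ennreal (cmod z * k z * (1 / cmod (z - w)))" and ?S = "\<lambda>w. (\<integral>\<^sup>+z. ennreal (\<Gamma> w * \<gamma> z * sing_gauss (z - w)) \<partial>lborel)"
    let ?J = "LINT z|lborel. k z * min (cmod z / \<rho>) 1"
    have T1: "(\<integral>\<^sup>+w. (\<integral>\<^sup>+z. ?B w z \<partial>lborel) \<partial>lborel)
      \<le> ennreal (24 * pi * \<rho>^2 * ?J)"
    proof -
      have "(\<integral>\<^sup>+w. (\<integral>\<^sup>+z. ?B w z \<partial>lborel) \<partial>lborel)
        = (\<integral>\<^sup>+z. (\<integral>\<^sup>+w. ?B w z \<partial>lborel) \<partial>lborel)"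
        by (rule lborel_pair.Fubini') measurable
      also have "\<dots> \<le> (\<integral>\<^sup>+z. ennreal (24 * pi * \<rho>^2) * ennreal (k z * min (cmod z / \<rho>) 1) \<partial>lborel)"
      proof (rule nn_integral_mono)
        fix z :: complex
        have "(\<integral>\<^sup>+w. ?B w z \<partial>lborel)
          = (\<integral>\<^sup>+w. ennreal (k z) * (ennreal (cmod z) * (indicator (ball 0 \<rho>) w * ennreal (1 / cmod (z - w)))) \<partial>lborel)"
        proof (rule nn_integral_cong)
          fix w :: complex
          have "ennreal (cmod z * k z * (1 / cmod (z - w))) = ennreal (cmod z) * ennreal (k z) * ennreal (1 / cmod (z - w))"
            using k0 by (simp only: ennreal_mult norm_ge_zero mult_nonneg_nonneg divide_nonneg_nonneg zero_le_one)
          thus "?B w z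
            = ennreal (k z) * (ennreal (cmod z) * (indicator (ball 0 \<rho>) w * ennreal (1 / cmod (z - w))))"
            by (simp only: mult_ac)
        qed
        also have "\<dots> = ennreal (k z) * (ennreal (cmod z) * (\<integral>\<^sup>+w. indicator (ball 0 \<rho>) w * ennreal (1 / cmod (z - w)) \<partial>lborel))"
          by (subst nn_integral_cmult, measurable, subst nn_integral_cmult, measurable)
        also have "\<dots> \<le> ennreal (k z) * ennreal (24 * pi * \<rho> * min (cmod z) \<rho>)"
          by (intro mult_left_mono nn_integral_inverse_dist_centred \<rho>) simp
        also have "\<dots> = ennreal (k z * (24 * pi * \<rho> * min (cmod z) \<rho>))"
          using k0 \<rho> by (intro ennreal_mult[symmetric]) auto
        also have "k z * (24 * pi * \<rho> * min (cmod z) \<rho>) = (24 * pi * \<rho>^2) * (k z * min (cmod z / \<rho>) 1)"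
          using \<rho> by (simp add: min_def power2_eq_square field_simps)
        also have "ennreal \<dots> = ennreal (24 * pi * \<rho>^2) * ennreal (k z * min (cmod z / \<rho>) 1)"
          using k0 \<rho> by (intro ennreal_mult) auto
        finally show "(\<integral>\<^sup>+w. ?B w z \<partial>lborel)
          \<le> ennreal (24 * pi * \<rho>^2) * ennreal (k z * min (cmod z / \<rho>) 1)" .
      qed
      also have "\<dots> = ennreal (24 * pi * \<rho>^2) * ennreal ?J"
        using k0 \<rho> by (subst nn_integral_cmult) (auto simp: nn_integral_eq_integral[OF ikm])
      also have "\<dots> = ennreal (24 * pi * \<rho>^2 * ?J)"
        using k0 \<rho> by (intro ennreal_mult[symmetric] integral_nonneg_AE) auto
      finally show ?thesis .
    qed
    have "(\<integral>\<^sup>+w. indicator A w * ennreal (pi * cmod (interpolant F g h w)) \<partial>lborel)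
      \<le> (\<integral>\<^sup>+w. ((\<integral>\<^sup>+z. ?B w z \<partial>lborel)
         + ennreal \<rho> * ?S w) \<partial>lborel)"
    proof (rule nn_integral_mono)
      fix w
      show "indicator A w * ennreal (pi * cmod (interpolant F g h w))
        \<le> (\<integral>\<^sup>+z. ?B w z \<partial>lborel)
         + ennreal \<rho> * ?S w"
      proof (cases "w \<in> A")
        case True
        hence w: "w \<in> contact_set F 1 UNIV" "cmod w \<le> \<rho>" "w \<in> ball 0 \<rho>" using A by auto
        have "ennreal (cmod w) * ?S w
          \<le> ennreal \<rho> * ?S w"
          using w by (intro mult_right_mono ennreal_leI) auto
        from order_trans[OF interpolation_bound_at_contact[OF hol gr \<kappa> g orth h hF w(1)] add_left_mono[OF this[unfolded \<Gamma>_def \<gamma>_def]]]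
        show ?thesis using True w by (simp add: k_def \<Gamma>_def \<gamma>_def)
      qed simp
    qed
    also have "\<dots> = (\<integral>\<^sup>+w. (\<integral>\<^sup>+z. ?B w z \<partial>lborel) \<partial>lborel) + ennreal \<rho> * C2"
      unfolding C2_def by (subst nn_integral_add, measurable, subst nn_integral_cmult, measurable)
    also have "\<dots> \<le> ennreal (24 * pi * \<rho>^2 * ?J) + ennreal \<rho> * ennreal c"
      using T1 unfolding c by (intro add_right_mono)
    also have "\<dots> = ennreal (24 * pi * \<rho>^2 * ?J + \<rho> * c)"
    proof -
      have "0 \<le> ?J" using k0 \<rho> by (intro integral_nonneg_AE) auto
      thus ?thesis using \<rho> c by (simp add: ennreal_plus ennreal_mult)
    qed
    finally show ?thesis .
  qed
  thus ?thesis using c(1) unfolding k_def by blast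
qed

section \<open>Spectral synthesis for functions of small type\<close>

text \<open>
  The growth of the pairing is that of $h$ on unit discs, and $h$ is the quotient of $hF$ by $F$.
\<close>
lemma order_two_interpolation:
  assumes hol: "F holomorphic_on UNIV" and p: "F p \<noteq> 0" and F2: "order_two F"
    and F: "F \<in> fock_space" and g: "g \<in> fock_space"
    and h: "h holomorphic_on UNIV" and hF: "(\<lambda>z. h z * F z) \<in> fock_space"
  shows "order_two (\<lambda>w. a + w * (b * divdiff_pairing F g h w))"
proof -
  have shift: "1 + (cmod \<zeta>)^2 \<le> 35 * (1 + (cmod w)^2)" if "cmod \<zeta> \<le> 1 + cmod w" for \<zeta> w :: complex
    using one_plus_square_shift[of "cmod \<zeta>" 1 "cmod w"] that by simp
  have "order_two h"
  proof (rule order_two_quotient[OF hol h p F2], rule order_twoI)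
    fix z
    have "1 + (cmod z + 1)^2 \<le> 35 * (1 + (cmod z)^2)"
      using one_plus_square_shift[of "cmod z + 1" 1 "cmod z"] by simp
    hence "exp (pi * (cmod z + 1)^2) \<le> exp (pi * (35 * (1 + (cmod z)^2)))" by simp
    hence "exp (pi * (cmod z + 1)^2) * fock_norm (\<lambda>z. h z * F z) \<le> exp (pi * (35 * (1 + (cmod z)^2))) * fock_norm (\<lambda>z. h z * F z)"
      by (rule mult_right_mono) (rule fock_norm_nonneg)
    with fock_pointwise_bound[OF hF, of z]
    show "cmod (h z * F z) \<le> fock_norm (\<lambda>z. h z * F z) * exp ((35 * pi) * (1 + (cmod z)^2))"
      by (simp add: mult_ac)
  qed
  then obtain c where c: "\<And>z. cmod (h z) \<le> exp (c * (1 + (cmod z)^2))" unfolding order_two_def by blast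
  obtain N where N: "\<And>w B. (\<forall>\<zeta>. cmod (\<zeta> - w) \<le> 1 \<longrightarrow> cmod (h \<zeta>) \<le> B) \<Longrightarrow>
      cmod (divdiff_pairing F g h w) \<le> N * (1 + B)"
    using fock_space_divdiff(2)[OF h F hF g] by blast
  define d where "d = 35 * \<bar>c\<bar>"
  have "cmod (a + w * (b * divdiff_pairing F g h w))
      \<le> (cmod a + cmod b * (\<bar>N\<bar> * 2)) * exp ((1 + d) * (1 + (cmod w)^2))" for w
  proof -
    define X where "X = 1 + (cmod w)^2"
    define E where "E = exp (d * X)"
    have X: "X \<ge> 1" by (simp add: X_def)
    have E: "E \<ge> 1" unfolding E_def using X by (simp add: d_def)
    have "cmod (h \<zeta>) \<le> E" if "cmod (\<zeta> - w) \<le> 1" for \<zeta>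
    proof -
      have "c * (1 + (cmod \<zeta>)^2) \<le> \<bar>c\<bar> * (1 + (cmod \<zeta>)^2)" by (intro mult_right_mono) auto
      also have "\<dots> \<le> \<bar>c\<bar> * (35 * X)"
        unfolding X_def using that norm_triangle_sub[of \<zeta> w] by (intro mult_left_mono shift) auto
      finally have "exp (c * (1 + (cmod \<zeta>)^2)) \<le> E" by (simp add: E_def d_def)
      with c show ?thesis by (rule order_trans)
    qed
    hence "cmod (divdiff_pairing F g h w) \<le> N * (1 + E)" by (intro N) blast
    also have "\<dots> \<le> \<bar>N\<bar> * (2 * E)" using E by (intro mult_mono) auto
    finally have \<Phi>: "cmod (divdiff_pairing F g h w) \<le> \<bar>N\<bar> * (2 * E)" .
    have "cmod w \<le> X" using zero_le_power2[of "cmod w - 1 / 2"] by (simp add: X_def power2_eq_square algebra_simps)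
    also have "\<dots> \<le> exp X" using exp_ge_add_one_self[of X] by linarith
    finally have w: "cmod w \<le> exp X" .
    have "1 * 1 \<le> exp X * E" using E X by (intro mult_mono) auto
    hence T: "cmod a * 1 \<le> cmod a * (exp X * E)" by (intro mult_left_mono) auto
    have "cmod (a + w * (b * divdiff_pairing F g h w))
        \<le> cmod a + cmod w * (cmod b * cmod (divdiff_pairing F g h w))"
      by (rule order_trans[OF norm_triangle_ineq]) (simp add: norm_mult)
    also have "\<dots> \<le> cmod a * (exp X * E) + exp X * (cmod b * (\<bar>N\<bar> * (2 * E)))"
      using E T by (intro add_mono mult_mono w \<Phi>) auto
    also have "\<dots> = (cmod a + cmod b * (\<bar>N\<bar> * 2)) * exp ((1 + d) * X)"
      by (simp add: E_def exp_add distrib_right algebra_simps)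
    finally show ?thesis by (simp add: X_def)
  qed
  thus ?thesis by (rule order_twoI)
qed

text \<open>
  The normalised interpolation function exceeds 1 on area $\pi R^2/16$ of the disc of radius $3R$,
  for arbitrarily large $R$. At most $0.03\,\pi R^2$ of this lies outside the touching points of
  $F$, so the integral of its modulus over the touching points is at least a multiple of $R^2$,
  contrary to \<open>interpolation_integral_bound\<close>.
\<close>
lemma fock_inner_multiple_eq_0:
  fixes \<kappa> :: real
  defines "\<kappa> \<equiv> 1 / 10 ^ 15"
  assumes hol: "F holomorphic_on UNIV" and p: "F p \<noteq> 0"
    and gr: "\<And>z. cmod (F z) \<le> C * exp (\<kappa> * (cmod z)^2)"
    and g: "g \<in> fock_space" and orth: "\<And>l. fock_inner (\<lambda>z. exp (l * z) * F z) g = 0"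
    and h: "h holomorphic_on UNIV" and hF: "(\<lambda>z. h z * F z) \<in> fock_space"
  shows "fock_inner (\<lambda>z. h z * F z) g = 0"
proof (rule ccontr)
  define L where "L = fock_inner (\<lambda>z. h z * F z) g"
  assume "fock_inner (\<lambda>z. h z * F z) g \<noteq> 0"
  hence L: "L \<noteq> 0" by (simp add: L_def)
  have \<kappa>: "0 \<le> \<kappa>" "\<kappa> \<le> 1 / 4" by (auto simp: \<kappa>_def)
  have F: "F \<in> fock_space" using exp_multiple_in_fock[OF hol gr \<kappa>(2), of 0] by simp
  have [measurable]: "F \<in> borel_measurable borel" "g \<in> borel_measurable borel" "h \<in> borel_measurable borel"
    using entire_measurable[OF hol] entire_measurable[OF h] fock_spaceD(2)[OF g] by auto
  define \<Phi> where "\<Phi> w = divdiff_pairing F g h w" for w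
  \<comment> \<open>scaled so that K 0 = 2, as superlevel sets refer to the level 1\<close>
  define K where "K w = 2 + w * (2 / L * \<Phi> w)" for w
  have K_eq: "K w = 2 / L * (L + w * \<Phi> w)" for w using L by (simp add: K_def field_simps)
  have holK: "K holomorphic_on UNIV"
    unfolding K_def \<Phi>_def by (intro holomorphic_intros holomorphic_fock_inner_divdiff[OF h F hF g])
  have [measurable]: "K \<in> borel_measurable borel" by (rule entire_measurable[OF holK])
  have "order_two F"
  proof (rule order_twoI)
    fix z
    have "\<kappa> * (cmod z)^2 \<le> \<kappa> * (1 + (cmod z)^2)" using \<kappa> by (intro mult_left_mono) auto
    hence "exp (\<kappa> * (cmod z)^2) \<le> exp (\<kappa> * (1 + (cmod z)^2))" by simp
    hence "C * exp (\<kappa> * (cmod z)^2) \<le> C * exp (\<kappa> * (1 + (cmod z)^2))"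
      using order_trans[OF norm_ge_zero gr[of 0]] by (intro mult_left_mono) auto
    with gr show "cmod (F z) \<le> C * exp (\<kappa> * (1 + (cmod z)^2))" by (rule order_trans)
  qed
  from order_two_interpolation[OF hol p this F g h hF, of 2 "2 / L"]
  have grK: "order_two K" unfolding K_def \<Phi>_def .
  define k where "k z = cmod (h z * F z) * cmod (g z) * gauss z" for z
  have [measurable]: "k \<in> borel_measurable borel" unfolding k_def by measurable
  define J where "J \<rho> = (LINT z|lborel. k z * min (cmod z / \<rho>) 1)" for \<rho>
  obtain c where c: "c \<ge> 0" and bound: "\<And>\<rho> A. \<rho> > 0 \<Longrightarrow> A \<in> sets borel \<Longrightarrow> A \<subseteq> ball 0 \<rho> \<inter> contact_set F 1 UNIV \<Longrightarrow>
    (\<integral>\<^sup>+w. indicator A w * ennreal (pi * cmod (L + w * \<Phi> w)) \<partial>lborel) \<le> ennreal (24 * pi * \<rho>^2 * J \<rho> + \<rho> * c)"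
    using interpolation_integral_bound[OF hol gr \<kappa>(2) g orth h hF] unfolding L_def \<Phi>_def J_def k_def by blast
  have k0: "k z \<ge> 0" for z by (simp add: k_def)
  have J0: "J \<rho> \<ge> 0" if "\<rho> > 0" for \<rho> unfolding J_def using k0 that by (intro integral_nonneg_AE) auto
  have Jlim: "(J \<longlongrightarrow> 0) at_top"
  proof -
    have ik: "integrable lborel k"
      using integrable_norm[OF integrable_fock_inner[OF hF g]] by (simp add: k_def[abs_def] norm_mult)
    have "((\<lambda>\<rho>. LINT z|lborel. k z * min (cmod z / \<rho>) 1) \<longlongrightarrow> (LINT z|(lborel :: complex measure). 0)) at_top"
    proof (rule integral_dominated_convergence_at_top[OF _ _ ik])
      show "AE z in lborel. ((\<lambda>\<rho>. k z * min (cmod z / \<rho>) 1) \<longlongrightarrow> 0) at_top"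
      proof (rule AE_I2)
        fix z
        have "((\<lambda>\<rho>. cmod z / \<rho>) \<longlongrightarrow> 0) at_top" by real_asymp
        hence "((\<lambda>\<rho>. k z * min (cmod z / \<rho>) 1) \<longlongrightarrow> k z * min 0 1) at_top" by (intro tendsto_intros)
        thus "((\<lambda>\<rho>. k z * min (cmod z / \<rho>) 1) \<longlongrightarrow> 0) at_top" by simp
      qed
      show "eventually (\<lambda>\<rho>. AE z in lborel. norm (k z * min (cmod z / \<rho>) 1) \<le> k z) at_top"
        using eventually_gt_at_top[of "0::real"]
      proof eventually_elim
        case (elim \<rho>)
        thus ?case using k0 by (auto simp: abs_mult intro!: mult_left_le)
      qed
    qed measurable
    thus ?thesis by (simp add: J_def[abs_def])
  qed
  have ev1: "eventually (\<lambda>R. J (3 * R) < cmod L / 100000) at_top"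
  proof -
    have "((\<lambda>R. J (3 * R)) \<longlongrightarrow> 0) at_top"
      by (rule filterlim_compose[OF Jlim]) real_asymp
    thus ?thesis using L by (intro order_tendstoD) auto
  qed
  have ev2: "eventually (\<lambda>R. R > 600 * c / cmod L) at_top" by (rule eventually_gt_at_top)
  obtain R0 where R0: "\<And>R. R \<ge> R0 \<Longrightarrow> J (3 * R) < cmod L / 100000 \<and> R > 600 * c / cmod L \<and>
     ennreal (pi * ((3 - 1 / 200) * R)^2) \<le> emeasure lborel (ball 0 (3 * R) \<inter> contact_set F 1 UNIV)"
    using eventually_conj[OF ev1 eventually_conj[OF ev2 contact_set_nearly_full[OF hol p gr[unfolded \<kappa>_def]]]]
    unfolding eventually_at_top_linorder by blast
  have "cmod (K 0) > 1" by (simp add: K_def)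
  from superlevel_area[OF holK this grK, of R0] obtain R where R: "R \<ge> R0" "R > 0"
    and area: "ennreal (pi * (R / 4)^2) \<le> emeasure lborel {z \<in> ball 0 (3 * R). cmod (K z) > 1}" by blast
  define U where "U = {z \<in> ball 0 (3 * R). cmod (K z) > 1}"
  define S where "S = ball 0 (3 * R) \<inter> contact_set F 1 UNIV"
  have U [measurable]: "U \<in> sets borel"
  proof -
    have "{z. cmod (K z) > 1} \<in> sets borel" by measurable
    moreover have "U = ball 0 (3 * R) \<inter> {z. cmod (K z) > 1}" by (auto simp: U_def)
    ultimately show ?thesis by simp
  qed
  have S [measurable]: "S \<in> sets borel" unfolding S_def using borel_contact_set[OF hol, of 1 UNIV] by auto
  have fin: "emeasure lborel T < \<infinity>" if "T \<subseteq> ball 0 (3 * R)" "T \<in> sets borel" for T :: "complex set"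
    using emeasure_mono[OF that(1), of lborel] by (simp add: emeasure_disc R(2) less_imp_le le_less_trans)
  have sub: "U \<subseteq> ball 0 (3 * R)" "S \<subseteq> ball 0 (3 * R)" by (auto simp: U_def S_def)
  have mU: "pi * (R / 4)^2 \<le> measure lborel U"
    using area fin[OF sub(1) U] unfolding U_def[symmetric] by (subst (asm) emeasure_eq_ennreal_measure) auto
  have mS: "pi * ((3 - 1 / 200) * R)^2 \<le> measure lborel S"
    using R0[OF R(1)] fin[OF sub(2) S] unfolding S_def[symmetric] by (subst (asm) emeasure_eq_ennreal_measure) auto
  have mB: "measure lborel (ball (0::complex) (3 * R)) = pi * (3 * R)^2"
    using R(2) by (simp add: measure_def emeasure_disc)
  have fm: "U \<in> fmeasurable lborel" "S \<in> fmeasurable lborel" "ball (0::complex) (3 * R) \<in> fmeasurable lborel"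
    using fin[OF sub(1) U] fin[OF sub(2) S] fin[of "ball 0 (3 * R)"] U S by (auto simp: fmeasurable_def)
  have "measure lborel U \<le> measure lborel ((U \<inter> S) \<union> (ball 0 (3 * R) - S))"
    by (rule measure_mono_fmeasurable) (use fm in \<open>auto simp: U_def\<close>)
  also have "\<dots> \<le> measure lborel (U \<inter> S) + measure lborel (ball 0 (3 * R) - S)"
    by (rule measure_Un_le) auto
  also have "measure lborel (ball 0 (3 * R) - S) = measure lborel (ball (0::complex) (3 * R)) - measure lborel S"
    by (rule measurable_measure_Diff) (use fm S in \<open>auto simp: S_def\<close>)
  finally have "pi * (R / 4)^2 \<le> measure lborel (U \<inter> S) + (pi * (3 * R)^2 - pi * ((3 - 1 / 200) * R)^2)"
    using mU mS mB by linarith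
  moreover have "pi * (R / 4)^2 = 1 / 16 * (pi * R^2)"
    "pi * (3 * R)^2 - pi * ((3 - 1 / 200) * R)^2 = 1199 / 40000 * (pi * R^2)"
    by (simp_all add: power2_eq_square field_simps)
  moreover have "0 \<le> pi * R^2" by simp
  ultimately have mUS: "pi * R^2 * (3 / 100) \<le> measure lborel (U \<inter> S)" by argo
  have "ennreal (pi * R^2 * (3 / 100)) \<le> emeasure lborel (U \<inter> S)"
    using mUS fin[OF le_infI1[OF sub(1), of S]] by (subst emeasure_eq_ennreal_measure) (auto intro: ennreal_leI)
  also have "\<dots> = (\<integral>\<^sup>+w. indicator (U \<inter> S) w \<partial>lborel)" by simp
  also have "\<dots> \<le> (\<integral>\<^sup>+w. ennreal (2 / (pi * cmod L)) * (indicator (U \<inter> S) w * ennreal (pi * cmod (L + w * \<Phi> w))) \<partial>lborel)"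
  proof (rule nn_integral_mono)
    fix w
    show "indicator (U \<inter> S) w \<le> ennreal (2 / (pi * cmod L)) * (indicator (U \<inter> S) w * ennreal (pi * cmod (L + w * \<Phi> w)))"
    proof (cases "w \<in> U \<inter> S")
      case True
      hence "1 \<le> cmod (K w)" by (simp add: U_def)
      also have "cmod (K w) = 2 / (pi * cmod L) * (pi * cmod (L + w * \<Phi> w))"
        unfolding K_eq norm_mult norm_divide by simp
      finally have "ennreal 1 \<le> ennreal (2 / (pi * cmod L) * (pi * cmod (L + w * \<Phi> w)))" by (rule ennreal_leI)
      thus ?thesis using True by (subst (asm) ennreal_mult) auto
    qed simp
  qed
  also have "\<dots> = ennreal (2 / (pi * cmod L)) * (\<integral>\<^sup>+w. indicator (U \<inter> S) w * ennreal (pi * cmod (L + w * \<Phi> w)) \<partial>lborel)"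
  proof (rule nn_integral_cmult)
    have "(\<lambda>w. w * \<Phi> w) \<in> borel_measurable borel"
      unfolding \<Phi>_def by (intro entire_measurable holomorphic_intros holomorphic_fock_inner_divdiff[OF h F hF g])
    hence [measurable]: "(\<lambda>w. w * \<Phi> w) \<in> borel_measurable borel" .
    show "(\<lambda>w. indicator (U \<inter> S) w * ennreal (pi * cmod (L + w * \<Phi> w))) \<in> borel_measurable lborel" by measurable
  qed
  also have "\<dots> \<le> ennreal (2 / (pi * cmod L)) * ennreal (24 * pi * (3 * R)^2 * J (3 * R) + 3 * R * c)"
    using R(2) by (intro mult_left_mono bound sets.Int U S) (auto simp: S_def)
  also have "\<dots> = ennreal (2 / (pi * cmod L) * (24 * pi * (3 * R)^2 * J (3 * R) + 3 * R * c))"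
    using R(2) c J0[of "3 * R"] by (intro ennreal_mult[symmetric]) auto
  finally have "pi * R^2 * (3 / 100) \<le> 2 / (pi * cmod L) * (24 * pi * (3 * R)^2 * J (3 * R) + 3 * R * c)"
    using R(2) c J0[of "3 * R"] by (subst (asm) ennreal_le_iff) auto
  also have "\<dots> = 432 * R^2 * (J (3 * R) / cmod L) + 6 * R * c / (pi * cmod L)"
    using L by (simp add: field_simps power2_eq_square)
  also have "\<dots> < 432 * R^2 * (1 / 100000) + R^2 / 100"
  proof (rule add_strict_mono)
    have "J (3 * R) / cmod L < 1 / 100000" using R0[OF R(1)] L by (simp add: field_simps)
    thus "432 * R^2 * (J (3 * R) / cmod L) < 432 * R^2 * (1 / 100000)"
      using R(2) by (intro mult_strict_left_mono) auto
    have "600 * c / cmod L < R" using R0[OF R(1)] by blast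
    hence "R * (600 * c / cmod L) < R * R" using R(2) by (intro mult_strict_left_mono) auto
    moreover have "6 * R * c / (pi * cmod L) \<le> 6 * R * c / (1 * cmod L)"
      using R(2) c L pi_ge_two by (intro divide_left_mono mult_right_mono) auto
    moreover have "6 * R * c / (1 * cmod L) = R * (600 * c / cmod L) / 100" by simp
    ultimately show "6 * R * c / (pi * cmod L) < R^2 / 100" unfolding power2_eq_square by argo
  qed
  finally have "pi * R^2 * (3 / 100) < R^2 * (1432 / 100000)" by simp
  moreover have "2 * R^2 \<le> pi * R^2" using pi_ge_two by (intro mult_right_mono) auto
  moreover have "R^2 > 0" using R(2) by simp
  ultimately show False by (simp add: field_simps)
qed

lemma entire_multiplesI: "h holomorphic_on UNIV \<Longrightarrow> X = (\<lambda>z. h z * F z) \<Longrightarrow> X \<in> entire_multiples F"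
  by (auto simp: entire_multiples_def entire_functions_def)

lemma entire_multiplesE:
  assumes "X \<in> entire_multiples F"
  obtains h where "h holomorphic_on UNIV" "X = (\<lambda>z. h z * F z)"
  using assms by (auto simp: entire_multiples_def entire_functions_def)

lemma subspace_fock_multiples: "cfun.subspace (fock_space \<inter> entire_multiples F)"
proof (rule cfun.subspaceI)
  show "0 \<in> fock_space \<inter> entire_multiples F"
    by (auto simp: zero_fun_def fock_space_def entire_functions_def intro!: entire_multiplesI[of "\<lambda>_. 0"])
next
  fix X Y assume XY: "X \<in> fock_space \<inter> entire_multiples F" "Y \<in> fock_space \<inter> entire_multiples F"
  obtain a b where ab: "a holomorphic_on UNIV" "X = (\<lambda>z. a z * F z)" "b holomorphic_on UNIV" "Y = (\<lambda>z. b z * F z)"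
    using XY by (auto elim!: entire_multiplesE)
  have "X + Y \<in> entire_multiples F"
    by (rule entire_multiplesI[of "\<lambda>z. a z + b z"])
       (auto simp: ab fun_eq_iff algebra_simps intro!: holomorphic_intros ab)
  thus "X + Y \<in> fock_space \<inter> entire_multiples F" using fock_space_add[of X Y] XY by (simp add: plus_fun_def)
next
  fix c X assume X: "X \<in> fock_space \<inter> entire_multiples F"
  obtain a where a: "a holomorphic_on UNIV" "X = (\<lambda>z. a z * F z)" using X by (auto elim!: entire_multiplesE)
  have "fun_scale c X \<in> entire_multiples F"
    by (rule entire_multiplesI[of "\<lambda>z. c * a z"]) (auto simp: a fun_scale_def intro!: holomorphic_intros a)
  thus "fun_scale c X \<in> fock_space \<inter> entire_multiples F"
    using fock_space_scale[of X c] X by (simp add: fun_scale_def)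
qed

text \<open>
  The definition only speaks about large $|z|$; compactness provides the constant for the rest.
\<close>
lemma entire_order_two_growth:
  assumes F: "F \<in> entire_order_two \<eta>" and \<eta>: "\<eta> < \<kappa>" and \<kappa>: "\<kappa> > 0"
  shows "F holomorphic_on UNIV" "\<exists>C. \<forall>z. cmod (F z) \<le> C * exp (\<kappa> * (cmod z)^2)"
proof -
  show hol: "F holomorphic_on UNIV" using F by (simp add: entire_order_two_def entire_functions_def)
  have "Limsup at_infinity (\<lambda>z. ext_log (cmod (F z)) / ereal ((cmod z)^2)) \<le> ereal \<eta>"
    using F by (simp add: entire_order_two_def)
  also have "\<dots> < ereal \<kappa>" using \<eta> by simp
  finally have "eventually (\<lambda>z. ext_log (cmod (F z)) / ereal ((cmod z)^2) < ereal \<kappa>) at_infinity"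
    by (rule Limsup_lessD)
  then obtain b where b: "\<And>z. cmod z \<ge> b \<Longrightarrow> ext_log (cmod (F z)) / ereal ((cmod z)^2) < ereal \<kappa>"
    unfolding eventually_at_infinity by blast
  obtain B where B: "\<And>z. cmod (z - 0) \<le> max b 1 \<Longrightarrow> cmod (F z) \<le> B"
    using entire_bounded_on_disc[OF hol, of 0 "max b 1"] by metis
  have B0: "B \<ge> 0" using order_trans[OF norm_ge_zero B[of 0]] by simp
  have "cmod (F z) \<le> max B 1 * exp (\<kappa> * (cmod z)^2)" for z
  proof (cases "cmod z \<le> max b 1")
    case True
    hence "cmod (F z) \<le> max B 1 * 1" using B[of z] by simp
    also have "\<dots> \<le> max B 1 * exp (\<kappa> * (cmod z)^2)" using \<kappa> B0 by (intro mult_left_mono) auto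
    finally show ?thesis .
  next
    case False
    have "cmod (F z) \<le> exp (\<kappa> * (cmod z)^2)"
    proof (cases "F z = 0")
      case nz: False
      have z: "z \<noteq> 0" using False by auto
      have "ereal (ln (cmod (F z))) / ereal ((cmod z)^2) < ereal \<kappa>" using b[of z] False nz by (simp add: ext_log_def)
      hence "ln (cmod (F z)) / (cmod z)^2 < \<kappa>" using z by simp
      hence "ln (cmod (F z)) < \<kappa> * (cmod z)^2" using z by (simp add: field_simps)
      hence "exp (ln (cmod (F z))) < exp (\<kappa> * (cmod z)^2)" by (simp only: exp_less_cancel_iff)
      thus ?thesis using nz by simp
    qed simp
    also have "\<dots> \<le> max B 1 * exp (\<kappa> * (cmod z)^2)" by simp
    finally show ?thesis .
  qed
  thus "\<exists>C. \<forall>z. cmod (F z) \<le> C * exp (\<kappa> * (cmod z)^2)" by blast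
qed

theorem theorem1p5:
  shows "\<exists>\<eta>>0. \<forall>F \<in> entire_order_two \<eta>.
    Fock.mtopology closure_of (cfun.span {\<lambda>z. exp_fun l z * F z | l::complex. True})
      = entire_multiples F \<inter> fock_space"
proof (intro exI[of _ "1 / 10 ^ 16"] conjI ballI)
  \<comment> \<open>eta is smaller than kappa so that the upper limit yields a bound with kappa\<close>
  define \<kappa> :: real where "\<kappa> = 1 / 10 ^ 15"
  fix F assume F: "F \<in> entire_order_two (1 / 10 ^ 16)"
  have hol: "F holomorphic_on UNIV" by (rule entire_order_two_growth[OF F, of \<kappa>]) (auto simp: \<kappa>_def)
  obtain C where gr: "\<And>z. cmod (F z) \<le> C * exp (\<kappa> * (cmod z)^2)"
    using entire_order_two_growth(2)[OF F, of \<kappa>] by (auto simp: \<kappa>_def)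
  define G where "G = {\<lambda>z. exp_fun l z * F z | l::complex. True}"
  define Sp where "Sp = cfun.span G"
  have GF: "(\<lambda>z. exp (l * z) * F z) \<in> fock_space" for l
    by (rule exp_multiple_in_fock[OF hol gr]) (simp add: \<kappa>_def)
  have "G \<subseteq> fock_space \<inter> entire_multiples F"
    using GF by (auto simp: G_def exp_fun_def intro!: entire_multiplesI[of "\<lambda>z. exp (_ * z)"] holomorphic_intros)
  hence Sp: "Sp \<subseteq> fock_space \<inter> entire_multiples F"
    unfolding Sp_def by (intro cfun.span_minimal subspace_fock_multiples)
  have lin: "(\<lambda>z. X z + c * Y z) \<in> Sp" if "X \<in> Sp" "Y \<in> Sp" for X Y c
    using cfun.span_add[OF that(1)[unfolded Sp_def] cfun.span_scale[OF that(2)[unfolded Sp_def], of c]]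
    by (simp add: Sp_def plus_fun_def fun_scale_def)
  have "Fock.mtopology closure_of Sp = entire_multiples F \<inter> fock_space"
  proof (intro equalityI subsetI)
    fix X assume "X \<in> Fock.mtopology closure_of Sp"
    hence X: "X \<in> fock_space" "\<And>r. r > 0 \<Longrightarrow> \<exists>Y\<in>Sp. fock_dist X Y < r"
      by (auto simp: Fock.metric_closure_of)
    have "\<exists>Y\<in>Sp. fock_dist X Y < 1 / real (Suc n)" for n by (intro X) auto
    then obtain S where S: "\<And>n. S n \<in> Sp" "\<And>n. fock_dist X (S n) < 1 / real (Suc n)" by metis
    have SF: "S n \<in> fock_space" "S n \<in> entire_multiples F" for n using S(1) Sp by auto
    have lim: "(\<lambda>n. fock_dist (S n) X) \<longlonglongrightarrow> 0"
    proof (rule tendsto_sandwich)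
      show "eventually (\<lambda>n. fock_dist (S n) X \<le> 1 / real (Suc n)) sequentially"
        using S(2) by (intro always_eventually allI) (simp add: Fock.commute[of _ X] less_imp_le)
      show "eventually (\<lambda>n. 0 \<le> fock_dist (S n) X) sequentially" by (simp add: fock_dist_def fock_norm_nonneg)
      show "(\<lambda>n. 1 / real (Suc n)) \<longlonglongrightarrow> 0" by (intro LIMSEQ_Suc lim_1_over_n)
    qed auto
    show "X \<in> entire_multiples F \<inter> fock_space"
    proof (cases "\<exists>p. F p \<noteq> 0")
      case True
      thus ?thesis using entire_multiples_closed[OF hol _ SF X(1) lim] X(1) by blast
    next
      case False
      hence "S n = (\<lambda>z. 0)" for n using SF(2)[of n] by (auto simp: entire_multiples_def)
      hence "fock_dist (\<lambda>z. 0) X = 0" using lim by (simp add: LIMSEQ_const_iff)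
      moreover have "(\<lambda>z. 0) \<in> fock_space" using SF(1) \<open>\<And>n. S n = (\<lambda>z. 0)\<close> by metis
      ultimately have "X = (\<lambda>z. 0)" using X(1) by simp
      thus ?thesis using SF \<open>\<And>n. S n = (\<lambda>z. 0)\<close> by (metis IntI)
    qed
  next
    fix X assume X: "X \<in> entire_multiples F \<inter> fock_space"
    then obtain h where h: "h holomorphic_on UNIV" "X = (\<lambda>z. h z * F z)"
      by (auto simp: entire_multiples_def entire_functions_def)
    show "X \<in> Fock.mtopology closure_of Sp"
    proof (rule ccontr)
      assume "X \<notin> Fock.mtopology closure_of Sp"
      then obtain r where r: "r > 0" "\<And>Y. Y \<in> Sp \<Longrightarrow> fock_dist X Y \<ge> r"
        using X Sp by (force simp: Fock.metric_closure_of not_less)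
      have "Sp \<noteq> {}" unfolding Sp_def using cfun.span_zero by blast
      from fock_orthogonal_complement[OF _ this lin _ r] Sp X
      obtain g where g: "g \<in> fock_space" "\<And>s. s \<in> Sp \<Longrightarrow> fock_inner s g = 0" "fock_inner X g \<noteq> 0" by blast
      have orth: "fock_inner (\<lambda>z. exp (l * z) * F z) g = 0" for l
      proof (rule g(2))
        have "(\<lambda>z. exp (l * z) * F z) \<in> G" by (auto simp: G_def exp_fun_def)
        thus "(\<lambda>z. exp (l * z) * F z) \<in> Sp" unfolding Sp_def by (rule cfun.span_base)
      qed
      have "X \<noteq> (\<lambda>z. 0)" using g(3) by (auto simp: fock_inner_def)
      then obtain p where "F p \<noteq> 0" using h(2) by (auto simp: fun_eq_iff)
      from fock_inner_multiple_eq_0[OF hol this gr[unfolded \<kappa>_def] g(1) orth h(1)] X h(2) g(3)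
      show False by simp
    qed
  qed
  thus "Fock.mtopology closure_of (cfun.span {\<lambda>z. exp_fun l z * F z | l::complex. True}) = entire_multiples F \<inter> fock_space"
    by (simp add: Sp_def G_def)
qed simp

end
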